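(* Consider a stable G/M/1 queue with inter-arrival time LST $G^*$ and service rate $\mu$. Let $R^*$ be the LST of the steady-state residual inter-arrival time at a departure instance conditioned on the queue length left behind (which does not depend on that queue length), let $a_n$ be the steady-state probability of $n$ customers in the system just before an arrival, and let $\pi_n$ be the steady-state probability of $n$ customers in the system at an arbitrary instance. Let $\sigma =G^*(\mu)/(1-R^*(\mu))$. Then $$\frac{\pi_{n+1}}{\pi_n}=\frac{a_{n}}{a_{n-1}}=\sigma,\quad n\ge 1.$$ In particular, the two ratios $\pi_{n+1}/\pi_n$ and $a_n/a_{n-1}$ are not functions of $n$ as long as $n\ge 1$.
   Context: G/M/1 queue: a single-server queue with customers arriving one by one, i.i.d. inter-arrival times with CDF $G$, LST $G^*(s)=\int_0^\infty e^{-sx}\,dG(x)$ and mean $1/\lambda$, and independent i.i.d. exponential service times with rate $\mu$; the service regime is work conserving and non-anticipating. The system is stable: $\lambda<\mu$. Steady-state probabilities and distributions are long-run averages. The probability $a_n$ of $n$ customers just before an arrival equals that of $n$ customers just after a departure. The residual inter-arrival time at a departure instance is the time from that instance until the next arrival. Let $R_n$ and $R_n^*$, $n\ge 0$, be the CDF and LST of its steady-state distribution conditioned on $n$ customers being left behind by the departure. These do not depend on $n$ and the common CDF and LST are denoted $R$ and $R^*$. *)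

theory Defs
  imports "HOL-Probability.Probability"
begin

text \<open>
  The sample path of the queue is generated event by event. An event is the arrival or the departure
  of a customer; customers are numbered \<open>0, 1, \<dots>\<close> in order of arrival. A history is the chronological
  list of the events so far together with their epochs, which is all that a non-anticipating service
  regime may observe. The system starts empty at time \<open>0\<close>.
\<close>

datatype event = is_Arrival: Arrival nat | is_Departure: Departure nat

type_synonym history = "(real \<times> event) list"

definition present :: "history \<Rightarrow> nat set" where
  "present h = {j. Arrival j \<in> snd ` set h \<and> Departure j \<notin> snd ` set h}"

definition num_arrivals :: "history \<Rightarrow> nat" where
  "num_arrivals h = length (filter (\<lambda>e. is_Arrival (snd e)) h)"

definition now :: "history \<Rightarrow> real" where
  "now h = (if h = [] then 0 else fst (last h))"

definition arrival_epoch :: "(nat \<Rightarrow> real) \<Rightarrow> nat \<Rightarrow> real" where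
  "arrival_epoch a k = (\<Sum>i\<le>k. a i)"

definition residual_arrival :: "(nat \<Rightarrow> real) \<Rightarrow> history \<Rightarrow> real" where
  "residual_arrival a h = arrival_epoch a (num_arrivals h) - now h"

text \<open>
  A service regime \<open>\<rho>\<close> makes a plan after every event: \<open>\<rho> v h j u\<close> is the amount of service that
  customer \<open>j\<close> receives during the \<open>u\<close> time units following the last event of \<open>h\<close>, as long as no
  further event interrupts the plan. The number \<open>v\<close> is a seed for regimes that randomise (such as
  service in random order). As no information besides the passage of time becomes available between
  two events, this covers all non-anticipating regimes (preemptive or not, processor sharing,
  time slicing etc.): neither the service times nor future arrivals are arguments of \<open>\<rho>\<close>.
\<close>

type_synonym regime = "real \<Rightarrow> history \<Rightarrow> nat \<Rightarrow> real \<Rightarrow> real"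

definition work_conserving :: "regime \<Rightarrow> bool" where
  "work_conserving \<rho> \<longleftrightarrow>
     (\<forall>v h j. \<rho> v h j 0 = 0 \<and> mono_on {0..} (\<rho> v h j)) \<and>
     (\<forall>v h. \<forall>j. j \<notin> present h \<longrightarrow> (\<forall>u\<ge>0. \<rho> v h j u = 0)) \<and>
     (\<forall>v h. present h \<noteq> {} \<longrightarrow> (\<forall>u\<ge>0. (\<Sum>j\<in>present h. \<rho> v h j u) = u))"

text \<open>
  Measurability in the seed and in the event epochs. Under \<open>work_conserving\<close> a plan is
  1-Lipschitz in \<open>u\<close>, so nothing is needed in that argument.
\<close>

definition measurable_regime :: "regime \<Rightarrow> bool" where
  "measurable_regime \<rho> \<longleftrightarrow>
     (\<forall>es j u. (\<lambda>(v, \<tau>). \<rho> v (zip (map \<tau> [0..<length es]) es) j u)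
        \<in> borel_measurable (borel \<Otimes>\<^sub>M (\<Pi>\<^sub>M i\<in>(UNIV :: nat set). (borel :: real measure))))"

text \<open>
  One event of the dynamics, for inter-arrival times \<open>a\<close> and service requirements \<open>s\<close>. The function
  \<open>att\<close> is the service attained so far by each customer. Ties between an arrival and a completion, or
  between two completions, have probability zero; they are resolved as successive events at the same
  epoch.
\<close>

definition next_completion :: "regime \<Rightarrow> real \<Rightarrow> (nat \<Rightarrow> real) \<Rightarrow> history \<Rightarrow> (nat \<Rightarrow> real) \<Rightarrow> real" where
  "next_completion \<rho> v s h att = Inf {u. 0 \<le> u \<and> (\<exists>j\<in>present h. s j \<le> att j + \<rho> v h j u)}"

definition queue_step ::
  "regime \<Rightarrow> real \<Rightarrow> (nat \<Rightarrow> real) \<Rightarrow> (nat \<Rightarrow> real) \<Rightarrow> history \<times> (nat \<Rightarrow> real) \<Rightarrow> history \<times> (nat \<Rightarrow> real)"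
where
  "queue_step \<rho> v a s = (\<lambda>(h, att).
     let r = residual_arrival a h;
         d = next_completion \<rho> v s h att;
         arr = (present h = {} \<or> r < d);
         u = (if arr then r else d);
         att' = (\<lambda>j. att j + \<rho> v h j u);
         e = (if arr then Arrival (num_arrivals h)
              else Departure (LEAST j. j \<in> present h \<and> s j \<le> att' j))
     in (h @ [(now h + u, e)], att'))"

definition queue_history ::
  "regime \<Rightarrow> real \<Rightarrow> (nat \<Rightarrow> real) \<Rightarrow> (nat \<Rightarrow> real) \<Rightarrow> nat \<Rightarrow> history"
where
  "queue_history \<rho> v a s m = fst ((queue_step \<rho> v a s ^^ m) ([], \<lambda>_. 0))"

text \<open>
  Empirical frequencies along a sample path \<open>H\<close>, where \<open>H m\<close> is the history of the first \<open>m\<close> events: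
  the fraction of arrivals that find \<open>n\<close> customers; among the departures that leave \<open>n\<close> customers
  behind, the fraction with a residual inter-arrival time of at most \<open>x\<close>; and the fraction of the
  time interval \<open>[0, t]\<close> during which \<open>n\<close> customers are in the system.
\<close>

definition event_at :: "(nat \<Rightarrow> history) \<Rightarrow> nat \<Rightarrow> event" where
  "event_at H i = snd (last (H (Suc i)))"

definition arrival_freq :: "(nat \<Rightarrow> history) \<Rightarrow> nat \<Rightarrow> nat \<Rightarrow> real" where
  "arrival_freq H n m =
     real (card {i. i < m \<and> is_Arrival (event_at H i) \<and> card (present (H i)) = n}) /
     real (card {i. i < m \<and> is_Arrival (event_at H i)})"

definition departure_residual_freq ::
  "(nat \<Rightarrow> real) \<Rightarrow> (nat \<Rightarrow> history) \<Rightarrow> nat \<Rightarrow> real \<Rightarrow> nat \<Rightarrow> real"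
where
  "departure_residual_freq a H n x m =
     real (card {i. i < m \<and> is_Departure (event_at H i) \<and> card (present (H (Suc i))) = n \<and>
                    residual_arrival a (H (Suc i)) \<le> x}) /
     real (card {i. i < m \<and> is_Departure (event_at H i) \<and> card (present (H (Suc i))) = n})"

definition num_in_system :: "(nat \<Rightarrow> history) \<Rightarrow> real \<Rightarrow> nat" where
  "num_in_system H t = card {j. (\<exists>m. \<exists>\<tau>\<le>t. (\<tau>, Arrival j) \<in> set (H m)) \<and>
                               \<not> (\<exists>m. \<exists>\<tau>\<le>t. (\<tau>, Departure j) \<in> set (H m))}"

definition time_freq :: "(nat \<Rightarrow> history) \<Rightarrow> nat \<Rightarrow> real \<Rightarrow> real" where
  "time_freq H n t = measure lborel {u \<in> {0..t}. num_in_system H u = n} / t"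

definition lst :: "real measure \<Rightarrow> real \<Rightarrow> real" where
  "lst D s = (LINT x:{0..}|D. exp (- s * x))"

text \<open>
  \<open>A k\<close> is the time between arrivals \<open>k - 1\<close> and \<open>k\<close> (between time \<open>0\<close> and the first arrival if
  \<open>k = 0\<close>), \<open>S k\<close> is the service requirement of customer \<open>k\<close>, and \<open>V\<close> is the seed of the regime,
  independent of everything else. \<open>G\<close> is the inter-arrival distribution as a measure, its CDF being
  \<open>cdf G\<close>.
\<close>

locale stable_gm1_queue = prob_space M for M :: "'w measure" +
  fixes A S :: "nat \<Rightarrow> 'w \<Rightarrow> real" and V :: "'w \<Rightarrow> real" and \<rho> :: regime
    and G :: "real measure" and lam mu :: real
  assumes independent:
      "indep_vars (\<lambda>_. borel) (case_sum A (case_sum S (\<lambda>_ :: unit. V))) UNIV"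
    and interarrival_distr: "\<And>k. distr M borel (A k) = G"
    and interarrival_pos: "AE x in G. x > 0"
    and interarrival_integrable: "integrable G (\<lambda>x. x)"
    and interarrival_mean: "(LINT x|G. x) = 1 / lam"
    and service_distr: "\<And>k. distributed M lborel (S k) (exponential_density mu)"
    and lam_pos: "0 < lam"
    and stable: "lam < mu"
    and regime_work_conserving: "work_conserving \<rho>"
    and regime_measurable: "measurable_regime \<rho>"

end

theory Submission imports Defs
begin

text \<open>
  The proof compares expected counts over the first \<open>m\<close> events. As the regime does not observe the
  service requirements, those of the customers present may be replaced by huge ones without changing
  the path until the next completion; integrating them out shows that, given the history and the
  inter-arrival times, the time to the next completion is exponential with rate \<open>mu\<close>. An arrival that
  finds \<open>n \<ge> 1\<close> customers thus has probability \<open>exp (- mu * r)\<close> given the preceding event, \<open>r\<close> being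
  the residual inter-arrival time: \<open>G\<close>-distributed after an arrival that finds \<open>n - 1\<close>, asymptotically
  \<open>R\<close>-distributed after a departure that leaves \<open>n\<close>. As the latter are as frequent as arrivals that
  find \<open>n\<close>, this yields \<open>a n = a (n - 1) * lst G mu + a n * lst R mu\<close>. The time spent with \<open>n + 1\<close>
  customers is \<open>1 / mu\<close> times the number of departures that leave \<open>n\<close>, so \<open>\<pi> (n + 1)\<close> is proportional
  to \<open>a n\<close>. Finally \<open>a 0 > 0\<close>, since otherwise departures would outnumber arrivals.
\<close>

subsection \<open>Sample paths\<close>

text \<open>The existence of the long-run averages is part of the hypotheses. Frequencies are
  bounded, so almost sure convergence passes to expectations in the form
  \<open>(E X - c * E Z) / m\<close> tends to \<open>0\<close>, and linear relations between
  expected counts become equations between \<open>a\<close>, \<open>\<pi>\<close> and the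
  transforms. Elapsed time has no deterministic bound, so for \<open>\<pi>\<close> the finite mean
  of \<open>G\<close> has to supply uniform integrability. The hypothesis on \<open>R\<close>
  concerns its distribution function at one fixed point at a time; the transform at
  \<open>mu\<close> is reached by evaluating at an independent exponential variable. Conditioning
  takes the form of resampling: the path is a function on the product space of all inputs, and one
  coordinate at a time is overwritten by an independent copy. This is sound only for coordinates
  that have not yet influenced the path, whence the two nonanticipation lemmas. Inputs are truncated
  at \<open>0\<close>, so that path facts hold at every sample point.\<close>

instance event :: countable
  by countable_datatype

lemma finite_present [simp]: "finite (present h)"
proof -
  have "present h \<subseteq> (\<lambda>e. case e of Arrival j \<Rightarrow> j | Departure j \<Rightarrow> j) ` snd ` set h"
    unfolding present_def by force
  then show ?thesis
    by (rule finite_subset) simp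
qed

section \<open>Work-conserving plans and the time to the next completion\<close>

context
  fixes \<rho> :: regime
  assumes wc: "work_conserving \<rho>"
begin

lemma plan_0: "\<rho> v h j 0 = 0"
  using wc unfolding work_conserving_def by blast

lemma plan_mono: "0 \<le> u \<Longrightarrow> u \<le> w \<Longrightarrow> \<rho> v h j u \<le> \<rho> v h j w"
  using wc unfolding work_conserving_def by (meson atLeast_iff mono_onD order_trans)

lemma plan_nonneg: "0 \<le> u \<Longrightarrow> 0 \<le> \<rho> v h j u"
  using plan_mono[of 0 u v h j] by (simp add: plan_0)

lemma plan_absent: "j \<notin> present h \<Longrightarrow> 0 \<le> u \<Longrightarrow> \<rho> v h j u = 0"
  using wc unfolding work_conserving_def by blast

lemma plan_total: "present h \<noteq> {} \<Longrightarrow> 0 \<le> u \<Longrightarrow> (\<Sum>j\<in>present h. \<rho> v h j u) = u"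
  using wc unfolding work_conserving_def by blast

text \<open>The shares of the customers present sum to the elapsed time and none of them decreases,
  so a single share cannot grow faster than time.\<close>

lemma plan_lipschitz:
  assumes "0 \<le> u" "u \<le> w"
  shows "\<rho> v h j w - \<rho> v h j u \<le> w - u"
proof (cases "j \<in> present h")
  case True
  have "\<rho> v h j w - \<rho> v h j u \<le> (\<Sum>i\<in>present h. \<rho> v h i w - \<rho> v h i u)"
    using True assms by (intro member_le_sum) (auto intro!: plan_mono)
  also have "\<dots> = w - u"
    using True assms plan_total by (subst sum_subtractf) (metis empty_iff order_trans)
  finally show ?thesis .
next
  case False
  then show ?thesis using assms by (simp add: plan_absent)
qed

lemma plan_le: "0 \<le> u \<Longrightarrow> \<rho> v h j u \<le> u"
  using plan_lipschitz[of 0 u v h j] by (simp add: plan_0)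

lemma plan_continuous: "continuous_on {0..} (\<rho> v h j)"
proof (rule continuous_onI)
  fix x e :: real assume x: "x \<in> {0..}" and e: "0 < e"
  have *: "dist (\<rho> v h j y) (\<rho> v h j x) \<le> dist y x" if "y \<in> {0..}" for y
    using plan_lipschitz[of x y v h j] plan_lipschitz[of y x v h j]
      plan_mono[of x y v h j] plan_mono[of y x v h j] x that
    by (auto simp: dist_real_def abs_if)
  then show "\<exists>d>0. \<forall>y\<in>{0..}. dist y x < d \<longrightarrow> dist (\<rho> v h j y) (\<rho> v h j x) \<le> e"
    using e by (intro exI[of _ e]) (auto intro: order_trans[OF *])
qed

text \<open>The set in \<open>next_completion\<close> is a finite union of closed sets, plans being
  continuous; so its infimum is attained and a customer to depart exists.\<close>

lemma completion_attained:
  assumes ne: "present h \<noteq> {}"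
  shows "0 \<le> next_completion \<rho> v s h att"
    and "\<exists>j\<in>present h. s j \<le> att j + \<rho> v h j (next_completion \<rho> v s h att)"
proof -
  let ?S = "{u. 0 \<le> u \<and> (\<exists>j\<in>present h. s j \<le> att j + \<rho> v h j u)}"
  have S_eq: "?S = (\<Union>j\<in>present h. {u \<in> {0..}. s j \<le> att j + \<rho> v h j u})"
    by auto
  have "closed ?S"
    unfolding S_eq
    by (intro closed_UN finite_present ballI continuous_on_closed_Collect_le continuous_intros
        plan_continuous)
  moreover have "?S \<noteq> {}"
  proof
    assume empty: "?S = {}"
    \<comment> \<open>\<open>U\<close> is at least the total outstanding work, and work conservation
      delivers exactly \<open>U\<close> units of service in \<open>U\<close> time units, so somebody
      must be done by then.\<close>
    define U where "U = (\<Sum>j\<in>present h. \<bar>s j - att j\<bar>)"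
    have "0 \<le> U" unfolding U_def by (simp add: sum_nonneg)
    then have "\<rho> v h j U < s j - att j" if "j \<in> present h" for j
      using empty that by force
    then have "(\<Sum>j\<in>present h. \<rho> v h j U) < (\<Sum>j\<in>present h. s j - att j)"
      using ne by (intro sum_strict_mono) auto
    also have "\<dots> \<le> U"
      unfolding U_def by (intro sum_mono) auto
    finally show False
      using plan_total[OF ne \<open>0 \<le> U\<close>] by simp
  qed
  moreover have "bdd_below ?S"
    by (intro bdd_belowI[of _ 0]) auto
  ultimately have "next_completion \<rho> v s h att \<in> ?S"
    unfolding next_completion_def by (intro closed_contains_Inf) auto
  then show "0 \<le> next_completion \<rho> v s h att"
    "\<exists>j\<in>present h. s j \<le> att j + \<rho> v h j (next_completion \<rho> v s h att)"
    by auto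
qed

text \<open>Trades the infimum for a finite disjunction of inequalities at a fixed time.
  Measurability, insensitivity to altered requirements and the law of the completion time all go
  through this equivalence.\<close>

lemma next_completion_le_iff:
  assumes ne: "present h \<noteq> {}" and u: "0 \<le> u"
  shows "next_completion \<rho> v s h att \<le> u \<longleftrightarrow> (\<exists>j\<in>present h. s j \<le> att j + \<rho> v h j u)"
proof
  assume le: "next_completion \<rho> v s h att \<le> u"
  from completion_attained[OF ne] obtain j where j: "j \<in> present h"
    "s j \<le> att j + \<rho> v h j (next_completion \<rho> v s h att)"
    by blast
  have "\<rho> v h j (next_completion \<rho> v s h att) \<le> \<rho> v h j u"
    by (intro plan_mono completion_attained(1) ne le)
  with j show "\<exists>j\<in>present h. s j \<le> att j + \<rho> v h j u"
    by (intro bexI[of _ j]) auto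
next
  assume "\<exists>j\<in>present h. s j \<le> att j + \<rho> v h j u"
  then show "next_completion \<rho> v s h att \<le> u"
    unfolding next_completion_def using u by (intro cInf_lower bdd_belowI[of _ 0]) auto
qed

lemma next_completion_zero_iff:
  assumes "present h \<noteq> {}"
  shows "next_completion \<rho> v s h att = 0 \<longleftrightarrow> (\<exists>j\<in>present h. s j \<le> att j)"
  using next_completion_le_iff[OF assms, of 0 v s att] completion_attained(1)[OF assms, of v s att]
  by (auto simp: plan_0)

end

section \<open>The state of the queue and its transitions\<close>

definition queue_state ::
  "regime \<Rightarrow> real \<Rightarrow> (nat \<Rightarrow> real) \<Rightarrow> (nat \<Rightarrow> real) \<Rightarrow> nat \<Rightarrow> history \<times> (nat \<Rightarrow> real)"
where
  "queue_state \<rho> v a s m = (queue_step \<rho> v a s ^^ m) ([], \<lambda>_. 0)"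

lemma queue_history_eq: "queue_history \<rho> v a s m = fst (queue_state \<rho> v a s m)"
  by (simp add: queue_history_def queue_state_def)

lemma queue_state_0: "queue_state \<rho> v a s 0 = ([], \<lambda>_. 0)"
  by (simp add: queue_state_def)

lemma queue_state_Suc: "queue_state \<rho> v a s (Suc m) = queue_step \<rho> v a s (queue_state \<rho> v a s m)"
  by (simp add: queue_state_def)

text \<open>This and the next three definitions name the local quantities of
  \<open>queue_step\<close> as functions of the state; \<open>queue_step_eq\<close> reassembles
  them.\<close>

definition arrival_first ::
  "regime \<Rightarrow> real \<Rightarrow> (nat \<Rightarrow> real) \<Rightarrow> (nat \<Rightarrow> real) \<Rightarrow> history \<times> (nat \<Rightarrow> real) \<Rightarrow> bool"
where
  "arrival_first \<rho> v a s st \<longleftrightarrow> present (fst st) = {} \<or>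
     residual_arrival a (fst st) < next_completion \<rho> v s (fst st) (snd st)"

definition sojourn ::
  "regime \<Rightarrow> real \<Rightarrow> (nat \<Rightarrow> real) \<Rightarrow> (nat \<Rightarrow> real) \<Rightarrow> history \<times> (nat \<Rightarrow> real) \<Rightarrow> real"
where
  "sojourn \<rho> v a s st = (if arrival_first \<rho> v a s st then residual_arrival a (fst st)
     else next_completion \<rho> v s (fst st) (snd st))"

definition attained ::
  "regime \<Rightarrow> real \<Rightarrow> (nat \<Rightarrow> real) \<Rightarrow> (nat \<Rightarrow> real) \<Rightarrow> history \<times> (nat \<Rightarrow> real) \<Rightarrow> nat \<Rightarrow> real"
where
  "attained \<rho> v a s st j = snd st j + \<rho> v (fst st) j (sojourn \<rho> v a s st)"

definition next_event ::
  "regime \<Rightarrow> real \<Rightarrow> (nat \<Rightarrow> real) \<Rightarrow> (nat \<Rightarrow> real) \<Rightarrow> history \<times> (nat \<Rightarrow> real) \<Rightarrow> event"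
where
  "next_event \<rho> v a s st = (if arrival_first \<rho> v a s st then Arrival (num_arrivals (fst st))
     else Departure (LEAST j. j \<in> present (fst st) \<and> s j \<le> attained \<rho> v a s st j))"

lemma queue_step_eq:
  "queue_step \<rho> v a s st =
     (fst st @ [(now (fst st) + sojourn \<rho> v a s st, next_event \<rho> v a s st)], attained \<rho> v a s st)"
  unfolding queue_step_def next_event_def attained_def[abs_def] sojourn_def arrival_first_def
  by (simp add: Let_def split_beta)

lemma now_snoc [simp]: "now (h @ [e]) = fst e"
  by (simp add: now_def)

lemma num_arrivals_snoc [simp]:
  "num_arrivals (h @ [(t, e)]) = num_arrivals h + (if is_Arrival e then 1 else 0)"
  by (simp add: num_arrivals_def)

lemma present_Nil [simp]: "present [] = {}"
  by (simp add: present_def)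

lemma num_arrivals_Nil [simp]: "num_arrivals [] = 0"
  by (simp add: num_arrivals_def)

lemma now_Nil [simp]: "now [] = 0"
  by (simp add: now_def)

text \<open>The invariant that makes the number given to a new customer fresh, so that each arrival
  adds exactly one element to \<open>present\<close>.\<close>

definition well_numbered :: "history \<Rightarrow> bool" where
  "well_numbered h \<longleftrightarrow> (\<forall>j. Arrival j \<in> snd ` set h \<longleftrightarrow> j < num_arrivals h) \<and>
     (\<forall>j. Departure j \<in> snd ` set h \<longrightarrow> j < num_arrivals h)"

lemma present_snoc_Arrival:
  assumes "well_numbered h"
  shows "present (h @ [(t, Arrival (num_arrivals h))]) = insert (num_arrivals h) (present h)"
    and "num_arrivals h \<notin> present h"
  using assms unfolding present_def well_numbered_def by auto

lemma present_snoc_Departure: "present (h @ [(t, Departure j)]) = present h - {j}"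
  unfolding present_def by auto

lemma well_numbered_Arrival:
  "well_numbered h \<Longrightarrow> well_numbered (h @ [(t, Arrival (num_arrivals h))])"
  unfolding well_numbered_def by (auto simp: less_Suc_eq)

lemma well_numbered_Departure:
  "well_numbered h \<Longrightarrow> j \<in> present h \<Longrightarrow> well_numbered (h @ [(t, Departure j)])"
  unfolding well_numbered_def present_def by auto

text \<open>Describes a single deterministic path. The probabilistic part instantiates it with
  inputs truncated at \<open>0\<close>, which are nonnegative at every sample point.\<close>

locale queue_path =
  fixes \<rho> :: regime and v :: real and a s :: "nat \<Rightarrow> real"
  assumes wc: "work_conserving \<rho>" and a_nonneg: "\<And>k. 0 \<le> a k" and s_nonneg: "\<And>k. 0 \<le> s k"
begin

abbreviation "st \<equiv> queue_state \<rho> v a s"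
abbreviation "H m \<equiv> fst (st m)"
abbreviation "att m \<equiv> snd (st m)"
abbreviation "r m \<equiv> residual_arrival a (H m)"
abbreviation "d m \<equiv> next_completion \<rho> v s (H m) (att m)"
abbreviation "u m \<equiv> sojourn \<rho> v a s (st m)"
abbreviation "arr m \<equiv> arrival_first \<rho> v a s (st m)"
abbreviation "evt m \<equiv> next_event \<rho> v a s (st m)"
abbreviation "N m \<equiv> card (present (H m))"

lemma H_0: "H 0 = []" and att_0: "att 0 = (\<lambda>_. 0)"
  by (simp_all add: queue_state_0)

lemma H_Suc: "H (Suc m) = H m @ [(now (H m) + u m, evt m)]"
  and att_Suc: "att (Suc m) j = att m j + \<rho> v (H m) j (u m)"
  by (simp_all add: queue_state_Suc queue_step_eq attained_def)

lemma now_Suc: "now (H (Suc m)) = now (H m) + u m"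
  by (simp add: H_Suc)

lemma length_H: "length (H m) = m"
  by (induction m) (simp_all add: H_0 H_Suc)

lemma is_Arrival_ev: "is_Arrival (evt m) \<longleftrightarrow> arr m"
  by (simp add: next_event_def)

lemma is_Departure_ev: "is_Departure (evt m) \<longleftrightarrow> \<not> arr m"
  by (simp add: next_event_def)

lemma ev_arr: "arr m \<Longrightarrow> evt m = Arrival (num_arrivals (H m))"
  by (simp add: next_event_def)

lemma ev_dep:
  assumes "\<not> arr m"
  obtains j where "evt m = Departure j" "j \<in> present (H m)" "s j \<le> att (Suc m) j"
    "\<And>i. i \<in> present (H m) \<Longrightarrow> s i \<le> att (Suc m) i \<Longrightarrow> j \<le> i"
proof -
  from assms have ne: "present (H m) \<noteq> {}"
    by (simp add: arrival_first_def)
  from assms have u: "u m = d m" by (simp add: sojourn_def)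
  let ?P = "\<lambda>j. j \<in> present (H m) \<and> s j \<le> attained \<rho> v a s (st m) j"
  have "\<exists>j. ?P j"
    using completion_attained(2)[OF wc ne, of s "att m" v] by (auto simp: attained_def u)
  then have "?P (LEAST j. ?P j)" by (rule LeastI_ex)
  moreover have "evt m = Departure (LEAST j. ?P j)"
    using assms by (simp add: next_event_def)
  moreover have "att (Suc m) = attained \<rho> v a s (st m)"
    by (simp add: queue_state_Suc queue_step_eq)
  ultimately show ?thesis
    using that[of "LEAST j. ?P j"] Least_le[of ?P] by simp
qed

lemma well_numbered_H: "well_numbered (H m)"
proof (induction m)
  case 0
  then show ?case by (simp add: H_0 well_numbered_def)
next
  case (Suc m)
  show ?case
  proof (cases "arr m")
    case True
    then show ?thesis using Suc by (simp add: H_Suc ev_arr well_numbered_Arrival)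
  next
    case False
    then obtain j where "evt m = Departure j" "j \<in> present (H m)" by (rule ev_dep)
    then show ?thesis using Suc by (simp add: H_Suc well_numbered_Departure)
  qed
qed

lemma num_arrivals_Suc: "num_arrivals (H (Suc m)) = num_arrivals (H m) + (if arr m then 1 else 0)"
  by (simp add: H_Suc is_Arrival_ev)

lemma num_arrivals_mono: "i \<le> j \<Longrightarrow> num_arrivals (H i) \<le> num_arrivals (H j)"
  by (rule lift_Suc_mono_le[of "\<lambda>i. num_arrivals (H i)"]) (simp add: num_arrivals_Suc)

lemma num_arrivals_le: "num_arrivals (H m) \<le> m"
  by (induction m) (simp_all add: H_0 num_arrivals_Suc)

lemma present_Suc_arr: "arr m \<Longrightarrow> present (H (Suc m)) = insert (num_arrivals (H m)) (present (H m))"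
  by (simp add: H_Suc ev_arr present_snoc_Arrival(1) well_numbered_H)

lemma N_Suc_arr: "arr m \<Longrightarrow> N (Suc m) = Suc (N m)"
  by (simp add: present_Suc_arr present_snoc_Arrival(2) well_numbered_H)

lemma N_Suc_dep: "\<not> arr m \<Longrightarrow> N m = Suc (N (Suc m))"
  by (erule ev_dep) (simp add: H_Suc present_snoc_Departure card_Suc_Diff1 del: card_Diff_insert)

text \<open>Events are arrivals plus departures, and the number present is arrivals minus
  departures. Hence at least half of the first \<open>m\<close> events are arrivals.\<close>

lemma N_arrivals: "m + N m = 2 * num_arrivals (H m)"
proof (induction m)
  case (Suc m)
  then show ?case using N_Suc_arr[of m] N_Suc_dep[of m] by (auto simp: num_arrivals_Suc)
qed (simp add: H_0)

lemma empty_arr: "present (H m) = {} \<Longrightarrow> arr m"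
  by (simp add: arrival_first_def)

lemma arrival_epoch_Suc: "arrival_epoch a (Suc k) = arrival_epoch a k + a (Suc k)"
  by (simp add: arrival_epoch_def)

lemma arrival_epoch_nonneg: "0 \<le> arrival_epoch a k"
  unfolding arrival_epoch_def by (intro sum_nonneg a_nonneg)

lemma arrival_epoch_mono: "i \<le> j \<Longrightarrow> arrival_epoch a i \<le> arrival_epoch a j"
  by (rule lift_Suc_mono_le[of "arrival_epoch a"]) (simp add: arrival_epoch_Suc a_nonneg)

lemma r_eq: "r m = arrival_epoch a (num_arrivals (H m)) - now (H m)"
  by (simp add: residual_arrival_def)

lemma r_0: "r 0 = a 0"
  by (simp add: residual_arrival_def H_0 arrival_epoch_def)

lemma r_Suc_arr: "arr m \<Longrightarrow> r (Suc m) = a (Suc (num_arrivals (H m)))"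
  by (simp add: r_eq now_Suc num_arrivals_Suc arrival_epoch_Suc sojourn_def)

lemma r_Suc_dep: "\<not> arr m \<Longrightarrow> r (Suc m) = r m - d m"
  by (simp add: r_eq now_Suc num_arrivals_Suc sojourn_def)

lemma r_nonneg: "0 \<le> r m"
proof (induction m)
  case (Suc m)
  then show ?case
    by (cases "arr m") (auto simp: r_Suc_arr r_Suc_dep a_nonneg arrival_first_def)
qed (simp add: r_0 a_nonneg)

lemma d_nonneg: "present (H m) \<noteq> {} \<Longrightarrow> 0 \<le> d m"
  by (rule completion_attained(1)[OF wc])

lemma u_nonneg: "0 \<le> u m"
  using r_nonneg d_nonneg by (auto simp: sojourn_def arrival_first_def)

lemma u_eq_min: "present (H m) \<noteq> {} \<Longrightarrow> u m = min (r m) (d m)"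
  by (auto simp: sojourn_def arrival_first_def)

lemma r_le: "r m \<le> a (num_arrivals (H m))"
proof (induction m)
  case (Suc m)
  then show ?case
    using d_nonneg[of m]
    by (cases "arr m") (auto simp: r_Suc_arr r_Suc_dep num_arrivals_Suc arrival_first_def)
qed (use r_0 in \<open>simp add: H_0\<close>)

lemma now_eq_sum: "now (H m) = (\<Sum>i<m. u i)"
  by (induction m) (simp_all add: H_0 now_Suc)

lemma now_mono: "i \<le> j \<Longrightarrow> now (H i) \<le> now (H j)"
  by (rule lift_Suc_mono_le[of "\<lambda>i. now (H i)"]) (simp add: now_Suc u_nonneg)

lemma now_nonneg: "0 \<le> now (H m)"
  using now_mono[of 0 m] by (simp add: H_0)

lemma now_le: "now (H m) \<le> arrival_epoch a m"
  using r_nonneg[of m] arrival_epoch_mono[OF num_arrivals_le, of m] by (simp add: r_eq)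

lemma att_mono: "i \<le> k \<Longrightarrow> att i j \<le> att k j"
  by (rule lift_Suc_mono_le[of "\<lambda>i. att i j"])
     (simp add: att_Suc plan_nonneg[OF wc] u_nonneg)

lemma att_nonneg: "0 \<le> att m j"
  using att_mono[of 0 m j] by (simp add: att_0)

text \<open>With \<open>now_le\<close>, this caps the service attained within \<open>m\<close>
  events by \<open>arrival_epoch a m\<close>; a requirement above that level cannot be met by
  then.\<close>

lemma att_le_now: "att m j \<le> now (H m)"
proof (induction m)
  case (Suc m)
  then show ?case
    using plan_le[OF wc u_nonneg, of v "H m" j m] by (simp add: att_Suc now_Suc)
qed (simp add: att_0 H_0)

lemma att_absent: "j \<ge> num_arrivals (H m) \<Longrightarrow> att m j = 0"
proof (induction m)
  case (Suc m)
  then have j: "j \<ge> num_arrivals (H m)" by (simp add: num_arrivals_Suc)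
  then have "j \<notin> present (H m)"
    using well_numbered_H[of m] by (auto simp: well_numbered_def present_def)
  with Suc j show ?case by (simp add: att_Suc plan_absent[OF wc] u_nonneg)
qed (simp add: att_0)

text \<open>Only a tie makes a customer stay on after having attained his service requirement.\<close>

lemma att_le_service: "j \<in> present (H m) \<Longrightarrow> att m j \<le> s j"
proof (induction m)
  case (Suc m)
  show ?case
  proof (cases "j \<in> present (H m)")
    case True
    then have IH: "att m j \<le> s j" by (rule Suc)
    have ne: "present (H m) \<noteq> {}" using True by auto
    show ?thesis
    proof (rule ccontr)
      assume "\<not> att (Suc m) j \<le> s j"
      then have gt: "s j - att m j < \<rho> v (H m) j (u m)" by (simp add: att_Suc)
      then have "0 < \<rho> v (H m) j (u m)" using IH by simp
      then have "0 < u m"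
        using plan_0[OF wc, of v "H m" j] u_nonneg[of m] by (metis less_eq_real_def less_irrefl)
      \<comment> \<open>The surplus over the requirement is walked back in time: as a plan is
        1-Lipschitz, the requirement is already met at \<open>w\<close>, strictly before the event,
        although no completion precedes \<open>u m\<close>.\<close>
      define w where "w = max 0 (u m - (\<rho> v (H m) j (u m) - (s j - att m j)))"
      have w: "0 \<le> w" "w < u m" "w \<le> u m"
        using gt \<open>0 < u m\<close> by (auto simp: w_def)
      have "u m - w \<le> \<rho> v (H m) j (u m) - (s j - att m j)"
        by (simp add: w_def)
      then have "s j \<le> att m j + \<rho> v (H m) j w"
        using plan_lipschitz[OF wc w(1) w(3), of v "H m" j] by simp
      then have "d m \<le> w"
        using next_completion_le_iff[OF wc ne w(1)] True by blast
      then show False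
        using w(2) u_eq_min[OF ne] by simp
    qed
  next
    case False
    have "arr m"
    proof (rule ccontr)
      assume "\<not> arr m"
      then obtain i where "evt m = Departure i" by (rule ev_dep)
      with Suc.prems False show False by (simp add: H_Suc present_snoc_Departure)
    qed
    then have "j = num_arrivals (H m)"
      using Suc.prems False by (simp add: present_Suc_arr)
    then show ?thesis
      using att_absent[of m j] False s_nonneg[of j]
      by (simp add: att_Suc plan_absent[OF wc] u_nonneg)
  qed
qed (simp add: H_0)

lemma departed_mono: "i \<le> k \<Longrightarrow> Departure j \<in> snd ` set (H i) \<Longrightarrow> Departure j \<in> snd ` set (H k)"
proof -
  have "snd ` set (H i) \<subseteq> snd ` set (H (Suc i))" for i
    by (auto simp: H_Suc)
  then show "i \<le> k \<Longrightarrow> Departure j \<in> snd ` set (H i) \<Longrightarrow> Departure j \<in> snd ` set (H k)"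
    using lift_Suc_mono_le[of "\<lambda>i. snd ` set (H i)" i k] by blast
qed

text \<open>
  As the regime does not observe service requirements, those of customers who have not yet been
  completed may be altered without affecting the sample path.
\<close>

lemma service_nonanticipation:
  assumes s': "\<And>j. j \<notin> J \<Longrightarrow> s' j = s j"
    and nodep: "\<And>j. j \<in> J \<Longrightarrow> Departure j \<notin> snd ` set (H m)"
    and unfinished: "\<And>j. j \<in> J \<Longrightarrow> att m j < s' j"
  shows "queue_state \<rho> v a s' m = st m"
  using nodep unfinished
proof (induction m)
  case (Suc m)
  have IH: "queue_state \<rho> v a s' m = st m"
  proof (rule Suc.IH)
    show "Departure j \<notin> snd ` set (H m)" if "j \<in> J" for j
      using Suc.prems(1)[OF that] departed_mono[of m "Suc m" j] by auto
    show "att m j < s' j" if "j \<in> J" for j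
      using Suc.prems(2)[OF that] att_mono[of m "Suc m" j] by simp
  qed
  let ?d' = "next_completion \<rho> v s' (H m) (att m)"
  have "queue_step \<rho> v a s' (st m) = queue_step \<rho> v a s (st m)"
  proof (cases "present (H m) = {}")
    case True
    then have af: "arrival_first \<rho> v a s' (st m)" "arr m" by (auto simp: arrival_first_def)
    have "sojourn \<rho> v a s' (st m) = u m" by (simp add: sojourn_def af)
    then show ?thesis using af
      by (auto simp: queue_step_eq attained_def next_event_def fun_eq_iff)
  next
    case ne: False
    show ?thesis
    proof (cases "arr m")
      case True
      then have less: "r m < d m" and u: "u m = r m"
        using ne by (auto simp: arrival_first_def sojourn_def)
      \<comment> \<open>A completion under \<open>s'\<close> by time \<open>r m\<close> would
        concern a customer outside \<open>J\<close>, since those in \<open>J\<close> are unfinished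
        even after the step. His requirement is the same under \<open>s\<close>, so the arrival
        would not come first there either.\<close>
      have "r m < ?d'"
      proof (rule ccontr)
        assume "\<not> r m < ?d'"
        then obtain j where j: "j \<in> present (H m)" "s' j \<le> att m j + \<rho> v (H m) j (r m)"
          using next_completion_le_iff[OF wc ne r_nonneg, of v s' "att m" m] by auto
        then have "s' j \<le> att (Suc m) j" by (simp add: att_Suc u)
        with Suc.prems(2)[of j] have "j \<notin> J" by auto
        with s' j have "\<exists>j\<in>present (H m). s j \<le> att m j + \<rho> v (H m) j (r m)" by auto
        then show False
          using next_completion_le_iff[OF wc ne r_nonneg, of v s "att m" m] less by simp
      qed
      then have af: "arrival_first \<rho> v a s' (st m)" by (simp add: arrival_first_def)
      have "sojourn \<rho> v a s' (st m) = u m" by (simp add: sojourn_def af True)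
      then show ?thesis using af True
        by (auto simp: queue_step_eq attained_def next_event_def fun_eq_iff)
    next
      case False
      then have u: "u m = d m" and le: "d m \<le> r m"
        by (auto simp: sojourn_def arrival_first_def)
      from False obtain k where k: "evt m = Departure k" "k \<in> present (H m)"
        "s k \<le> att (Suc m) k"
        "\<And>i. i \<in> present (H m) \<Longrightarrow> s i \<le> att (Suc m) i \<Longrightarrow> k \<le> i"
        by (rule ev_dep) metis
      \<comment> \<open>No member of \<open>J\<close> departs within \<open>Suc m\<close> events, so
        the customer who leaves keeps his requirement and is done by the same time under
        \<open>s'\<close>.\<close>
      have "k \<notin> J" using Suc.prems(1)[of k] k(1) by (auto simp: H_Suc)
      have "?d' \<le> d m"
        using next_completion_le_iff[OF wc ne d_nonneg[OF ne], of v s' "att m"] k \<open>k \<notin> J\<close> s'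
        by (auto simp: att_Suc u intro!: bexI[of _ k])
      moreover have "d m \<le> ?d'"
      proof -
        have d': "0 \<le> ?d'" by (rule completion_attained(1)[OF wc ne])
        from completion_attained(2)[OF wc ne] obtain j where
          j: "j \<in> present (H m)" "s' j \<le> att m j + \<rho> v (H m) j ?d'" by blast
        have "\<rho> v (H m) j ?d' \<le> \<rho> v (H m) j (d m)"
          by (rule plan_mono[OF wc d' \<open>?d' \<le> d m\<close>])
        then have "s' j \<le> att (Suc m) j" using j by (simp add: att_Suc u)
        with Suc.prems(2)[of j] have "j \<notin> J" by auto
        with s' j show ?thesis
          using next_completion_le_iff[OF wc ne d', of v s "att m"] by auto
      qed
      ultimately have d': "?d' = d m" by simp
      then have af: "\<not> arrival_first \<rho> v a s' (st m)"
        using le ne by (simp add: arrival_first_def)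
      have so: "sojourn \<rho> v a s' (st m) = u m" using False by (simp add: sojourn_def af d')
      then have at: "attained \<rho> v a s' (st m) = att (Suc m)"
        by (simp add: fun_eq_iff attained_def att_Suc)
      have "(LEAST j. j \<in> present (H m) \<and> s' j \<le> att (Suc m) j) = k"
      proof (rule Least_equality)
        show "k \<in> present (H m) \<and> s' k \<le> att (Suc m) k"
          using k \<open>k \<notin> J\<close> s' by simp
        fix i assume i: "i \<in> present (H m) \<and> s' i \<le> att (Suc m) i"
        with Suc.prems(2)[of i] have "i \<notin> J" by auto
        with i s' k(4) show "k \<le> i" by simp
      qed
      then have "next_event \<rho> v a s' (st m) = evt m"
        using af k(1) by (simp add: next_event_def at)
      then show ?thesis
        using so at by (auto simp: queue_step_eq fun_eq_iff attained_def att_Suc)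
    qed
  qed
  then show ?case by (simp add: queue_state_Suc IH)
qed (simp add: queue_state_0)

text \<open>The step out of \<open>H m\<close> reads the inter-arrival times only through the epoch
  of the pending arrival, whose index is \<open>num_arrivals (H m)\<close>. If that arrival occurs,
  the inter-arrival time starting then has not been looked at, which
  \<open>expectation_after_arrival\<close> exploits.\<close>

lemma arrival_nonanticipation:
  assumes a': "\<And>i. i \<le> k \<Longrightarrow> a' i = a i" and k: "num_arrivals (H m) \<le> k"
  shows "queue_state \<rho> v a' s m = st m" and "queue_state \<rho> v a' s (Suc m) = st (Suc m)"
proof -
  have step: "queue_state \<rho> v a' s m = st m \<Longrightarrow> num_arrivals (H m) \<le> k \<Longrightarrow>
      queue_state \<rho> v a' s (Suc m) = st (Suc m)" for m
  proof -
    assume IH: "queue_state \<rho> v a' s m = st m" and k: "num_arrivals (H m) \<le> k"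
    have "residual_arrival a' (H m) = r m"
      using k a' by (simp add: residual_arrival_def arrival_epoch_def)
    then show "queue_state \<rho> v a' s (Suc m) = st (Suc m)"
      by (simp add: queue_state_Suc IH queue_step_def split_beta)
  qed
  show "queue_state \<rho> v a' s m = st m"
    using k
  proof (induction m)
    case (Suc m)
    then show ?case using step[of m] num_arrivals_mono[of m "Suc m"] by simp
  qed (simp add: queue_state_0)
  with step k show "queue_state \<rho> v a' s (Suc m) = st (Suc m)" by simp
qed

end

subsection \<open>Measurability of the sample path\<close>

context queue_path
begin

lemma H_zip: "H m = zip (map (\<lambda>i. now (H (Suc i))) [0..<m]) (map snd (H m))"
proof (induction m)
  case (Suc m)
  have "map snd (H (Suc m)) = map snd (H m) @ [evt m]"
    by (simp add: H_Suc)
  then have "zip (map (\<lambda>i. now (H (Suc i))) [0..<Suc m]) (map snd (H (Suc m))) =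
      H m @ [(now (H (Suc m)), evt m)]"
    using Suc by (simp add: length_H)
  then show ?case by (simp add: H_Suc)
qed (simp add: H_0)

end

text \<open>The shape in which \<open>measurable_regime\<close> presents histories: a fixed list of
  events with variable epochs.\<close>

definition history_of :: "event list \<Rightarrow> (nat \<Rightarrow> real) \<Rightarrow> history" where
  "history_of es \<tau> = zip (map \<tau> [0..<length es]) es"

lemma map_snd_history_of [simp]: "map snd (history_of es \<tau>) = es"
  by (simp add: history_of_def)

text \<open>Epochs have no influence on \<open>present\<close>; the dummy epochs \<open>0\<close>
  make the set a function of the event list, hence constant once that list is fixed.\<close>

lemma present_map_snd: "present h = present (history_of (map snd h) (\<lambda>_. 0))"
  using arg_cong[OF map_snd_history_of[of "map snd h" "\<lambda>_. 0"], of set]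
  by (simp only: present_def set_map)

lemma num_arrivals_map_snd: "num_arrivals h = length (filter is_Arrival (map snd h))"
  by (simp add: num_arrivals_def filter_map comp_def)

lemma present_history_of: "present (history_of es \<tau>) = present (history_of es (\<lambda>_. 0))"
  by (subst present_map_snd) simp

lemma num_arrivals_history_of: "num_arrivals (history_of es \<tau>) = length (filter is_Arrival es)"
  by (simp add: num_arrivals_map_snd)

lemma now_history_of: "now (history_of es \<tau>) = (if es = [] then 0 else \<tau> (length es - 1))"
proof (cases "es = []")
  case False
  then have "history_of es \<tau> \<noteq> []" by (cases es) (auto simp: history_of_def upt_conv_Cons simp del: upt_Suc)
  then show ?thesis using False by (simp add: now_def last_conv_nth history_of_def)
qed (simp add: history_of_def now_def)

text \<open>The space \<open>Q\<close> is arbitrary because the locale is used three times: for the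
  inputs on \<open>M\<close>, for the coordinate projections on the product space, and for the
  latter with some requirements raised.\<close>

locale measurable_queue =
  fixes Q :: "'q measure" and \<rho> :: regime and v :: "'q \<Rightarrow> real" and a s :: "'q \<Rightarrow> nat \<Rightarrow> real"
  assumes wc: "work_conserving \<rho>" and mr: "measurable_regime \<rho>"
    and v_meas [measurable]: "v \<in> borel_measurable Q"
    and a_meas [measurable]: "\<And>k. (\<lambda>x. a x k) \<in> borel_measurable Q"
    and s_meas [measurable]: "\<And>k. (\<lambda>x. s x k) \<in> borel_measurable Q"
    and a_nonneg: "\<And>x k. 0 \<le> a x k" and s_nonneg: "\<And>x k. 0 \<le> s x k"
begin

sublocale path: queue_path \<rho> "v x" "a x" "s x" for x
  by unfold_locales (rule wc a_nonneg s_nonneg)+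

abbreviation "st m x \<equiv> queue_state \<rho> (v x) (a x) (s x) m"
abbreviation "H m x \<equiv> fst (st m x)"

lemma plan_const_measurable:
  assumes [measurable]: "\<And>i. (\<lambda>x. \<tau> x i) \<in> borel_measurable Q"
  shows "(\<lambda>x. \<rho> (v x) (history_of es (\<tau> x)) j w) \<in> borel_measurable Q"
proof -
  have \<tau>: "\<tau> \<in> Q \<rightarrow>\<^sub>M (\<Pi>\<^sub>M i\<in>UNIV. borel)"
    by (rule measurable_PiM_single') (auto simp: space_PiM)
  have "(\<lambda>(v, \<tau>). \<rho> v (zip (map \<tau> [0..<length es]) es) j w)
      \<in> borel_measurable (borel \<Otimes>\<^sub>M (\<Pi>\<^sub>M i\<in>(UNIV :: nat set). (borel :: real measure)))"
    using mr unfolding measurable_regime_def by blast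
  from measurable_compose[OF measurable_Pair[OF v_meas \<tau>] this]
  show ?thesis by (simp add: history_of_def)
qed

text \<open>\<open>measurable_regime\<close> speaks of fixed durations only. A random duration is
  rounded up to the grid of mesh \<open>1 / Suc n\<close>, where it takes countably many values, and
  the Lipschitz bound lets \<open>n\<close> tend to infinity.\<close>

lemma plan_measurable:
  assumes [measurable]: "\<And>i. (\<lambda>x. \<tau> x i) \<in> borel_measurable Q" "u \<in> borel_measurable Q"
    and u: "\<And>x. 0 \<le> u x"
  shows "(\<lambda>x. \<rho> (v x) (history_of es (\<tau> x)) j (u x)) \<in> borel_measurable Q"
proof (rule borel_measurable_LIMSEQ_real)
  define w where "w n x = nat \<lceil>real (Suc n) * u x\<rceil>" for n x
  define f where "f n x = \<rho> (v x) (history_of es (\<tau> x)) j (real (w n x) / real (Suc n))" for n x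
  show "f n \<in> borel_measurable Q" for n
    unfolding f_def
  proof (rule measurable_compose_countable[where g = "w n"])
    show "w n \<in> Q \<rightarrow>\<^sub>M count_space UNIV" unfolding w_def by measurable
    show "(\<lambda>x. \<rho> (v x) (history_of es (\<tau> x)) j (real k / real (Suc n))) \<in> borel_measurable Q" for k
      by (rule plan_const_measurable) measurable
  qed
  show "(\<lambda>n. f n x) \<longlonglongrightarrow> \<rho> (v x) (history_of es (\<tau> x)) j (u x)" for x
  proof (rule LIMSEQ_I)
    fix e :: real assume "0 < e"
    then obtain n0 where n0: "inverse (real (Suc n0)) < e" using reals_Archimedean by blast
    show "\<exists>no. \<forall>n\<ge>no. norm (f n x - \<rho> (v x) (history_of es (\<tau> x)) j (u x)) < e"
    proof (intro exI[of _ n0] allI impI)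
      fix n assume n: "n0 \<le> n"
      let ?y = "real (w n x) / real (Suc n)"
      have w: "real (Suc n) * u x \<le> real (w n x)" "real (w n x) < real (Suc n) * u x + 1"
        using u[of x] unfolding w_def by (simp_all add: of_nat_nat) linarith+
      then have 1: "u x \<le> ?y" by (simp add: field_simps)
      have "?y \<le> (real (Suc n) * u x + 1) / real (Suc n)"
        using w(2) by (intro divide_right_mono) auto
      also have "\<dots> = u x + inverse (real (Suc n))"
        by (simp add: add_divide_distrib inverse_eq_divide del: of_nat_Suc)
      finally have 2: "?y \<le> u x + inverse (real (Suc n))" .
      have "inverse (real (Suc n)) \<le> inverse (real (Suc n0))" using n by (simp add: field_simps)
      with n0 2 have "?y - u x < e" by linarith
      then show "norm (f n x - \<rho> (v x) (history_of es (\<tau> x)) j (u x)) < e"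
        unfolding f_def
        using plan_lipschitz[OF wc u[of x] 1, of "v x" "history_of es (\<tau> x)" j]
          plan_mono[OF wc u[of x] 1, of "v x" "history_of es (\<tau> x)" j] by simp
    qed
  qed
qed

lemma next_completion_measurable:
  assumes [measurable]: "\<And>i. (\<lambda>x. \<tau> x i) \<in> borel_measurable Q"
    "\<And>j. (\<lambda>x. att x j) \<in> borel_measurable Q"
  shows "(\<lambda>x. next_completion \<rho> (v x) (s x) (history_of es (\<tau> x)) (att x)) \<in> borel_measurable Q"
proof (cases "present (history_of es (\<lambda>_. 0)) = {}")
  \<comment> \<open>With nobody present the infimum is taken over the empty set, which gives a
    constant.\<close>
  case True
  then show ?thesis
    by (simp add: next_completion_def present_history_of[of es "\<tau> _"])
next
  case False
  then have ne: "present (history_of es (\<tau> x)) \<noteq> {}" for x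
    by (simp add: present_history_of[of es "\<tau> _"])
  have [measurable]: "(\<lambda>x. \<rho> (v x) (history_of es (\<tau> x)) j w) \<in> borel_measurable Q" for j w
    by (rule plan_const_measurable) measurable
  show ?thesis
    unfolding borel_measurable_iff_le
  proof
    fix c
    show "{x \<in> space Q. next_completion \<rho> (v x) (s x) (history_of es (\<tau> x)) (att x) \<le> c} \<in> sets Q"
    proof (cases "0 \<le> c")
      case True
      let ?J = "present (history_of es (\<lambda>_. 0))"
      have "countable ?J" by (rule countable_finite) simp
      then have "{x \<in> space Q. \<exists>j\<in>?J. s x j \<le> att x j + \<rho> (v x) (history_of es (\<tau> x)) j c} \<in> sets Q"
        by measurable
      then show ?thesis
        using True by (simp add: next_completion_le_iff[OF wc ne] present_history_of[of es "\<tau> _"])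
    next
      case False
      then have "\<not> next_completion \<rho> (v x) (s x) (history_of es (\<tau> x)) (att x) \<le> c" for x
        using completion_attained(1)[OF wc ne[of x], of "v x" "s x" "att x"] by linarith
      then show ?thesis by simp
    qed
  qed
qed

text \<open>The events take countably many values, so that only the epochs need to be random.\<close>

definition epochs :: "nat \<Rightarrow> 'q \<Rightarrow> nat \<Rightarrow> real" where
  "epochs m x i = (if i < m then now (H (Suc i) x) else 0)"

lemma H_eq_history_of: "H m x = history_of (map snd (H m x)) (epochs m x)"
proof -
  have "map (epochs m x) [0..<m] = map (\<lambda>i. now (H (Suc i) x)) [0..<m]"
    by (simp add: epochs_def)
  then show ?thesis
    using path.H_zip[of x m] by (simp only: history_of_def length_map path.length_H)
qed

lemma countable_histories:
  assumes "(\<lambda>x. map snd (H m x)) \<in> Q \<rightarrow>\<^sub>M count_space UNIV"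
    and "\<And>es. (\<lambda>x. g (history_of es (epochs m x)) x) \<in> Q \<rightarrow>\<^sub>M N'"
  shows "(\<lambda>x. g (H m x) x) \<in> Q \<rightarrow>\<^sub>M N'"
proof -
  have "(\<lambda>x. g (history_of (map snd (H m x)) (epochs m x)) x) \<in> Q \<rightarrow>\<^sub>M N'"
    by (rule measurable_compose_countable[OF assms(2) assms(1)])
  then show ?thesis
    by (subst H_eq_history_of)
qed

context
  fixes m
  assumes E: "(\<lambda>x. map snd (H m x)) \<in> Q \<rightarrow>\<^sub>M count_space UNIV"
    and T [measurable]: "\<And>i. (\<lambda>x. epochs m x i) \<in> borel_measurable Q"
    and att [measurable]: "\<And>j. (\<lambda>x. snd (st m x) j) \<in> borel_measurable Q"
begin

lemma residual_measurable_aux: "(\<lambda>x. residual_arrival (a x) (H m x)) \<in> borel_measurable Q"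
  by (rule countable_histories[OF E])
     (simp add: residual_arrival_def arrival_epoch_def num_arrivals_history_of now_history_of)

lemma completion_measurable_aux:
  "(\<lambda>x. next_completion \<rho> (v x) (s x) (H m x) (snd (st m x))) \<in> borel_measurable Q"
  by (rule countable_histories[OF E]) (rule next_completion_measurable; measurable)

lemma present_empty_measurable_aux: "Measurable.pred Q (\<lambda>x. present (H m x) = {})"
  using measurable_compose[OF E, of "\<lambda>es. present (history_of es (\<lambda>_. 0)) = {}" "count_space UNIV"]
  by (subst present_map_snd) simp

lemma arrival_first_measurable_aux:
  "Measurable.pred Q (\<lambda>x. arrival_first \<rho> (v x) (a x) (s x) (st m x))"
  unfolding arrival_first_def
  using residual_measurable_aux completion_measurable_aux present_empty_measurable_aux
  by measurable

lemma sojourn_measurable_aux: "(\<lambda>x. sojourn \<rho> (v x) (a x) (s x) (st m x)) \<in> borel_measurable Q"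
  unfolding sojourn_def
  using residual_measurable_aux completion_measurable_aux arrival_first_measurable_aux
  by measurable

lemma attained_measurable_aux:
  "(\<lambda>x. attained \<rho> (v x) (a x) (s x) (st m x) j) \<in> borel_measurable Q"
proof -
  have "(\<lambda>x. \<rho> (v x) (H m x) j (sojourn \<rho> (v x) (a x) (s x) (st m x))) \<in> borel_measurable Q"
    by (rule countable_histories[OF E])
       (intro plan_measurable sojourn_measurable_aux T path.u_nonneg)
  then show ?thesis unfolding attained_def by measurable
qed

lemma next_event_measurable_aux:
  "(\<lambda>x. next_event \<rho> (v x) (a x) (s x) (st m x)) \<in> Q \<rightarrow>\<^sub>M count_space UNIV"
proof -
  note [measurable] = arrival_first_measurable_aux attained_measurable_aux
  have "(\<lambda>x. if arrival_first \<rho> (v x) (a x) (s x) (st m x) then Arrival (num_arrivals (H m x))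
     else Departure (LEAST j. j \<in> present (H m x) \<and> s x j \<le> attained \<rho> (v x) (a x) (s x) (st m x) j))
     \<in> Q \<rightarrow>\<^sub>M count_space UNIV"
  proof (rule countable_histories[OF E])
    fix es
    have "(\<lambda>x. LEAST j. j \<in> present (history_of es (\<lambda>_. 0)) \<and>
        s x j \<le> attained \<rho> (v x) (a x) (s x) (st m x) j) \<in> Q \<rightarrow>\<^sub>M count_space UNIV"
      by measurable
    from measurable_compose[OF this, of Departure "count_space UNIV"]
    have [measurable]: "(\<lambda>x. Departure (LEAST j. j \<in> present (history_of es (\<lambda>_. 0)) \<and>
        s x j \<le> attained \<rho> (v x) (a x) (s x) (st m x) j)) \<in> Q \<rightarrow>\<^sub>M count_space UNIV"
      by simp
    show "(\<lambda>x. if arrival_first \<rho> (v x) (a x) (s x) (st m x)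
        then Arrival (num_arrivals (history_of es (epochs m x)))
        else Departure (LEAST j. j \<in> present (history_of es (epochs m x)) \<and>
          s x j \<le> attained \<rho> (v x) (a x) (s x) (st m x) j)) \<in> Q \<rightarrow>\<^sub>M count_space UNIV"
      unfolding num_arrivals_history_of present_history_of[of es "epochs m _"] by measurable
  qed
  then show ?thesis unfolding next_event_def .
qed

end

lemma epochs_Suc:
  "epochs (Suc m) x i = (if i = m then now (H m x) + sojourn \<rho> (v x) (a x) (s x) (st m x) else epochs m x i)"
  by (auto simp: epochs_def path.now_Suc less_Suc_eq)

lemma now_epochs: "now (H m x) = (case m of 0 \<Rightarrow> 0 | Suc k \<Rightarrow> epochs m x k)"
  by (cases m) (simp_all add: epochs_def path.H_0)

text \<open>The lemmas with suffix \<open>_aux\<close> assume exactly these three facts about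
  \<open>m\<close> and deliver the measurability of every ingredient of the step to
  \<open>Suc m\<close>.\<close>

lemma state_measurable:
  "(\<lambda>x. map snd (H m x)) \<in> Q \<rightarrow>\<^sub>M count_space UNIV \<and>
   (\<forall>i. (\<lambda>x. epochs m x i) \<in> borel_measurable Q) \<and>
   (\<forall>j. (\<lambda>x. snd (st m x) j) \<in> borel_measurable Q)"
proof (induction m)
  case 0
  then show ?case by (simp add: queue_state_0 epochs_def)
next
  case (Suc m)
  then have E: "(\<lambda>x. map snd (H m x)) \<in> Q \<rightarrow>\<^sub>M count_space UNIV"
    and T: "\<And>i. (\<lambda>x. epochs m x i) \<in> borel_measurable Q"
    and att: "\<And>j. (\<lambda>x. snd (st m x) j) \<in> borel_measurable Q"
    by auto
  have "(\<lambda>x. now (H m x)) \<in> borel_measurable Q"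
    unfolding now_epochs using T by (cases m) auto
  then have "(\<lambda>x. epochs (Suc m) x i) \<in> borel_measurable Q" for i
    unfolding epochs_Suc using T sojourn_measurable_aux[OF E T att] by (cases "i = m") auto
  moreover have "(\<lambda>x. snd (st (Suc m) x) j) \<in> borel_measurable Q" for j
    using attained_measurable_aux[OF E T att] by (simp add: queue_state_Suc queue_step_eq)
  moreover have "(\<lambda>x. map snd (H m x) @ [next_event \<rho> (v x) (a x) (s x) (st m x)])
      \<in> Q \<rightarrow>\<^sub>M count_space UNIV"
  proof (rule measurable_compose_countable[OF _ E])
    fix es
    show "(\<lambda>x. es @ [next_event \<rho> (v x) (a x) (s x) (st m x)]) \<in> Q \<rightarrow>\<^sub>M count_space UNIV"
      using measurable_compose[OF next_event_measurable_aux[OF E T att],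
          of "\<lambda>e. es @ [e]" "count_space UNIV"] by simp
  qed
  ultimately show ?case
    by (simp add: queue_state_Suc queue_step_eq)
qed

lemma events_measurable: "(\<lambda>x. g (map snd (H m x))) \<in> Q \<rightarrow>\<^sub>M count_space UNIV"
  using state_measurable[of m] by (auto intro: measurable_compose)

lemmas residual_measurable [measurable] = residual_measurable_aux[OF conjunct1[OF state_measurable]
    spec[OF conjunct1[OF conjunct2[OF state_measurable]]] spec[OF conjunct2[OF conjunct2[OF state_measurable]]]]
lemmas completion_measurable [measurable] = completion_measurable_aux[OF conjunct1[OF state_measurable]
    spec[OF conjunct1[OF conjunct2[OF state_measurable]]] spec[OF conjunct2[OF conjunct2[OF state_measurable]]]]
lemmas arrival_first_measurable [measurable] = arrival_first_measurable_aux[OF conjunct1[OF state_measurable]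
    spec[OF conjunct1[OF conjunct2[OF state_measurable]]] spec[OF conjunct2[OF conjunct2[OF state_measurable]]]]
lemmas sojourn_measurable [measurable] = sojourn_measurable_aux[OF conjunct1[OF state_measurable]
    spec[OF conjunct1[OF conjunct2[OF state_measurable]]] spec[OF conjunct2[OF conjunct2[OF state_measurable]]]]

lemma attained_measurable [measurable]: "(\<lambda>x. snd (st m x) j) \<in> borel_measurable Q"
  using state_measurable[of m] by blast

lemma present_measurable [measurable]: "(\<lambda>x. present (H m x)) \<in> Q \<rightarrow>\<^sub>M count_space UNIV"
  using events_measurable[of "\<lambda>es. present (history_of es (\<lambda>_. 0))" m]
  by (simp only: present_map_snd[symmetric])

lemma num_arrivals_measurable [measurable]: "(\<lambda>x. num_arrivals (H m x)) \<in> Q \<rightarrow>\<^sub>M count_space UNIV"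
  using events_measurable[of "\<lambda>es. length (filter is_Arrival es)" m]
  by (simp only: num_arrivals_map_snd[symmetric])

lemma now_measurable [measurable]: "(\<lambda>x. now (H m x)) \<in> borel_measurable Q"
  unfolding path.now_eq_sum by measurable

lemma state_plan_measurable:
  assumes u: "u \<in> borel_measurable Q" "\<And>x. 0 \<le> u x"
  shows "(\<lambda>x. \<rho> (v x) (H m x) j (u x)) \<in> borel_measurable Q"
proof (rule countable_histories[OF conjunct1[OF state_measurable]])
  fix es
  have "\<And>i. (\<lambda>x. epochs m x i) \<in> borel_measurable Q"
    using state_measurable[of m] by blast
  then show "(\<lambda>x. \<rho> (v x) (history_of es (epochs m x)) j (u x)) \<in> borel_measurable Q"
    by (rule plan_measurable[OF _ u])
qed

end

subsection \<open>Independence of the future from the past\<close>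

lemma (in queue_path) present_subset: "present (H m) \<subseteq> {..<m}"
  using well_numbered_H[of m] num_arrivals_le[of m]
  by (auto simp: well_numbered_def present_def)

text \<open>On the right the path is driven by \<open>s'\<close>, which ignores the requirements of
  \<open>J\<close>; these enter only through the inequalities with \<open>s j\<close>, so they can
  be integrated out. \<open>service_nonanticipation\<close> is applied in both directions:
  \<open>B\<close> exceeds anything attained within \<open>m\<close> events, and conversely the
  inequalities keep the service attained along the path of \<open>s'\<close> below
  \<open>s j\<close>.\<close>

lemma (in queue_path) present_completion_iff:
  fixes B :: real and J :: "nat set"
  defines "s' \<equiv> \<lambda>j. if j \<in> J then B else s j"
  assumes ne: "J \<noteq> {}" and B: "arrival_epoch a m < B" and c: "0 \<le> c"
  shows "present (H m) = J \<and> c < d m \<longleftrightarrow>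
      present (fst (queue_state \<rho> v a s' m)) = J \<and>
      (\<forall>j\<in>J. snd (queue_state \<rho> v a s' m) j + \<rho> v (fst (queue_state \<rho> v a s' m)) j c < s j)"
    and "present (H m) = J \<Longrightarrow> queue_state \<rho> v a s' m = st m"
proof -
  let ?st' = "queue_state \<rho> v a s' m"
  have "0 < B" using arrival_epoch_nonneg[of m] B by simp
  then interpret s': queue_path \<rho> v a s'
    by unfold_locales (auto simp: s'_def wc a_nonneg s_nonneg)
  show same: "?st' = st m" if J: "present (H m) = J"
  proof (rule service_nonanticipation[where J = J])
    show "Departure j \<notin> snd ` set (H m)" if "j \<in> J" for j
      using that J by (auto simp: present_def)
    show "att m j < s' j" if "j \<in> J" for j
      using att_le_now[of m j] now_le[of m] B that by (simp add: s'_def)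
  qed (simp add: s'_def)
  have same': "st m = ?st'" if J: "present (fst ?st') = J"
    and less: "\<And>j. j \<in> J \<Longrightarrow> snd ?st' j < s j"
  proof (rule s'.service_nonanticipation[where J = J])
    show "Departure j \<notin> snd ` set (fst ?st')" if "j \<in> J" for j
      using that J by (auto simp: present_def)
    show "snd ?st' j < s j" if "j \<in> J" for j
      using that by (rule less)
  qed (simp add: s'_def)
  show "present (H m) = J \<and> c < d m \<longleftrightarrow> present (fst ?st') = J \<and>
      (\<forall>j\<in>J. snd ?st' j + \<rho> v (fst ?st') j c < s j)"
  proof
    assume L: "present (H m) = J \<and> c < d m"
    then have "\<not> (\<exists>j\<in>J. s j \<le> att m j + \<rho> v (H m) j c)"
      using next_completion_le_iff[OF wc _ c, of "H m" v s "att m"] ne by auto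
    with L same show "present (fst ?st') = J \<and> (\<forall>j\<in>J. snd ?st' j + \<rho> v (fst ?st') j c < s j)"
      by (auto simp: not_le)
  next
    assume R: "present (fst ?st') = J \<and> (\<forall>j\<in>J. snd ?st' j + \<rho> v (fst ?st') j c < s j)"
    have "snd ?st' j < s j" if "j \<in> J" for j
      using R that plan_nonneg[OF wc c, of v "fst ?st'" j] by force
    with R have eq: "st m = ?st'" by (intro same') auto
    with R ne show "present (H m) = J \<and> c < d m"
      using next_completion_le_iff[OF wc _ c, of "H m" v s "att m"] by (force simp: not_le[symmetric])
  qed
qed

section \<open>Resampling of inputs and the law of the next completion\<close>

context stable_gm1_queue
begin

definition coord :: "nat + nat + unit \<Rightarrow> 'w \<Rightarrow> real" where
  "coord = case_sum A (case_sum S (\<lambda>_. V))"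

lemma coord_simps [simp]:
  "coord (Inl k) = A k" "coord (Inr (Inl k)) = S k" "coord (Inr (Inr u)) = V"
  by (simp_all add: coord_def)

lemma coord_measurable [measurable]: "coord i \<in> borel_measurable M"
  using independent unfolding indep_vars_def coord_def by auto

lemma A_measurable [measurable]: "A k \<in> borel_measurable M"
  and S_measurable [measurable]: "S k \<in> borel_measurable M"
  and V_measurable [measurable]: "V \<in> borel_measurable M"
  using coord_measurable[of "Inl k"] coord_measurable[of "Inr (Inl k)"] coord_measurable[of "Inr (Inr ())"]
  by simp_all

abbreviation "coords \<omega> \<equiv> (\<lambda>i. coord i \<omega>)"
abbreviation "K \<equiv> (\<Pi>\<^sub>M i\<in>(UNIV :: (nat + nat + unit) set). (borel :: real measure))"

lemma coords_measurable [measurable]: "coords \<in> M \<rightarrow>\<^sub>M K"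
  by (rule measurable_PiM_single') (auto simp: space_PiM)

lemma distr_coords: "distr M K coords = (\<Pi>\<^sub>M i\<in>UNIV. distr M borel (coord i))"
  using indep_vars_iff_distr_eq_PiM[where I = UNIV and M' = "\<lambda>_. borel" and X = coord] independent coord_measurable
  unfolding coord_def[symmetric] by (simp add: restrict_def)

text \<open>By independence the joint law of the inputs is a product measure, which is preserved
  when coordinate \<open>i\<close> is overwritten by an independent copy, taken here at a second
  sample point \<open>\<omega>'\<close>. The inner integral plays the role of conditioning on all
  other inputs.\<close>

lemma resample:
  assumes f [measurable]: "f \<in> borel_measurable K"
  shows "(\<integral>\<^sup>+\<omega>. f (coords \<omega>) \<partial>M) = (\<integral>\<^sup>+\<omega>. (\<integral>\<^sup>+\<omega>'. f ((coords \<omega>)(i := coord i \<omega>')) \<partial>M) \<partial>M)"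
proof -
  let ?D = "\<lambda>i. distr M borel (coord i)"
  let ?P = "\<Pi>\<^sub>M i\<in>UNIV. ?D i"
  have D: "prob_space (?D i)" for i by (rule prob_space_distr) simp
  interpret D: prob_space "?D i" by (rule D)
  interpret P: prob_space ?P by (intro prob_space_PiM D)
  interpret DP: pair_sigma_finite "?D i" ?P ..
  have sets_P: "sets ?P = sets K" by (intro sets_PiM_cong) auto
  have upd [measurable]: "(\<lambda>(y, x). x(i := y)) \<in> ?D i \<Otimes>\<^sub>M ?P \<rightarrow>\<^sub>M K"
  proof (rule measurable_PiM_single')
    show "(\<lambda>p. (case p of (y, x) \<Rightarrow> x(i := y)) k) \<in> borel_measurable (?D i \<Otimes>\<^sub>M ?P)" for k
    proof (cases "k = i")
      case False
      have "(\<lambda>x. x k) \<in> borel_measurable ?P"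
        using measurable_component_singleton[of k UNIV ?D] by (simp cong: measurable_cong_sets)
      from measurable_compose[OF measurable_snd this] show ?thesis
        using False by (simp add: split_beta')
    qed (simp add: split_beta')
  qed (auto simp: space_PiM)
  have "(\<lambda>(x, \<omega>'). x(i := coord i \<omega>')) \<in> K \<Otimes>\<^sub>M M \<rightarrow>\<^sub>M K"
  proof (rule measurable_PiM_single')
    show "(\<lambda>p. (case p of (x, \<omega>') \<Rightarrow> x(i := coord i \<omega>')) k) \<in> borel_measurable (K \<Otimes>\<^sub>M M)" for k
      by (cases "k = i") (simp_all add: split_beta')
  qed (auto simp: space_PiM)
  from measurable_compose[OF this f]
  have inner: "(\<lambda>x. \<integral>\<^sup>+\<omega>'. f (x(i := coord i \<omega>')) \<partial>M) \<in> borel_measurable K"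
    by (intro borel_measurable_nn_integral) (simp add: split_beta')
  have upd1: "(\<lambda>y. x(i := y)) \<in> borel \<rightarrow>\<^sub>M K" for x :: "nat + nat + unit \<Rightarrow> real"
    by (rule measurable_PiM_single') (auto simp: space_PiM fun_upd_apply)
  have "(\<integral>\<^sup>+\<omega>. f (coords \<omega>) \<partial>M) = (\<integral>\<^sup>+x. f x \<partial>distr M K coords)"
    by (simp add: nn_integral_distr)
  also have "distr M K coords = ?P" by (rule distr_coords)
  also have "?P = distr (?D i \<Otimes>\<^sub>M ?P) ?P (\<lambda>(y, x). x(i := y))"
    using distr_pair_PiM_eq_PiM[of UNIV ?D i] D by simp
  also have "(\<integral>\<^sup>+x. f x \<partial>\<dots>) = (\<integral>\<^sup>+(y, x). f (x(i := y)) \<partial>(?D i \<Otimes>\<^sub>M ?P))"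
    by (subst nn_integral_distr) (auto simp: split_beta' cong: measurable_cong_sets simp: sets_P)
  also have "\<dots> = (\<integral>\<^sup>+x. (\<integral>\<^sup>+y. f (x(i := y)) \<partial>?D i) \<partial>?P)"
    by (subst DP.nn_integral_snd[symmetric]) (auto simp: split_beta')
  also have "\<dots> = (\<integral>\<^sup>+x. (\<integral>\<^sup>+\<omega>'. f (x(i := coord i \<omega>')) \<partial>M) \<partial>?P)"
    using measurable_compose[OF upd1 f] by (subst nn_integral_distr) auto
  also have "?P = distr M K coords" by (rule distr_coords[symmetric])
  also have "(\<integral>\<^sup>+x. (\<integral>\<^sup>+\<omega>'. f (x(i := coord i \<omega>')) \<partial>M) \<partial>distr M K coords) =
      (\<integral>\<^sup>+\<omega>. (\<integral>\<^sup>+\<omega>'. f ((coords \<omega>)(i := coord i \<omega>')) \<partial>M) \<partial>M)"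
    by (subst nn_integral_distr) (simp_all add: inner)
  finally show ?thesis .
qed

text \<open>The inputs as functions of a coordinate vector instead of a sample point, so that single
  coordinates can be overwritten. Truncation at \<open>0\<close> changes nothing almost surely but
  secures nonnegativity everywhere.\<close>

definition xV :: "(nat + nat + unit \<Rightarrow> real) \<Rightarrow> real" where "xV x = x (Inr (Inr ()))"
definition xA :: "(nat + nat + unit \<Rightarrow> real) \<Rightarrow> nat \<Rightarrow> real" where "xA x k = max 0 (x (Inl k))"
definition xS :: "(nat + nat + unit \<Rightarrow> real) \<Rightarrow> nat \<Rightarrow> real" where "xS x k = max 0 (x (Inr (Inl k)))"

abbreviation "Apos \<omega> k \<equiv> max 0 (A k \<omega>)"
abbreviation "Spos \<omega> k \<equiv> max 0 (S k \<omega>)"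

lemma x_coords: "xV (coords \<omega>) = V \<omega>" "xA (coords \<omega>) = Apos \<omega>" "xS (coords \<omega>) = Spos \<omega>"
  by (simp_all add: xV_def xA_def[abs_def] xS_def[abs_def])

lemma xV_measurable [measurable]: "xV \<in> borel_measurable K"
  and xA_measurable [measurable]: "(\<lambda>x. xA x k) \<in> borel_measurable K"
  and xS_measurable [measurable]: "(\<lambda>x. xS x k) \<in> borel_measurable K"
  unfolding xV_def xA_def xS_def by measurable

sublocale q: measurable_queue M \<rho> V Apos Spos
  by unfold_locales (auto simp: regime_work_conserving regime_measurable)

sublocale x: measurable_queue K \<rho> xV xA xS
  by unfold_locales (auto simp: regime_work_conserving regime_measurable xA_def xS_def)

text \<open>Customers in \<open>J\<close> cannot leave during the first \<open>m\<close> events.\<close>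

definition xSJ :: "nat set \<Rightarrow> nat \<Rightarrow> (nat + nat + unit \<Rightarrow> real) \<Rightarrow> nat \<Rightarrow> real" where
  "xSJ J m x j = (if j \<in> J then 1 + arrival_epoch (xA x) m else xS x j)"

lemma measurable_queue_J: "measurable_queue K \<rho> xV xA (xSJ J m)"
proof
  show "(\<lambda>x. xSJ J m x k) \<in> borel_measurable K" for k
    unfolding xSJ_def arrival_epoch_def by measurable
  show "0 \<le> xSJ J m x k" for x k
    using x.path.arrival_epoch_nonneg[of x m] x.s_nonneg[of x k] by (simp add: xSJ_def)
qed (auto simp: regime_work_conserving regime_measurable xA_def)

lemma mu_pos: "0 < mu"
  using lam_pos stable by simp

lemma prob_service_gt:
  assumes "0 \<le> c"
  shows "emeasure M {\<omega> \<in> space M. c < S j \<omega>} = ennreal (exp (- mu * c))"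
  using exponential_distributedD_gt[OF service_distr assms mu_pos]
  by (simp add: emeasure_eq_measure mult.commute)

lemma AE_service_pos: "AE \<omega> in M. \<forall>k. 0 < S k \<omega>"
proof (unfold AE_all_countable, intro allI)
  fix k
  have "prob {\<omega> \<in> space M. 0 < S k \<omega>} = 1"
    using exponential_distributedD_gt[OF service_distr order_refl mu_pos] by simp
  then show "AE \<omega> in M. 0 < S k \<omega>"
    by (subst (asm) prob_Collect_eq_1) auto
qed

lemma AE_service_neq: "AE \<omega> in M. max 0 (S k \<omega>) \<noteq> c"
proof -
  have "emeasure M (S k -` {c} \<inter> space M) =
      (\<integral>\<^sup>+y. ennreal (exponential_density mu y) * indicator {c} y \<partial>lborel)"
    by (rule distributed_emeasure[OF service_distr]) simp
  also have "\<dots> = 0"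
    using AE_lborel_singleton[of c] by (subst nn_integral_0_iff_AE) auto
  finally have "AE \<omega> in M. S k \<omega> \<noteq> c"
    by (intro AE_I[where N = "S k -` {c} \<inter> space M"]) auto
  with AE_service_pos show ?thesis
    by eventually_elim (metis max.absorb4)
qed

text \<open>Neither \<open>F\<close> nor the thresholds depend on the requirements in
  \<open>J\<close>, so resampling these one by one turns each indicator into the exponential tail
  probability at its threshold.\<close>

lemma integrate_out_services:
  fixes F :: "(nat + nat + unit \<Rightarrow> real) \<Rightarrow> ennreal" and g :: "nat \<Rightarrow> (nat + nat + unit \<Rightarrow> real) \<Rightarrow> real"
  assumes "finite J" and "F \<in> borel_measurable K" and "\<And>i. g i \<in> borel_measurable K"
    and "\<And>i x. 0 \<le> g i x"
    and "\<And>j x y. j \<in> J \<Longrightarrow> F (x(Inr (Inl j) := y)) = F x"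
    and "\<And>i j x y. j \<in> J \<Longrightarrow> g i (x(Inr (Inl j) := y)) = g i x"
  shows "(\<integral>\<^sup>+\<omega>. F (coords \<omega>) * (\<Prod>j\<in>J. indicator {x. g j x < xS x j} (coords \<omega>)) \<partial>M) =
    (\<integral>\<^sup>+\<omega>. F (coords \<omega>) * (\<Prod>j\<in>J. ennreal (exp (- mu * g j (coords \<omega>)))) \<partial>M)"
  using assms
proof (induction J arbitrary: F rule: finite_induct)
  case (insert j J)
  note [measurable] = insert.prems(1,2)
  note g0 = insert.prems(3)
  let ?I = "\<lambda>j x. indicator {x. g j x < xS x j} x :: ennreal"
  let ?E = "\<lambda>x. \<Prod>j\<in>J. ennreal (exp (- mu * g j x))"
  have "(\<integral>\<^sup>+\<omega>. F (coords \<omega>) * (\<Prod>j\<in>insert j J. ?I j (coords \<omega>)) \<partial>M) =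
      (\<integral>\<^sup>+\<omega>. (F (coords \<omega>) * ?I j (coords \<omega>)) * (\<Prod>j\<in>J. ?I j (coords \<omega>)) \<partial>M)"
    using insert.hyps by (simp add: mult.assoc)
  also have "\<dots> = (\<integral>\<^sup>+\<omega>. (F (coords \<omega>) * ?I j (coords \<omega>)) * ?E (coords \<omega>) \<partial>M)"
  \<comment> \<open>The induction hypothesis is used with the indicator of \<open>j\<close> absorbed
    into \<open>F\<close>: since \<open>j \<notin> J\<close>, overwriting requirements in
    \<open>J\<close> leaves \<open>xS x j\<close> alone.\<close>
  proof (rule insert.IH)
    show "(\<lambda>x. F x * ?I j x) \<in> borel_measurable K" by measurable
    show "F (x(Inr (Inl i) := y)) * ?I j (x(Inr (Inl i) := y)) = F x * ?I j x" if "i \<in> J" for i x y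
    proof -
      have "i \<noteq> j" using that insert.hyps by auto
      then have "xS (x(Inr (Inl i) := y)) j = xS x j" by (simp add: xS_def)
      moreover have "F (x(Inr (Inl i) := y)) = F x" "g j (x(Inr (Inl i) := y)) = g j x"
        using that insert.prems(4,5) by blast+
      ultimately show ?thesis by (simp only: indicator_def mem_Collect_eq)
    qed
  qed (use insert.prems in auto)
  also have "\<dots> = (\<integral>\<^sup>+\<omega>. \<integral>\<^sup>+\<omega>'. (F (coords \<omega>) * ?E (coords \<omega>)) *
      indicator {\<omega>' \<in> space M. g j (coords \<omega>) < S j \<omega>'} \<omega>' \<partial>M \<partial>M)"
    by (subst resample[where i = "Inr (Inl j)"], measurable)
       (intro nn_integral_cong, use g0 in \<open>auto simp: insert.prems(4,5) xS_def indicator_def not_less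
          intro: order.strict_trans1 dest: order.strict_trans1[OF g0]\<close>)
  also have "\<dots> = (\<integral>\<^sup>+\<omega>. F (coords \<omega>) * (\<Prod>j\<in>insert j J. ennreal (exp (- mu * g j (coords \<omega>)))) \<partial>M)"
    using insert.hyps by (simp add: nn_integral_cmult prob_service_gt g0 ac_simps)
  finally show ?case .
qed simp

text \<open>Memorylessness, however service is shared: by work conservation the thresholds of the
  customers in \<open>J\<close> add up to the total service attained plus \<open>c\<close>, and the
  product of exponentials sees only this sum. The condition \<open>0 < D\<close> on the right
  excludes ties, which \<open>AE_no_tie\<close> disposes of.\<close>

lemma completion_law_untied:
  fixes f :: "real \<Rightarrow> ennreal" and c :: "real \<Rightarrow> real" and m :: nat
  assumes J: "finite J" "J \<noteq> {}"
    and f [measurable]: "f \<in> borel_measurable borel" and c [measurable]: "c \<in> borel_measurable borel"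
    and c0: "\<And>t. 0 \<le> c t"
  defines "D \<equiv> \<lambda>\<omega>. next_completion \<rho> (V \<omega>) (Spos \<omega>) (q.H m \<omega>) (snd (q.st m \<omega>))"
    and "r \<equiv> \<lambda>\<omega>. residual_arrival (Apos \<omega>) (q.H m \<omega>)"
  shows "(\<integral>\<^sup>+\<omega>. f (r \<omega>) * indicator {\<omega>. present (q.H m \<omega>) = J \<and> c (r \<omega>) < D \<omega>} \<omega> \<partial>M) =
    (\<integral>\<^sup>+\<omega>. f (r \<omega>) * ennreal (exp (- mu * c (r \<omega>))) *
       indicator {\<omega>. present (q.H m \<omega>) = J \<and> 0 < D \<omega>} \<omega> \<partial>M)"
proof -
  interpret j: measurable_queue K \<rho> xV xA "xSJ J m" by (rule measurable_queue_J)
  define rJ where "rJ x = residual_arrival (xA x) (j.H m x)" for x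
  \<comment> \<open>The path with raised requirements, weighted by the probability that the actual
    requirements of \<open>J\<close> exceed what has been attained. Both sides of the claim are
    values of \<open>R\<close>.\<close>
  define R where "R f' = (\<integral>\<^sup>+\<omega>. f' (rJ (coords \<omega>)) * indicator {x. present (j.H m x) = J} (coords \<omega>) *
      ennreal (exp (- mu * (\<Sum>i\<in>J. snd (j.st m (coords \<omega>)) i))) \<partial>M)" for f' :: "real \<Rightarrow> ennreal"
  have rJ_measurable [measurable]: "rJ \<in> borel_measurable K"
    unfolding rJ_def by (rule j.residual_measurable)
  have inv: "xV (x(Inr (Inl j) := y)) = xV x" "xA (x(Inr (Inl j) := y)) = xA x"
      "xSJ J m (x(Inr (Inl j) := y)) = xSJ J m x" if "j \<in> J" for j x y
    using that by (auto simp: xV_def xA_def[abs_def] xSJ_def xS_def fun_eq_iff)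
  have main: "(\<integral>\<^sup>+\<omega>. f (r \<omega>) * indicator {\<omega>. present (q.H m \<omega>) = J \<and> c (r \<omega>) < D \<omega>} \<omega> \<partial>M) =
      R (\<lambda>t. f t * ennreal (exp (- mu * c t)))"
    if f [measurable]: "f \<in> borel_measurable borel" and c [measurable]: "c \<in> borel_measurable borel"
      and c0: "\<And>t. 0 \<le> c t" for f :: "real \<Rightarrow> ennreal" and c :: "real \<Rightarrow> real"
  proof -
    define g where "g i x = snd (j.st m x) i + \<rho> (xV x) (j.H m x) i (c (rJ x))" for i x
    define F where "F x = f (rJ x) * indicator {x. present (j.H m x) = J} x" for x
    have "f (r \<omega>) * indicator {\<omega>. present (q.H m \<omega>) = J \<and> c (r \<omega>) < D \<omega>} \<omega> =
        F (coords \<omega>) * (\<Prod>j\<in>J. indicator {x. g j x < xS x j} (coords \<omega>))" for \<omega>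
    proof -
      let ?x = "coords \<omega>"
      have B: "arrival_epoch (xA ?x) m < 1 + arrival_epoch (xA ?x) m" by simp
      have s': "xSJ J m ?x = (\<lambda>j. if j \<in> J then 1 + arrival_epoch (xA ?x) m else xS ?x j)"
        by (simp add: fun_eq_iff xSJ_def)
      note iff = x.path.present_completion_iff[OF J(2) B, folded s', unfolded x_coords, OF c0]
      define pJ where "pJ \<longleftrightarrow> present (j.H m ?x) = J"
      define late where "late \<longleftrightarrow> (\<forall>j\<in>J. g j ?x < xS ?x j)"
      have prod: "(\<Prod>j\<in>J. indicator {x. g j x < xS x j} ?x :: ennreal) = (if late then 1 else 0)"
        using J(1) by (auto simp: late_def prod_zero_iff indicator_def)
      have F: "F ?x = (if pJ then f (rJ ?x) else 0)"
        by (simp add: F_def pJ_def)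
      show ?thesis
      proof (cases "present (q.H m \<omega>) = J")
        case True
        then have eq: "j.st m ?x = q.st m \<omega>" using iff(2) by (simp add: x_coords)
        then have rr: "rJ ?x = r \<omega>" by (simp add: rJ_def r_def x_coords)
        have "c (r \<omega>) < D \<omega> \<longleftrightarrow> pJ \<and> late"
          using iff(1)[of "r \<omega>"] True unfolding pJ_def late_def g_def rr D_def x_coords by blast
        then show ?thesis using True rr by (simp add: prod F)
      next
        case False
        then have "\<not> (pJ \<and> late)"
          using iff(1)[of "rJ ?x"] unfolding pJ_def late_def g_def x_coords by blast
        then show ?thesis using False by (simp add: prod F)
      qed
    qed
    then have "(\<integral>\<^sup>+\<omega>. f (r \<omega>) * indicator {\<omega>. present (q.H m \<omega>) = J \<and> c (r \<omega>) < D \<omega>} \<omega> \<partial>M) =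
        (\<integral>\<^sup>+\<omega>. F (coords \<omega>) * (\<Prod>j\<in>J. indicator {x. g j x < xS x j} (coords \<omega>)) \<partial>M)"
      by simp
    also have "\<dots> = (\<integral>\<^sup>+\<omega>. F (coords \<omega>) * (\<Prod>j\<in>J. ennreal (exp (- mu * g j (coords \<omega>)))) \<partial>M)"
    proof (rule integrate_out_services)
      show "F \<in> borel_measurable K"
        unfolding F_def by measurable
      show "g i \<in> borel_measurable K" for i
        unfolding g_def[abs_def] by (intro borel_measurable_add j.attained_measurable
            j.state_plan_measurable c0 measurable_compose[OF rJ_measurable c])
      show "0 \<le> g i x" for i x
        unfolding g_def by (intro add_nonneg_nonneg j.path.att_nonneg plan_nonneg[OF j.wc] c0)
      show "F (x(Inr (Inl j) := y)) = F x" if "j \<in> J" for j x y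
        by (simp only: F_def rJ_def inv[OF that] indicator_def mem_Collect_eq)
      show "g i (x(Inr (Inl j) := y)) = g i x" if "j \<in> J" for i j x y
        by (simp only: g_def rJ_def inv[OF that])
    qed (rule J)
    also have "\<dots> = R (\<lambda>t. f t * ennreal (exp (- mu * c t)))"
      unfolding R_def
    proof (intro nn_integral_cong)
      fix \<omega>
      let ?x = "coords \<omega>"
      have "(\<Prod>i\<in>J. ennreal (exp (- mu * g i ?x))) =
          ennreal (exp (- mu * c (rJ ?x))) * ennreal (exp (- mu * (\<Sum>i\<in>J. snd (j.st m ?x) i)))"
        if pr: "present (j.H m ?x) = J"
      proof -
        have "(\<Prod>i\<in>J. ennreal (exp (- mu * g i ?x))) = ennreal (exp (\<Sum>i\<in>J. - mu * g i ?x))"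
          using J by (subst prod_ennreal) (auto simp: exp_sum)
        also have "(\<Sum>i\<in>J. - mu * g i ?x) = - mu * (\<Sum>i\<in>J. g i ?x)"
          by (simp only: sum_distrib_left)
        also have "(\<Sum>i\<in>J. g i ?x) = (\<Sum>i\<in>J. snd (j.st m ?x) i) + c (rJ ?x)"
          using plan_total[OF j.wc _ c0, of "j.H m ?x"] J pr by (simp add: g_def sum.distrib)
        finally show ?thesis
          by (simp add: ennreal_mult[symmetric] exp_add[symmetric] algebra_simps)
      qed
      then show "F ?x * (\<Prod>i\<in>J. ennreal (exp (- mu * g i ?x))) =
          f (rJ ?x) * ennreal (exp (- mu * c (rJ ?x))) * indicator {x. present (j.H m x) = J} ?x *
          ennreal (exp (- mu * (\<Sum>i\<in>J. snd (j.st m ?x) i)))"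
        by (cases "present (j.H m ?x) = J") (simp_all add: F_def mult.assoc)
    qed
    finally show ?thesis .
  qed
  have "(\<integral>\<^sup>+\<omega>. f (r \<omega>) * indicator {\<omega>. present (q.H m \<omega>) = J \<and> c (r \<omega>) < D \<omega>} \<omega> \<partial>M) =
      R (\<lambda>t. f t * ennreal (exp (- mu * c t)))"
    by (rule main[OF f c c0])
  also have "\<dots> = (\<integral>\<^sup>+\<omega>. f (r \<omega>) * ennreal (exp (- mu * c (r \<omega>))) *
       indicator {\<omega>. present (q.H m \<omega>) = J \<and> 0 < D \<omega>} \<omega> \<partial>M)"
    \<comment> \<open>With the exponential moved into \<open>f\<close> and the threshold set to
      \<open>0\<close>, the same formula leads back from \<open>R\<close> to the true path.\<close>
    using main[of "\<lambda>t. f t * ennreal (exp (- mu * c t))" "\<lambda>_. 0"] by simp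
  finally show ?thesis .
qed

end

lemma integral_cong_nn_integral:
  fixes f g :: "'a \<Rightarrow> real"
  assumes "f \<in> borel_measurable M" "g \<in> borel_measurable N" "\<And>x. 0 \<le> f x" "\<And>x. 0 \<le> g x"
    and "(\<integral>\<^sup>+x. ennreal (f x) \<partial>M) = (\<integral>\<^sup>+x. ennreal (g x) \<partial>N)"
  shows "(LINT x|M. f x) = (LINT x|N. g x)"
  using assms by (simp add: integral_eq_nn_integral)

context stable_gm1_queue
begin

text \<open>By \<open>att_le_service\<close>, an immediate completion would need a requirement equal
  to the service attained. Along the path with raised requirements the latter does not depend on the
  customer's own requirement, whose resampled law has no atom there.\<close>

lemma AE_no_tie: "AE \<omega> in M. present (q.H m \<omega>) \<noteq> {} \<longrightarrow> 0 < q.path.d \<omega> m"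
proof -
  have "AE \<omega> in M. present (q.H m \<omega>) = J \<longrightarrow> 0 < q.path.d \<omega> m"
    if J: "J \<in> Pow {..<m} - {{}}" for J
  proof -
    interpret j: measurable_queue K \<rho> xV xA "xSJ J m" by (rule measurable_queue_J)
    have neq: "AE \<omega> in M. xS (coords \<omega>) i \<noteq> snd (j.st m (coords \<omega>)) i" if "i \<in> J" for i
    proof -
      let ?f = "indicator {x. xS x i = snd (j.st m x) i} :: _ \<Rightarrow> ennreal"
      have [measurable]: "(\<lambda>x. snd (j.st m x) i) \<in> borel_measurable K"
        by (rule j.attained_measurable)
      have "{x \<in> space K. xS x i = snd (j.st m x) i} \<in> sets K"
        by (rule borel_measurable_eq) measurable
      then have f: "?f \<in> borel_measurable K"
        by (simp add: space_PiM)
      have inv: "xV (x(Inr (Inl i) := y)) = xV x" "xA (x(Inr (Inl i) := y)) = xA x"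
          "xSJ J m (x(Inr (Inl i) := y)) = xSJ J m x" for x y
        using that by (auto simp: xV_def xA_def[abs_def] xSJ_def xS_def fun_eq_iff)
      have "(\<integral>\<^sup>+\<omega>. ?f (coords \<omega>) \<partial>M) =
          (\<integral>\<^sup>+\<omega>. \<integral>\<^sup>+\<omega>'. ?f ((coords \<omega>)(Inr (Inl i) := coord (Inr (Inl i)) \<omega>')) \<partial>M \<partial>M)"
        by (rule resample[OF f])
      also have "\<dots> = (\<integral>\<^sup>+\<omega>. 0 \<partial>M)"
      proof (intro nn_integral_cong)
        fix \<omega>
        have "(\<integral>\<^sup>+\<omega>'. ?f ((coords \<omega>)(Inr (Inl i) := coord (Inr (Inl i)) \<omega>')) \<partial>M) = (\<integral>\<^sup>+\<omega>'. 0 \<partial>M)"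
        proof (rule nn_integral_cong_AE)
          show "AE \<omega>' in M. ?f ((coords \<omega>)(Inr (Inl i) := coord (Inr (Inl i)) \<omega>')) = 0"
            using AE_service_neq[of i "snd (j.st m (coords \<omega>)) i"]
          proof eventually_elim
            case (elim \<omega>')
            moreover have "xS ((coords \<omega>)(Inr (Inl i) := coord (Inr (Inl i)) \<omega>')) i = max 0 (S i \<omega>')"
              by (simp add: xS_def)
            ultimately show ?case by (simp only: indicator_def mem_Collect_eq inv) simp
          qed
        qed
        then show "(\<integral>\<^sup>+\<omega>'. ?f ((coords \<omega>)(Inr (Inl i) := coord (Inr (Inl i)) \<omega>')) \<partial>M) = 0" by simp
      qed
      finally have "AE \<omega> in M. ?f (coords \<omega>) = 0"
        using nn_integral_0_iff_AE[of "\<lambda>\<omega>. ?f (coords \<omega>)" M]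
          measurable_compose[OF coords_measurable f] by simp
      then show ?thesis
        by eventually_elim (simp add: indicator_def split: if_splits)
    qed
    from neq have "AE \<omega> in M. \<forall>i\<in>J. xS (coords \<omega>) i \<noteq> snd (j.st m (coords \<omega>)) i"
      by (subst AE_ball_countable) simp_all
    then show ?thesis
    proof eventually_elim
      case (elim \<omega>)
      show ?case
      proof (intro impI)
        assume pr: "present (q.H m \<omega>) = J"
        let ?x = "coords \<omega>"
        have B: "arrival_epoch (xA ?x) m < 1 + arrival_epoch (xA ?x) m" by simp
        have s': "xSJ J m ?x = (\<lambda>j. if j \<in> J then 1 + arrival_epoch (xA ?x) m else xS ?x j)"
          by (simp add: fun_eq_iff xSJ_def)
        from J have ne: "J \<noteq> {}" by simp
        have "j.st m ?x = q.st m \<omega>"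
          using x.path.present_completion_iff(2)[OF ne B order_refl, folded s', unfolded x_coords] pr
          by (simp only: x_coords)
        with elim have neq: "Spos \<omega> i \<noteq> q.path.att \<omega> m i" if "i \<in> J" for i
          using that by (simp only: x_coords) blast
        have "\<not> (\<exists>i\<in>J. Spos \<omega> i \<le> q.path.att \<omega> m i)"
          using neq q.path.att_le_service[of _ \<omega> m] pr by force
        then have "q.path.d \<omega> m \<noteq> 0"
          using next_completion_zero_iff[OF regime_work_conserving, of "q.H m \<omega>"] pr ne by simp
        then show "0 < q.path.d \<omega> m"
          using q.path.d_nonneg[of \<omega> m] pr ne by simp
      qed
    qed
  qed
  then have "AE \<omega> in M. \<forall>J \<in> Pow {..<m} - {{}}. present (q.H m \<omega>) = J \<longrightarrow> 0 < q.path.d \<omega> m"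
    by (intro AE_ball_countable[THEN iffD2] ballI) (auto intro: countable_finite)
  then show ?thesis
    by eventually_elim (use q.path.present_subset in blast)
qed

text \<open>A sum over the finitely many sets that can be present after \<open>m\<close> events,
  with ties discarded. The condition \<open>\<not> P 0\<close> excludes the empty system, where no
  completion is pending.\<close>

lemma completion_law:
  fixes f :: "real \<Rightarrow> ennreal" and c :: "real \<Rightarrow> real"
  assumes P: "\<not> P 0"
    and f [measurable]: "f \<in> borel_measurable borel" and c [measurable]: "c \<in> borel_measurable borel"
    and c0: "\<And>t. 0 \<le> c t"
  shows "(\<integral>\<^sup>+\<omega>. f (q.path.r \<omega> m) *
        indicator {\<omega>. P (q.path.N \<omega> m) \<and> c (q.path.r \<omega> m) < q.path.d \<omega> m} \<omega> \<partial>M) =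
    (\<integral>\<^sup>+\<omega>. f (q.path.r \<omega> m) * ennreal (exp (- mu * c (q.path.r \<omega> m))) *
        indicator {\<omega>. P (q.path.N \<omega> m)} \<omega> \<partial>M)"
proof -
  define \<J> where "\<J> = {J. J \<subseteq> {..<m} \<and> P (card J)}"
  have fin: "finite \<J>" unfolding \<J>_def by simp
  have J: "finite J" "J \<noteq> {}" if "J \<in> \<J>" for J
    using that P by (auto simp: \<J>_def intro: finite_subset)
  have split: "(\<integral>\<^sup>+\<omega>. g \<omega> * indicator {\<omega>. P (q.path.N \<omega> m) \<and> T \<omega>} \<omega> \<partial>M) =
      (\<Sum>J\<in>\<J>. \<integral>\<^sup>+\<omega>. g \<omega> * indicator {\<omega>. present (q.H m \<omega>) = J \<and> T \<omega>} \<omega> \<partial>M)"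
    if [measurable]: "g \<in> borel_measurable M" "Measurable.pred M T" for g :: "'w \<Rightarrow> ennreal" and T
  proof -
    have "indicator {\<omega>. P (q.path.N \<omega> m) \<and> T \<omega>} \<omega> =
        (\<Sum>J\<in>\<J>. indicator {\<omega>. present (q.H m \<omega>) = J \<and> T \<omega>} \<omega> :: ennreal)" for \<omega>
    proof -
      have "(\<Sum>J\<in>\<J>. indicator {\<omega>. present (q.H m \<omega>) = J \<and> T \<omega>} \<omega> :: ennreal) =
          (\<Sum>J\<in>\<J>. if J = present (q.H m \<omega>) then of_bool (T \<omega>) else 0)"
        by (intro sum.cong) (auto simp: indicator_def)
      also have "\<dots> = (if present (q.H m \<omega>) \<in> \<J> then of_bool (T \<omega>) else 0)"
        using fin by (simp add: sum.delta)
      finally show ?thesis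
        using q.path.present_subset[of \<omega> m] by (simp add: \<J>_def indicator_def)
    qed
    then show ?thesis
      by (simp add: sum_distrib_left) (subst nn_integral_sum; measurable)
  qed
  have "(\<integral>\<^sup>+\<omega>. f (q.path.r \<omega> m) *
        indicator {\<omega>. P (q.path.N \<omega> m) \<and> c (q.path.r \<omega> m) < q.path.d \<omega> m} \<omega> \<partial>M) =
     (\<Sum>J\<in>\<J>. \<integral>\<^sup>+\<omega>. f (q.path.r \<omega> m) *
        indicator {\<omega>. present (q.H m \<omega>) = J \<and> c (q.path.r \<omega> m) < q.path.d \<omega> m} \<omega> \<partial>M)"
    by (rule split) measurable
  also have "\<dots> = (\<Sum>J\<in>\<J>. \<integral>\<^sup>+\<omega>. f (q.path.r \<omega> m) * ennreal (exp (- mu * c (q.path.r \<omega> m))) *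
        indicator {\<omega>. present (q.H m \<omega>) = J \<and> 0 < q.path.d \<omega> m} \<omega> \<partial>M)"
    by (intro sum.cong refl completion_law_untied J f c c0)
  also have "\<dots> = (\<integral>\<^sup>+\<omega>. f (q.path.r \<omega> m) * ennreal (exp (- mu * c (q.path.r \<omega> m))) *
        indicator {\<omega>. P (q.path.N \<omega> m) \<and> 0 < q.path.d \<omega> m} \<omega> \<partial>M)"
    by (rule split[symmetric]) measurable
  also have "\<dots> = (\<integral>\<^sup>+\<omega>. f (q.path.r \<omega> m) * ennreal (exp (- mu * c (q.path.r \<omega> m))) *
        indicator {\<omega>. P (q.path.N \<omega> m)} \<omega> \<partial>M)"
  proof (rule nn_integral_cong_AE)
    show "AE \<omega> in M. f (q.path.r \<omega> m) * ennreal (exp (- mu * c (q.path.r \<omega> m))) *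
          indicator {\<omega>. P (q.path.N \<omega> m) \<and> 0 < q.path.d \<omega> m} \<omega> =
        f (q.path.r \<omega> m) * ennreal (exp (- mu * c (q.path.r \<omega> m))) * indicator {\<omega>. P (q.path.N \<omega> m)} \<omega>"
      using AE_no_tie[of m]
    proof eventually_elim
      case (elim \<omega>)
      then have "P (q.path.N \<omega> m) \<Longrightarrow> 0 < q.path.d \<omega> m" using P by (cases "present (q.H m \<omega>) = {}") auto
      then show ?case by (auto simp: indicator_def)
    qed
  qed
  finally show ?thesis .
qed

text \<open>\<open>completion_law\<close> with the residual time itself as threshold;
  \<open>max 0\<close> merely makes the threshold nonnegative on all reals.\<close>

lemma expectation_arrival:
  assumes P: "\<not> P 0"
  shows "expectation (\<lambda>\<omega>. of_bool (P (q.path.N \<omega> m) \<and> q.path.arr \<omega> m)) =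
    expectation (\<lambda>\<omega>. of_bool (P (q.path.N \<omega> m)) * exp (- mu * q.path.r \<omega> m))"
proof (rule integral_cong_nn_integral)
  have "(\<integral>\<^sup>+\<omega>. ennreal (of_bool (P (q.path.N \<omega> m) \<and> q.path.arr \<omega> m)) \<partial>M) =
      (\<integral>\<^sup>+\<omega>. 1 * indicator {\<omega>. P (q.path.N \<omega> m) \<and> max 0 (q.path.r \<omega> m) < q.path.d \<omega> m} \<omega> \<partial>M)"
    using P q.path.r_nonneg
    by (intro nn_integral_cong) (auto simp: indicator_def arrival_first_def max_absorb2)
  also have "\<dots> = (\<integral>\<^sup>+\<omega>. 1 * ennreal (exp (- mu * max 0 (q.path.r \<omega> m))) *
      indicator {\<omega>. P (q.path.N \<omega> m)} \<omega> \<partial>M)"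
    by (rule completion_law[where P = P and f = "\<lambda>_. 1" and c = "max 0", OF P]) auto
  also have "\<dots> = (\<integral>\<^sup>+\<omega>. ennreal (of_bool (P (q.path.N \<omega> m)) * exp (- mu * q.path.r \<omega> m)) \<partial>M)"
    using q.path.r_nonneg by (intro nn_integral_cong) (auto simp: indicator_def max_absorb2)
  finally show "(\<integral>\<^sup>+\<omega>. ennreal (of_bool (P (q.path.N \<omega> m) \<and> q.path.arr \<omega> m)) \<partial>M) =
    (\<integral>\<^sup>+\<omega>. ennreal (of_bool (P (q.path.N \<omega> m)) * exp (- mu * q.path.r \<omega> m)) \<partial>M)" .
qed auto

lemma nn_integral_exp_Ico:
  assumes "0 \<le> t"
  shows "(\<integral>\<^sup>+y. ennreal (exp (- mu * y)) * indicator {0..<t} y \<partial>lborel) = ennreal ((1 - exp (- mu * t)) / mu)"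
proof -
  have "(\<integral>\<^sup>+y. ennreal (exp (- mu * y)) * indicator {0..<t} y \<partial>lborel) =
      (\<integral>\<^sup>+y. ennreal (exp (- mu * y)) * indicator {0..t} y \<partial>lborel)"
    using AE_lborel_singleton[of t] by (intro nn_integral_cong_AE) (auto simp: indicator_def)
  also have "\<dots> = ennreal (- exp (- mu * t) / mu - (- exp (- mu * 0) / mu))"
    using mu_pos assms
    by (intro nn_integral_FTC_Icc) (auto intro!: derivative_eq_intros)
  finally show ?thesis by (simp add: diff_divide_distrib)
qed

text \<open>Layer-cake formula: the sojourn, being the minimum of residual and completion time, is
  the integral over \<open>y \<ge> 0\<close> of the indicator that both exceed \<open>y\<close>. For
  each \<open>y\<close>, \<open>completion_law\<close> applies with the constant threshold
  \<open>y\<close>, and Fubini exchanges the integrals.\<close>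

lemma expectation_sojourn:
  assumes P: "\<not> P 0"
  shows "expectation (\<lambda>\<omega>. of_bool (P (q.path.N \<omega> m)) * q.path.u \<omega> m) =
    expectation (\<lambda>\<omega>. of_bool (P (q.path.N \<omega> m)) * ((1 - exp (- mu * q.path.r \<omega> m)) / mu))"
proof (rule integral_cong_nn_integral)
  interpret ml: pair_sigma_finite M lborel ..
  let ?I = "\<lambda>\<omega>. indicator {\<omega>. P (q.path.N \<omega> m)} \<omega> :: ennreal"
  have "(\<integral>\<^sup>+\<omega>. ennreal (of_bool (P (q.path.N \<omega> m)) * q.path.u \<omega> m) \<partial>M) =
      (\<integral>\<^sup>+\<omega>. (\<integral>\<^sup>+y. ?I \<omega> * indicator {y. 0 \<le> y \<and> y < q.path.u \<omega> m} y \<partial>lborel) \<partial>M)"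
  proof (intro nn_integral_cong)
    fix \<omega>
    have "{y. 0 \<le> y \<and> y < q.path.u \<omega> m} = {0..<q.path.u \<omega> m}" by auto
    then show "ennreal (of_bool (P (q.path.N \<omega> m)) * q.path.u \<omega> m) =
        (\<integral>\<^sup>+y. ?I \<omega> * indicator {y. 0 \<le> y \<and> y < q.path.u \<omega> m} y \<partial>lborel)"
      using q.path.u_nonneg[of \<omega> m] by (simp add: nn_integral_cmult indicator_def[of _ \<omega>])
  qed
  also have "\<dots> = (\<integral>\<^sup>+y. (\<integral>\<^sup>+\<omega>. ?I \<omega> * indicator {y. 0 \<le> y \<and> y < q.path.u \<omega> m} y \<partial>M) \<partial>lborel)"
  proof (rule ml.Fubini'[symmetric])
    have "Measurable.pred (M \<Otimes>\<^sub>M lborel) (\<lambda>p. 0 \<le> snd p \<and> snd p < q.path.u (fst p) m)"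
      by measurable
    then show "(\<lambda>(\<omega>, y). ?I \<omega> * indicator {y. 0 \<le> y \<and> y < q.path.u \<omega> m} y) \<in> borel_measurable (M \<Otimes>\<^sub>M lborel)"
      unfolding split_beta' indicator_def mem_Collect_eq by measurable
  qed
  also have "\<dots> = (\<integral>\<^sup>+y. indicator {0..} y * (\<integral>\<^sup>+\<omega>. indicator {y<..} (q.path.r \<omega> m) *
      indicator {\<omega>. P (q.path.N \<omega> m) \<and> max 0 y < q.path.d \<omega> m} \<omega> \<partial>M) \<partial>lborel)"
  proof (intro nn_integral_cong)
    fix y :: real
    have "?I \<omega> * indicator {y. 0 \<le> y \<and> y < q.path.u \<omega> m} y = indicator {0..} y *
        (indicator {y<..} (q.path.r \<omega> m) * indicator {\<omega>. P (q.path.N \<omega> m) \<and> max 0 y < q.path.d \<omega> m} \<omega>)" for \<omega>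
    proof (cases "P (q.path.N \<omega> m)")
      case True
      then have "present (q.H m \<omega>) \<noteq> {}" using P by auto
      then show ?thesis using True by (auto simp: indicator_def q.path.u_eq_min)
    qed simp
    then show "(\<integral>\<^sup>+\<omega>. ?I \<omega> * indicator {y. 0 \<le> y \<and> y < q.path.u \<omega> m} y \<partial>M) =
      indicator {0..} y * (\<integral>\<^sup>+\<omega>. indicator {y<..} (q.path.r \<omega> m) *
      indicator {\<omega>. P (q.path.N \<omega> m) \<and> max 0 y < q.path.d \<omega> m} \<omega> \<partial>M)"
      by (simp add: nn_integral_cmult)
  qed
  also have "\<dots> = (\<integral>\<^sup>+y. indicator {0..} y * (\<integral>\<^sup>+\<omega>. indicator {y<..} (q.path.r \<omega> m) *
      ennreal (exp (- mu * max 0 y)) * ?I \<omega> \<partial>M) \<partial>lborel)"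
    by (intro nn_integral_cong arg_cong2[where f = "(*)"] refl
        completion_law[where P = P and f = "indicator {_<..}" and c = "\<lambda>_. max 0 _", OF P]) auto
  also have "\<dots> = (\<integral>\<^sup>+y. (\<integral>\<^sup>+\<omega>. ?I \<omega> * (ennreal (exp (- mu * y)) *
      indicator {y. 0 \<le> y \<and> y < q.path.r \<omega> m} y) \<partial>M) \<partial>lborel)"
    by (intro nn_integral_cong, subst nn_integral_cmult[symmetric], measurable)
       (auto simp: indicator_def max_absorb2 intro!: nn_integral_cong)
  also have "\<dots> = (\<integral>\<^sup>+\<omega>. (\<integral>\<^sup>+y. ?I \<omega> * (ennreal (exp (- mu * y)) *
      indicator {y. 0 \<le> y \<and> y < q.path.r \<omega> m} y) \<partial>lborel) \<partial>M)"
  proof (rule ml.Fubini')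
    have "Measurable.pred (M \<Otimes>\<^sub>M lborel) (\<lambda>p. 0 \<le> snd p \<and> snd p < q.path.r (fst p) m)"
      by measurable
    then show "(\<lambda>(\<omega>, y). ?I \<omega> * (ennreal (exp (- mu * y)) *
        indicator {y. 0 \<le> y \<and> y < q.path.r \<omega> m} y)) \<in> borel_measurable (M \<Otimes>\<^sub>M lborel)"
      unfolding split_beta' indicator_def mem_Collect_eq by measurable
  qed
  also have "\<dots> = (\<integral>\<^sup>+\<omega>. ennreal (of_bool (P (q.path.N \<omega> m)) *
      ((1 - exp (- mu * q.path.r \<omega> m)) / mu)) \<partial>M)"
  proof (intro nn_integral_cong)
    fix \<omega>
    have "{y. 0 \<le> y \<and> y < q.path.r \<omega> m} = {0..<q.path.r \<omega> m}" by auto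
    then show "(\<integral>\<^sup>+y. ?I \<omega> * (ennreal (exp (- mu * y)) *
        indicator {y. 0 \<le> y \<and> y < q.path.r \<omega> m} y) \<partial>lborel) =
        ennreal (of_bool (P (q.path.N \<omega> m)) * ((1 - exp (- mu * q.path.r \<omega> m)) / mu))"
      using nn_integral_exp_Ico[OF q.path.r_nonneg, of \<omega> m]
      by (simp add: nn_integral_cmult indicator_def[of _ \<omega>])
  qed
  finally show "(\<integral>\<^sup>+\<omega>. ennreal (of_bool (P (q.path.N \<omega> m)) * q.path.u \<omega> m) \<partial>M) =
      (\<integral>\<^sup>+\<omega>. ennreal (of_bool (P (q.path.N \<omega> m)) * ((1 - exp (- mu * q.path.r \<omega> m)) / mu)) \<partial>M)" .
qed (use q.path.u_nonneg q.path.r_nonneg mu_pos in auto)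

text \<open>Both sides are the expectation of \<open>1 - exp (- mu * r)\<close> on the event given
  by \<open>P\<close>: the server completes at rate \<open>mu\<close> while busy.\<close>

lemma expectation_departure:
  assumes P: "\<not> P 0"
  shows "expectation (\<lambda>\<omega>. of_bool (P (q.path.N \<omega> m) \<and> \<not> q.path.arr \<omega> m)) =
    mu * expectation (\<lambda>\<omega>. of_bool (P (q.path.N \<omega> m)) * q.path.u \<omega> m)"
proof -
  have int: "integrable M (\<lambda>\<omega>. of_bool (P (q.path.N \<omega> m)) * exp (- mu * q.path.r \<omega> m) :: real)"
    using q.path.r_nonneg mu_pos
    by (intro integrable_const_bound[where B = 1]) (auto simp: abs_mult)
  have int': "integrable M (\<lambda>\<omega>. of_bool (P (q.path.N \<omega> m)) :: real)"
    "integrable M (\<lambda>\<omega>. of_bool (P (q.path.N \<omega> m) \<and> q.path.arr \<omega> m) :: real)"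
    by (intro integrable_const_bound[where B = 1]; auto)+
  have "expectation (\<lambda>\<omega>. of_bool (P (q.path.N \<omega> m) \<and> \<not> q.path.arr \<omega> m)) =
      expectation (\<lambda>\<omega>. of_bool (P (q.path.N \<omega> m)) - of_bool (P (q.path.N \<omega> m) \<and> q.path.arr \<omega> m))"
    by (intro Bochner_Integration.integral_cong) auto
  also have "\<dots> = expectation (\<lambda>\<omega>. of_bool (P (q.path.N \<omega> m))) -
      expectation (\<lambda>\<omega>. of_bool (P (q.path.N \<omega> m)) * exp (- mu * q.path.r \<omega> m))"
    using expectation_arrival[of P m] P int' by simp
  also have "\<dots> = expectation (\<lambda>\<omega>. mu * (of_bool (P (q.path.N \<omega> m)) * ((1 - exp (- mu * q.path.r \<omega> m)) / mu)))"
    using int int' mu_pos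
    by (subst Bochner_Integration.integral_diff[symmetric]) (auto simp: field_simps)
  also have "\<dots> = mu * expectation (\<lambda>\<omega>. of_bool (P (q.path.N \<omega> m)) * q.path.u \<omega> m)"
    by (simp only: expectation_sojourn[of P m, OF P] Bochner_Integration.integral_mult_right_zero)
  finally show ?thesis .
qed

end

section \<open>The law of a newly started inter-arrival time\<close>

context stable_gm1_queue
begin

lemma distr_Apos: "(\<integral>\<^sup>+\<omega>. f (Apos \<omega> k) \<partial>M) = (\<integral>\<^sup>+y. f (max 0 y) \<partial>G)"
  if [measurable]: "f \<in> borel_measurable borel" for f :: "real \<Rightarrow> ennreal"
  by (subst interarrival_distr[of k, symmetric]) (simp add: nn_integral_distr)

text \<open>If customer \<open>k\<close> arrives at this event, the residual time becomes
  inter-arrival time \<open>Suc k\<close>, which has not influenced the path yet; that coordinate is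
  resampled. As \<open>k\<close> is random, the event is split by its value, which is at most
  \<open>m\<close>.\<close>

lemma expectation_after_arrival:
  fixes f :: "real \<Rightarrow> real"
  assumes f [measurable]: "f \<in> borel_measurable borel" and f0: "\<And>t. 0 \<le> f t"
  shows "expectation (\<lambda>\<omega>. of_bool (P (q.path.N \<omega> m) \<and> q.path.arr \<omega> m) * f (q.path.r \<omega> (Suc m))) =
    expectation (\<lambda>\<omega>. of_bool (P (q.path.N \<omega> m) \<and> q.path.arr \<omega> m)) * (LINT y|G. f (max 0 y))"
proof -
  define Q where "Q k x \<longleftrightarrow> num_arrivals (x.H m x) = k \<and> P (x.path.N x m) \<and> x.path.arr x m" for k x
  have Q_measurable [measurable]: "Measurable.pred K (Q k)" for k
    unfolding Q_def[abs_def] by measurable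
  \<comment> \<open>Whether event \<open>m\<close> is an arrival can be read off the increase of
    \<open>num_arrivals\<close>, so equality of the states at \<open>m\<close> and
    \<open>Suc m\<close> transports \<open>Q k\<close>.\<close>
  have Q_imp: "Q k (x(Inl (Suc k) := y))" if Q: "Q k x" for k x y
  proof -
    let ?x' = "x(Inl (Suc k) := y)"
    have eq: "xV ?x' = xV x" "xS ?x' = xS x" "\<And>i. i \<le> k \<Longrightarrow> xA ?x' i = xA x i"
      by (auto simp: xV_def xS_def[abs_def] xA_def)
    have le: "num_arrivals (x.H m x) \<le> k" using Q by (simp add: Q_def)
    have st: "x.st m ?x' = x.st m x" "x.st (Suc m) ?x' = x.st (Suc m) x"
      using x.path.arrival_nonanticipation[of k "xA ?x'" x m, OF eq(3) le] eq(1,2) by simp_all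
    have "num_arrivals (x.H (Suc m) ?x') = Suc (num_arrivals (x.H m ?x'))"
      using Q x.path.num_arrivals_Suc[of x m] unfolding st by (simp add: Q_def)
    then have "x.path.arr ?x' m"
      using x.path.num_arrivals_Suc[of ?x' m] by (simp split: if_splits)
    then show ?thesis using Q st(1) by (simp add: Q_def)
  qed
  have Q_iff: "Q k (x(Inl (Suc k) := y)) \<longleftrightarrow> Q k x" for k x y
  proof
    assume "Q k (x(Inl (Suc k) := y))"
    \<comment> \<open>Overwriting the coordinate once more, with its old value, gives the
      converse.\<close>
    then have "Q k ((x(Inl (Suc k) := y))(Inl (Suc k) := x (Inl (Suc k))))" by (rule Q_imp)
    then show "Q k x" by (simp only: fun_upd_upd fun_upd_triv)
  qed (rule Q_imp)
  let ?\<phi> = "\<integral>\<^sup>+y. ennreal (f (max 0 y)) \<partial>G"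
  have part: "(\<integral>\<^sup>+\<omega>. of_bool (Q k (coords \<omega>)) * ennreal (f (Apos \<omega> (Suc k))) \<partial>M) =
      (\<integral>\<^sup>+\<omega>. of_bool (Q k (coords \<omega>)) \<partial>M) * ?\<phi>" for k
  proof -
    have "(\<integral>\<^sup>+\<omega>. of_bool (Q k (coords \<omega>)) * ennreal (f (Apos \<omega> (Suc k))) \<partial>M) =
        (\<integral>\<^sup>+\<omega>. of_bool (Q k (coords \<omega>)) * ennreal (f (xA (coords \<omega>) (Suc k))) \<partial>M)"
      by (simp add: x_coords)
    also have "\<dots> = (\<integral>\<^sup>+\<omega>. \<integral>\<^sup>+\<omega>'. of_bool (Q k ((coords \<omega>)(Inl (Suc k) := coord (Inl (Suc k)) \<omega>'))) *
        ennreal (f (xA ((coords \<omega>)(Inl (Suc k) := coord (Inl (Suc k)) \<omega>')) (Suc k))) \<partial>M \<partial>M)"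
      by (rule resample) measurable
    also have "\<dots> = (\<integral>\<^sup>+\<omega>. \<integral>\<^sup>+\<omega>'. of_bool (Q k (coords \<omega>)) * ennreal (f (Apos \<omega>' (Suc k))) \<partial>M \<partial>M)"
      by (simp only: Q_iff) (simp add: xA_def)
    also have "\<dots> = (\<integral>\<^sup>+\<omega>. of_bool (Q k (coords \<omega>)) * ?\<phi> \<partial>M)"
      using distr_Apos[of "\<lambda>y. ennreal (f y)" "Suc k"] by (simp add: nn_integral_cmult)
    also have "\<dots> = (\<integral>\<^sup>+\<omega>. of_bool (Q k (coords \<omega>)) \<partial>M) * ?\<phi>"
      by (rule nn_integral_multc) measurable
    finally show ?thesis .
  qed
  have split: "ennreal (of_bool (P (q.path.N \<omega> m) \<and> q.path.arr \<omega> m) * g (q.path.r \<omega> (Suc m))) =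
      (\<Sum>k\<le>m. of_bool (Q k (coords \<omega>)) * ennreal (g (Apos \<omega> (Suc k))))" for \<omega> and g :: "real \<Rightarrow> real"
  proof -
    have "(\<Sum>k\<le>m. of_bool (Q k (coords \<omega>)) * ennreal (g (Apos \<omega> (Suc k)))) =
        (\<Sum>k\<le>m. if k = num_arrivals (q.H m \<omega>) then of_bool (P (q.path.N \<omega> m) \<and> q.path.arr \<omega> m) *
            ennreal (g (Apos \<omega> (Suc k))) else 0)"
      by (intro sum.cong) (auto simp: Q_def x_coords)
    also have "\<dots> = of_bool (P (q.path.N \<omega> m) \<and> q.path.arr \<omega> m) *
        ennreal (g (Apos \<omega> (Suc (num_arrivals (q.H m \<omega>)))))"
      using q.path.num_arrivals_le[of \<omega> m] by simp
    also have "\<dots> = ennreal (of_bool (P (q.path.N \<omega> m) \<and> q.path.arr \<omega> m) * g (q.path.r \<omega> (Suc m)))"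
      using q.path.r_Suc_arr[of \<omega> m] by (cases "q.path.arr \<omega> m") auto
    finally show ?thesis ..
  qed
  have "(\<integral>\<^sup>+\<omega>. ennreal (of_bool (P (q.path.N \<omega> m) \<and> q.path.arr \<omega> m) * f (q.path.r \<omega> (Suc m))) \<partial>M) =
      (\<Sum>k\<le>m. (\<integral>\<^sup>+\<omega>. of_bool (Q k (coords \<omega>)) * ennreal (f (Apos \<omega> (Suc k))) \<partial>M))"
    unfolding split[of _ f] by (rule nn_integral_sum) measurable
  also have "\<dots> = (\<Sum>k\<le>m. (\<integral>\<^sup>+\<omega>. of_bool (Q k (coords \<omega>)) * ennreal 1 \<partial>M)) * ?\<phi>"
    by (simp add: part sum_distrib_right)
  also have "(\<Sum>k\<le>m. (\<integral>\<^sup>+\<omega>. of_bool (Q k (coords \<omega>)) * ennreal 1 \<partial>M)) =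
      (\<integral>\<^sup>+\<omega>. (\<Sum>k\<le>m. of_bool (Q k (coords \<omega>)) * ennreal 1) \<partial>M)"
    by (rule nn_integral_sum[symmetric]) measurable
  also have "\<dots> = (\<integral>\<^sup>+\<omega>. ennreal (of_bool (P (q.path.N \<omega> m) \<and> q.path.arr \<omega> m)) \<partial>M)"
    using split[of _ "\<lambda>_. 1"] by simp
  finally have *: "(\<integral>\<^sup>+\<omega>. ennreal (of_bool (P (q.path.N \<omega> m) \<and> q.path.arr \<omega> m) * f (q.path.r \<omega> (Suc m))) \<partial>M) =
      (\<integral>\<^sup>+\<omega>. ennreal (of_bool (P (q.path.N \<omega> m) \<and> q.path.arr \<omega> m)) \<partial>M) * ?\<phi>" .
  have [measurable_cong]: "sets G = sets borel"
    using interarrival_distr[of 0] by auto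
  show ?thesis
    using f0 by (subst (1 2 3) integral_eq_nn_integral) (auto simp: * enn2real_mult)
qed

lemma sets_G [measurable_cong]: "sets G = sets borel"
  using interarrival_distr[of 0] by auto

lemma prob_space_G: "prob_space G"
  using prob_space_distr[OF A_measurable, of 0] by (simp add: interarrival_distr)

lemma lst_G: "(LINT y|G. exp (- mu * max 0 y)) = lst G mu"
  unfolding lst_def set_lebesgue_integral_def
  using interarrival_pos by (intro integral_cong_AE) (auto simp: max_absorb2)

lemma lst_G_pos: "0 < lst G mu"
proof -
  interpret G: prob_space G by (rule prob_space_G)
  have "integrable G (\<lambda>y. exp (- mu * max 0 y))"
    using mu_pos by (intro G.integrable_const_bound[where B = 1]) auto
  then show ?thesis
    unfolding lst_G[symmetric] by (rule G.expectation_greater) simp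
qed

lemma mean_G: "(LINT y|G. max 0 y) = 1 / lam"
  unfolding interarrival_mean[symmetric]
  using interarrival_pos by (intro integral_cong_AE) (auto simp: max_absorb2)

lemma integrable_max_G: "integrable G (\<lambda>y. max 0 y)"
  using interarrival_integrable by (intro integrable_max) auto

lemma Apos_integrable: "integrable M (\<lambda>\<omega>. Apos \<omega> k)"
  and expectation_Apos: "expectation (\<lambda>\<omega>. Apos \<omega> k) = 1 / lam"
proof -
  have "integrable (distr M borel (A k)) (\<lambda>y. max 0 y)"
    using integrable_max_G by (simp add: interarrival_distr)
  then show "integrable M (\<lambda>\<omega>. Apos \<omega> k)" by (rule integrable_distr[rotated]) simp
  show "expectation (\<lambda>\<omega>. Apos \<omega> k) = 1 / lam"
    using integral_distr[OF A_measurable, of "\<lambda>y. max 0 y" k] by (simp add: interarrival_distr mean_G)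
qed

end

subsection \<open>Empirical frequencies\<close>

lemma real_card_less: "real (card {i::nat. i < m \<and> Q i}) = (\<Sum>i<m. of_bool (Q i))"
proof -
  have "{i. i < m \<and> Q i} = {..<m} \<inter> {i. Q i}" by auto
  then show ?thesis by simp
qed

text \<open>Counts are to stay sums of indicators, on which expectation acts linearly, instead of
  being simplified to cardinalities.\<close>

declare sum_of_bool_eq [simp del] sum_of_bool_mult_eq [simp del] sum_mult_of_bool_eq [simp del]

context queue_path
begin

abbreviation "hist \<equiv> queue_history \<rho> v a s"

lemma hist_eq: "hist m = H m"
  by (simp add: queue_history_eq)

lemma event_at_hist: "event_at hist i = evt i"
  by (simp add: event_at_def hist_eq H_Suc)

definition arrivals_finding :: "nat \<Rightarrow> nat \<Rightarrow> real" where
  "arrivals_finding n m = (\<Sum>i<m. of_bool (N i = n \<and> arr i))"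

definition departures_leaving :: "nat \<Rightarrow> nat \<Rightarrow> real" where
  "departures_leaving n m = (\<Sum>i<m. of_bool (N i = Suc n \<and> \<not> arr i))"

definition time_spent :: "nat \<Rightarrow> nat \<Rightarrow> real" where
  "time_spent n m = (\<Sum>i<m. of_bool (N i = n) * u i)"

lemma departure_leaves_iff: "\<not> arr i \<Longrightarrow> N (Suc i) = n \<longleftrightarrow> N i = Suc n"
  using N_Suc_dep[of i] by auto

lemma num_arrivals_eq_sum: "real (num_arrivals (H m)) = (\<Sum>i<m. of_bool (arr i))"
  by (induction m) (simp_all add: H_0 num_arrivals_Suc)

lemma num_arrivals_ge: "real m \<le> 2 * real (num_arrivals (H m))"
  using N_arrivals[of m] by linarith

lemma arrival_freq_eq: "arrival_freq hist n m = arrivals_finding n m / real (num_arrivals (H m))"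
  unfolding arrival_freq_def arrivals_finding_def num_arrivals_eq_sum real_card_less
  by (simp add: event_at_hist is_Arrival_ev hist_eq conj_commute)

lemma departure_residual_freq_eq:
  "departure_residual_freq a hist n x m =
    (\<Sum>i<m. of_bool (N i = Suc n \<and> \<not> arr i) * of_bool (r (Suc i) \<le> x)) / departures_leaving n m"
proof -
  have iff: "(is_Departure (event_at hist i) \<and> card (present (hist (Suc i))) = n) =
      (N i = Suc n \<and> \<not> arr i)" for i
    using departure_leaves_iff[of i n] by (auto simp: event_at_hist is_Departure_ev hist_eq)
  have "{i. i < m \<and> is_Departure (event_at hist i) \<and> card (present (hist (Suc i))) = n \<and>
      residual_arrival a (hist (Suc i)) \<le> x} = {i. i < m \<and> ((N i = Suc n \<and> \<not> arr i) \<and> r (Suc i) \<le> x)}"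
    using iff by (auto simp: hist_eq)
  then show ?thesis
    unfolding departure_residual_freq_def departures_leaving_def iff
    by (simp only: real_card_less of_bool_conj)
qed

text \<open>Upcrossings and downcrossings between \<open>n\<close> and \<open>Suc n\<close>
  alternate from the empty start, with an excess of one upcrossing exactly while the path is above
  \<open>n\<close>.\<close>

lemma arrivals_departures_balance:
  "arrivals_finding n m = departures_leaving n m + of_bool (n < N m)"
proof (induction m)
  case (Suc m)
  then show ?case
    using N_Suc_arr[of m] N_Suc_dep[of m]
    by (cases "arr m") (auto simp: arrivals_finding_def departures_leaving_def)
qed (simp add: arrivals_finding_def departures_leaving_def H_0)

lemma total_departures_le: "(\<Sum>i<m. of_bool (N i \<noteq> 0 \<and> \<not> arr i)) \<le> real (num_arrivals (H m))"
proof -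
  have "(\<Sum>i<m. of_bool (N i \<noteq> 0 \<and> \<not> arr i)) \<le> (\<Sum>i<m. 1 - of_bool (arr i) :: real)"
    by (intro sum_mono) auto
  also have "\<dots> = real m - real (num_arrivals (H m))"
    by (simp add: sum_subtractf num_arrivals_eq_sum)
  finally show ?thesis using num_arrivals_ge[of m] by simp
qed

text \<open>A state with \<open>n\<close> customers is classified by the event that led to it, which
  shifts the index by one; \<open>n \<noteq> 0\<close> removes the empty initial state.\<close>

lemma arrival_balance:
  assumes "n \<noteq> 0"
  shows "(\<Sum>i<Suc m. of_bool (N i = n) * f (r i)) =
    (\<Sum>i<m. of_bool (N i = n - 1 \<and> arr i) * f (r (Suc i))) +
    (\<Sum>i<m. of_bool (N i = Suc n \<and> \<not> arr i) * f (r (Suc i)) :: real)"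
proof -
  have "(\<Sum>i<Suc m. of_bool (N i = n) * f (r i)) = (\<Sum>i<m. of_bool (N (Suc i) = n) * f (r (Suc i)))"
    using assms by (subst sum.lessThan_Suc_shift) (simp add: H_0)
  also have "\<dots> = (\<Sum>i<m. of_bool (N i = n - 1 \<and> arr i) * f (r (Suc i)) +
      of_bool (N i = Suc n \<and> \<not> arr i) * f (r (Suc i)))"
  proof (intro sum.cong refl)
    fix i
    show "of_bool (N (Suc i) = n) * f (r (Suc i)) = of_bool (N i = n - 1 \<and> arr i) * f (r (Suc i)) +
      of_bool (N i = Suc n \<and> \<not> arr i) * f (r (Suc i))"
      using assms N_Suc_arr[of i] departure_leaves_iff[of i n] by (cases "arr i") auto
  qed
  finally show ?thesis by (simp add: sum.distrib)
qed

text \<open>An idle step ends with an arrival and lasts at most the inter-arrival time in progress.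
  It is covered by \<open>C\<close>, unless that time exceeds \<open>C\<close>; then the time itself
  is charged, at most once since the arrival ends it.\<close>

lemma idle_time_le:
  assumes "0 \<le> C"
  shows "time_spent 0 m \<le> C * arrivals_finding 0 m + (\<Sum>k<num_arrivals (H m). a k * of_bool (C < a k))"
proof (induction m)
  case (Suc m)
  show ?case
  proof (cases "N m = 0")
    case True
    then have arr: "arr m" by (simp add: empty_arr)
    then have "u m \<le> a (num_arrivals (H m))" using r_le[of m] by (simp add: sojourn_def)
    then have "u m \<le> C + a (num_arrivals (H m)) * of_bool (C < a (num_arrivals (H m)))"
      using assms by auto
    then show ?thesis using Suc True arr
      by (simp add: time_spent_def arrivals_finding_def num_arrivals_Suc algebra_simps)
  next
    case False
    have "0 \<le> a (num_arrivals (H m)) * of_bool (C < a (num_arrivals (H m)))"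
      by (simp add: a_nonneg)
    then show ?thesis using Suc False
      by (auto simp: time_spent_def arrivals_finding_def num_arrivals_Suc simp del: card_eq_0_iff card_0_eq)
  qed
qed (simp add: time_spent_def arrivals_finding_def H_0)

text \<open>The inter-arrival time in progress has a random index; summing the large ones over all
  indices up to \<open>m\<close> gives a bound whose mean is computable.\<close>

lemma residual_le:
  assumes "0 \<le> C"
  shows "r m \<le> C + (\<Sum>k\<le>m. a k * of_bool (C < a k))"
proof -
  let ?k = "num_arrivals (H m)"
  have "r m \<le> a ?k" by (rule r_le)
  also have "\<dots> \<le> C + a ?k * of_bool (C < a ?k)" using assms by auto
  also have "a ?k * of_bool (C < a ?k) \<le> (\<Sum>k\<le>m. a k * of_bool (C < a k))"
    by (rule member_le_sum) (auto simp: num_arrivals_le a_nonneg)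
  finally show ?thesis by simp
qed

lemma now_eq_idle_busy: "now (H m) = time_spent 0 m + (\<Sum>i<m. of_bool (N i \<noteq> 0) * u i)"
  unfolding now_eq_sum time_spent_def sum.distrib[symmetric] by (intro sum.cong) auto

lemma in_hist_iff: "(\<tau>, e) \<in> set (H m) \<longleftrightarrow> (\<exists>k<m. \<tau> = now (H (Suc k)) \<and> e = evt k)"
  by (induction m) (auto simp: H_0 H_Suc less_Suc_eq now_Suc)

lemma num_in_system_eq:
  assumes t: "now (H i) \<le> t" "t < now (H (Suc i))"
  shows "num_in_system hist t = N i"
proof -
  have "(\<exists>m. \<exists>\<tau>\<le>t. (\<tau>, e) \<in> set (hist m)) \<longleftrightarrow> e \<in> snd ` set (H i)" for e
  proof
    assume "\<exists>m. \<exists>\<tau>\<le>t. (\<tau>, e) \<in> set (hist m)"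
    then obtain k where k: "now (H (Suc k)) \<le> t" "e = evt k"
      by (auto simp: hist_eq in_hist_iff)
    have "k < i"
    proof (rule ccontr)
      assume "\<not> k < i"
      then have "now (H (Suc i)) \<le> now (H (Suc k))" by (intro now_mono) simp
      with t k show False by simp
    qed
    with k have "(now (H (Suc k)), e) \<in> set (H i)" by (auto simp: in_hist_iff)
    then show "e \<in> snd ` set (H i)" by force
  next
    assume "e \<in> snd ` set (H i)"
    then obtain \<tau> where \<tau>: "(\<tau>, e) \<in> set (H i)" by auto
    then obtain k where "k < i" "\<tau> = now (H (Suc k))" by (auto simp: in_hist_iff)
    then have "\<tau> \<le> t" using now_mono[of "Suc k" i] t by simp
    with \<tau> show "\<exists>m. \<exists>\<tau>\<le>t. (\<tau>, e) \<in> set (hist m)" by (auto simp: hist_eq)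
  qed
  then show ?thesis unfolding num_in_system_def present_def by simp
qed

lemma time_spent_measure:
  "{w \<in> {0..<now (H m)}. num_in_system hist w = n} \<in> sets lborel \<and>
   emeasure lborel {w \<in> {0..<now (H m)}. num_in_system hist w = n} = ennreal (time_spent n m)"
proof (induction m)
  case (Suc m)
  let ?A = "\<lambda>m. {w \<in> {0..<now (H m)}. num_in_system hist w = n}"
  let ?B = "if N m = n then {now (H m)..<now (H (Suc m))} else {}"
  have eq: "?A (Suc m) = ?A m \<union> ?B"
  proof -
    have "w < now (H m) \<or> num_in_system hist w = N m" if "w < now (H (Suc m))" for w
      using num_in_system_eq[of m w] that by (cases "w < now (H m)") auto
    moreover have "num_in_system hist w = N m" if "now (H m) \<le> w" "w < now (H (Suc m))" for w
      using num_in_system_eq that by blast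
    ultimately show ?thesis
      using now_nonneg[of m] now_mono[of m "Suc m"] by (auto split: if_splits) metis
  qed
  have "?A m \<inter> ?B = {}" by auto
  then have "emeasure lborel (?A (Suc m)) = emeasure lborel (?A m) + emeasure lborel ?B"
    unfolding eq using Suc by (intro plus_emeasure[symmetric]) auto
  also have "emeasure lborel ?B = ennreal (of_bool (N m = n) * u m)"
    using u_nonneg[of m] by (simp add: now_Suc)
  also have "emeasure lborel (?A m) + ennreal (of_bool (N m = n) * u m) = ennreal (time_spent n (Suc m))"
    using Suc u_nonneg by (simp add: time_spent_def ennreal_plus sum_nonneg)
  finally show ?case using Suc unfolding eq by auto
qed (simp add: time_spent_def H_0)

text \<open>In product form because the epoch may be \<open>0\<close>. The closed interval in
  \<open>time_freq\<close> and the half-open one in \<open>time_spent_measure\<close> differ by a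
  null set.\<close>

lemma time_freq_eq: "time_freq hist n (now (H m)) * now (H m) = time_spent n m"
proof -
  let ?A = "{w \<in> {0..<now (H m)}. num_in_system hist w = n}"
  let ?A' = "{w \<in> {0..now (H m)}. num_in_system hist w = n}"
  have nn: "0 \<le> time_spent n m" using u_nonneg by (simp add: time_spent_def sum_nonneg)
  have "?A' = ?A \<union> (?A' \<inter> {now (H m)})" by (auto simp: order.order_iff_strict)
  moreover have "?A' \<inter> {now (H m)} \<in> null_sets lborel"
    by (rule finite_imp_null_set_lborel) simp
  ultimately have "measure lborel ?A' = measure lborel ?A"
    using time_spent_measure[of m n] measure_Un_null_set[of ?A lborel "?A' \<inter> {now (H m)}"] by metis
  also have "\<dots> = time_spent n m"
    using time_spent_measure[of m n] nn by (simp add: measure_def)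
  finally show ?thesis
    using now_eq_sum[of m] sum_nonneg[of "{..<m}" u] u_nonneg nn
    by (cases "now (H m) = 0") (auto simp: time_freq_def time_spent_def sum_nonneg_eq_0_iff)
qed

end

subsection \<open>Long-run averages in expectation\<close>

lemma (in prob_space) bounded_convergence_zero:
  fixes Y :: "nat \<Rightarrow> 'a \<Rightarrow> real"
  assumes [measurable]: "\<And>m. Y m \<in> borel_measurable M" and B: "\<And>m \<omega>. \<bar>Y m \<omega>\<bar> \<le> B"
    and lim: "AE \<omega> in M. (\<lambda>m. Y m \<omega>) \<longlonglongrightarrow> 0"
  shows "(\<lambda>m. expectation (Y m)) \<longlonglongrightarrow> 0"
  using integral_dominated_convergence[of "\<lambda>_. 0" M Y "\<lambda>_. B"] lim B by simp

text \<open>Multiplying the error of the ratio by \<open>Z / m\<close>, which lies in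
  \<open>[0, 1]\<close>, gives a bounded error in product form, so that the limit passes to
  expectations even where \<open>Z\<close> grows more slowly than \<open>m\<close>.\<close>

lemma (in prob_space) ratio_limit:
  fixes X Z :: "nat \<Rightarrow> 'a \<Rightarrow> real"
  assumes [measurable]: "\<And>m. X m \<in> borel_measurable M" "\<And>m. Z m \<in> borel_measurable M"
    and XZ: "\<And>m \<omega>. 0 \<le> X m \<omega>" "\<And>m \<omega>. X m \<omega> \<le> Z m \<omega>" and Z: "\<And>m \<omega>. Z m \<omega> \<le> real m"
    and lim: "AE \<omega> in M. (\<lambda>m. X m \<omega> / Z m \<omega>) \<longlonglongrightarrow> c"
  shows "(\<lambda>m. (expectation (X m) - c * expectation (Z m)) / real m) \<longlonglongrightarrow> 0"
proof -
  define Y where "Y m \<omega> = (X m \<omega> - c * Z m \<omega>) / real m" for m \<omega>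
  have Z0: "0 \<le> Z m \<omega>" for m \<omega> using XZ[of m \<omega>] by simp
  \<comment> \<open>If \<open>Z\<close> vanishes then so does \<open>X\<close>, so the convention
    for division by zero does no harm.\<close>
  have eq: "Y m \<omega> = (Z m \<omega> / real m) * (X m \<omega> / Z m \<omega> - c)" for m \<omega>
    using XZ[of m \<omega>] by (cases "Z m \<omega> = 0"; cases "m = 0") (auto simp: Y_def field_simps)
  have le: "\<bar>Y m \<omega>\<bar> \<le> \<bar>X m \<omega> / Z m \<omega> - c\<bar>" for m \<omega>
  proof -
    have "\<bar>Z m \<omega> / real m\<bar> \<le> 1" using Z[of m \<omega>] Z0[of m \<omega>] by (auto simp: divide_le_eq_1)
    from mult_right_mono[OF this abs_ge_zero, of "X m \<omega> / Z m \<omega> - c"]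
    show ?thesis unfolding eq abs_mult by simp
  qed
  have "(\<lambda>m. expectation (Y m)) \<longlonglongrightarrow> 0"
  proof (rule bounded_convergence_zero)
    show "Y m \<in> borel_measurable M" for m unfolding Y_def[abs_def] by measurable
    fix m \<omega>
    have "\<bar>X m \<omega> / Z m \<omega>\<bar> \<le> 1" using XZ[of m \<omega>] Z0[of m \<omega>] by (auto simp: divide_le_eq_1)
    then show "\<bar>Y m \<omega>\<bar> \<le> 1 + \<bar>c\<bar>" using le[of m \<omega>] by linarith
  next
    show "AE \<omega> in M. (\<lambda>m. Y m \<omega>) \<longlonglongrightarrow> 0"
      using lim
    proof eventually_elim
      case (elim \<omega>)
      then have "(\<lambda>m. \<bar>X m \<omega> / Z m \<omega> - c\<bar>) \<longlonglongrightarrow> 0"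
        by (simp add: LIM_zero tendsto_rabs_zero)
      then show ?case
        by (rule tendsto_rabs_zero_cancel[OF tendsto_sandwich[of "\<lambda>_. 0", rotated 3]])
           (auto intro!: always_eventually le)
    qed
  qed
  moreover have "expectation (Y m) = (expectation (X m) - c * expectation (Z m)) / real m" for m
  proof -
    have "integrable M (X m)"
      by (rule integrable_const_bound[where B = "real m"]) (auto intro: order_trans[OF XZ(2) Z] simp: XZ)
    moreover have "integrable M (Z m)"
      by (rule integrable_const_bound[where B = "real m"]) (auto intro: Z simp: Z0)
    ultimately show ?thesis by (simp add: Y_def[abs_def])
  qed
  ultimately show ?thesis by simp
qed

lemma (in queue_path) arrivals_finding_bounds:
  "0 \<le> arrivals_finding n m" "arrivals_finding n m \<le> real (num_arrivals (H m))"
  unfolding arrivals_finding_def num_arrivals_eq_sum by (auto intro!: sum_nonneg sum_mono)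

lemma (in queue_path) departures_leaving_bounds:
  "0 \<le> departures_leaving n m" "departures_leaving n m \<le> real m"
proof -
  show "0 \<le> departures_leaving n m"
    unfolding departures_leaving_def by (auto intro!: sum_nonneg)
  show "departures_leaving n m \<le> real m"
    using arrivals_departures_balance[of n m] arrivals_finding_bounds(2)[of n m] num_arrivals_le[of m]
    by (auto simp: of_bool_def split: if_splits)
qed

lemma (in queue_path) time_spent_bounds: "0 \<le> time_spent n m" "time_spent n m \<le> now (H m)"
  unfolding time_spent_def now_eq_sum using u_nonneg by (auto intro!: sum_nonneg sum_mono)

lemma (in queue_path) time_freq_now: "time_freq hist n (now (H m)) = time_spent n m / now (H m)"
  using time_freq_eq[of n m] by (cases "now (H m) = 0") (auto simp: time_freq_def field_simps)

text \<open>At least \<open>m div 2\<close> arrivals have occurred, and the clock has reached the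
  epoch of the last of them.\<close>

lemma (in queue_path) now_ge: "(\<Sum>i<m div 2. a i) \<le> now (H m)"
proof -
  let ?k = "num_arrivals (H m)"
  have "m div 2 \<le> ?k" using num_arrivals_ge[of m] by linarith
  then have "(\<Sum>i<m div 2. a i) \<le> (\<Sum>i<?k. a i)"
    using a_nonneg by (intro sum_mono2) auto
  also have "\<dots> = arrival_epoch a ?k - a ?k"
    by (simp add: arrival_epoch_def lessThan_Suc_atMost[symmetric])
  also have "\<dots> \<le> now (H m)" using r_le[of m] by (simp add: r_eq)
  finally show ?thesis .
qed

context stable_gm1_queue
begin

lemma frequencies_measurable [measurable]:
  "(\<lambda>\<omega>. q.path.arrivals_finding \<omega> n m) \<in> borel_measurable M"
  "(\<lambda>\<omega>. q.path.departures_leaving \<omega> n m) \<in> borel_measurable M"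
  "(\<lambda>\<omega>. q.path.time_spent \<omega> n m) \<in> borel_measurable M"
  unfolding q.path.arrivals_finding_def q.path.departures_leaving_def q.path.time_spent_def
  by measurable

lemma of_bool_integrable: "Measurable.pred M Q \<Longrightarrow> integrable M (\<lambda>\<omega>. of_bool (Q \<omega>) :: real)"
  by (rule integrable_const_bound[where B = 1]) auto

abbreviation "mean_arrivals m \<equiv> expectation (\<lambda>\<omega>. real (num_arrivals (q.H m \<omega>)))"
abbreviation "mean_now m \<equiv> expectation (\<lambda>\<omega>. now (q.H m \<omega>))"

lemma num_arrivals_integrable: "integrable M (\<lambda>\<omega>. real (num_arrivals (q.H m \<omega>)))"
  using q.path.num_arrivals_le by (intro integrable_const_bound[where B = "real m"]) auto

lemma mean_arrivals_bounds: "real m / 2 \<le> mean_arrivals m" "mean_arrivals m \<le> real m"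
proof -
  show "real m / 2 \<le> mean_arrivals m"
    using q.path.num_arrivals_ge[where m = m] num_arrivals_integrable[of m]
    by (intro integral_ge_const) (auto simp: field_simps)
  show "mean_arrivals m \<le> real m"
    using q.path.num_arrivals_le num_arrivals_integrable[of m] by (intro integral_le_const) auto
qed

lemma arrival_epoch_integrable: "integrable M (\<lambda>\<omega>. arrival_epoch (Apos \<omega>) m)"
  unfolding arrival_epoch_def by (intro Bochner_Integration.integrable_sum Apos_integrable)

lemma now_integrable: "integrable M (\<lambda>\<omega>. now (q.H m \<omega>))"
  by (rule Bochner_Integration.integrable_bound[OF arrival_epoch_integrable[of m]])
     (auto simp: q.path.now_nonneg q.path.arrival_epoch_nonneg intro: q.path.now_le)

lemma sojourn_le_now: "q.path.u \<omega> m \<le> now (q.H (Suc m) \<omega>)"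
  using q.path.now_Suc[of \<omega> m] q.path.now_nonneg[of \<omega> m] by simp

lemma sojourn_integrable:
  assumes [measurable]: "Measurable.pred M Q"
  shows "integrable M (\<lambda>\<omega>. of_bool (Q \<omega>) * q.path.u \<omega> m)"
  by (rule Bochner_Integration.integrable_bound[OF now_integrable[of "Suc m"]])
     (auto simp: q.path.u_nonneg q.path.now_nonneg intro: sojourn_le_now)

lemma residual_integrable: "integrable M (\<lambda>\<omega>. q.path.r \<omega> m)"
proof (rule Bochner_Integration.integrable_bound[OF arrival_epoch_integrable[of m]])
  have "q.path.r \<omega> m \<le> arrival_epoch (Apos \<omega>) m" for \<omega>
    using q.path.now_nonneg[of \<omega> m] q.path.r_eq[of \<omega> m]
      q.path.arrival_epoch_mono[OF q.path.num_arrivals_le[of \<omega> m], of \<omega>] by simp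
  then show "AE \<omega> in M. norm (q.path.r \<omega> m) \<le> norm (arrival_epoch (Apos \<omega>) m)"
    by (auto simp: q.path.r_nonneg q.path.arrival_epoch_nonneg)
qed measurable

text \<open>Wald's identity, by induction on events: each arrival starts an inter-arrival time of
  mean \<open>1 / lam\<close> independent of the past. The extra \<open>1\<close> is the arrival
  that is pending.\<close>

lemma expectation_arrival_epoch:
  "expectation (\<lambda>\<omega>. arrival_epoch (Apos \<omega>) (num_arrivals (q.H m \<omega>))) = (1 + mean_arrivals m) / lam"
proof -
  have "integrable M (\<lambda>\<omega>. now (q.H m \<omega>) + q.path.r \<omega> m)" for m
    by (intro Bochner_Integration.integrable_add now_integrable residual_integrable)
  then have int: "integrable M (\<lambda>\<omega>. arrival_epoch (Apos \<omega>) (num_arrivals (q.H m \<omega>)))" for m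
    by (simp add: q.path.r_eq)
  show "expectation (\<lambda>\<omega>. arrival_epoch (Apos \<omega>) (num_arrivals (q.H m \<omega>))) = (1 + mean_arrivals m) / lam"
  proof (induction m)
    case 0
    then show ?case
      by (simp add: q.path.H_0 arrival_epoch_def expectation_Apos)
  next
    case (Suc m)
    \<comment> \<open>The forms \<open>True \<and> _\<close> and \<open>max 0 _\<close> match
      \<open>expectation_after_arrival\<close> with a trivial \<open>P\<close> and a nonnegative
      function.\<close>
    have step: "arrival_epoch (Apos \<omega>) (num_arrivals (q.H (Suc m) \<omega>)) =
        arrival_epoch (Apos \<omega>) (num_arrivals (q.H m \<omega>)) +
        of_bool (True \<and> q.path.arr \<omega> m) * max 0 (q.path.r \<omega> (Suc m))" for \<omega>
      using q.path.r_Suc_arr[of \<omega> m]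
      by (simp add: q.path.num_arrivals_Suc q.path.arrival_epoch_Suc)
    have step': "real (num_arrivals (q.H (Suc m) \<omega>)) =
        real (num_arrivals (q.H m \<omega>)) + of_bool (True \<and> q.path.arr \<omega> m)" for \<omega>
      by (simp add: q.path.num_arrivals_Suc)
    have int': "integrable M (\<lambda>\<omega>. of_bool (True \<and> q.path.arr \<omega> m) * max 0 (q.path.r \<omega> (Suc m)))"
      using Bochner_Integration.integrable_diff[OF int[of "Suc m"] int[of m]] by (simp add: step)
    have int'': "integrable M (\<lambda>\<omega>. of_bool (True \<and> q.path.arr \<omega> m) :: real)"
      by (rule of_bool_integrable) measurable
    have "expectation (\<lambda>\<omega>. of_bool (True \<and> q.path.arr \<omega> m) * max 0 (q.path.r \<omega> (Suc m))) =
        expectation (\<lambda>\<omega>. of_bool (True \<and> q.path.arr \<omega> m)) * (LINT y|G. max 0 (max 0 y))"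
      by (rule expectation_after_arrival[where P = "\<lambda>_. True"]) auto
    then show ?case
      using Suc int[of m] int' int'' num_arrivals_integrable[of m] mean_G
      unfolding step step' by (simp add: add_divide_distrib)
  qed
qed

lemma expectation_departures_leaving:
  "expectation (\<lambda>\<omega>. q.path.departures_leaving \<omega> n m) = mu * expectation (\<lambda>\<omega>. q.path.time_spent \<omega> (Suc n) m)"
proof -
  have "expectation (\<lambda>\<omega>. q.path.departures_leaving \<omega> n m) =
      (\<Sum>i<m. expectation (\<lambda>\<omega>. of_bool (q.path.N \<omega> i = Suc n \<and> \<not> q.path.arr \<omega> i)))"
    unfolding q.path.departures_leaving_def
    by (intro Bochner_Integration.integral_sum of_bool_integrable) measurable
  also have "\<dots> = (\<Sum>i<m. mu * expectation (\<lambda>\<omega>. of_bool (q.path.N \<omega> i = Suc n) * q.path.u \<omega> i))"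
    by (intro sum.cong refl expectation_departure) simp
  also have "\<dots> = mu * expectation (\<lambda>\<omega>. q.path.time_spent \<omega> (Suc n) m)"
    unfolding q.path.time_spent_def sum_distrib_left[symmetric]
    by (intro arg_cong[where f = "(*) mu"] Bochner_Integration.integral_sum[symmetric] sojourn_integrable)
       measurable
  finally show ?thesis .
qed

text \<open>Departures occur at rate \<open>mu\<close> during busy time and never outnumber
  arrivals.\<close>

lemma mean_busy_time_le:
  "mu * expectation (\<lambda>\<omega>. \<Sum>i<m. of_bool (q.path.N \<omega> i \<noteq> 0) * q.path.u \<omega> i) \<le> mean_arrivals m"
proof -
  have "mu * expectation (\<lambda>\<omega>. \<Sum>i<m. of_bool (q.path.N \<omega> i \<noteq> 0) * q.path.u \<omega> i) =
      (\<Sum>i<m. mu * expectation (\<lambda>\<omega>. of_bool (q.path.N \<omega> i \<noteq> 0) * q.path.u \<omega> i))"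
    unfolding sum_distrib_left[symmetric]
    by (intro arg_cong[where f = "(*) mu"] Bochner_Integration.integral_sum sojourn_integrable) measurable
  also have "\<dots> = (\<Sum>i<m. expectation (\<lambda>\<omega>. of_bool (q.path.N \<omega> i \<noteq> 0 \<and> \<not> q.path.arr \<omega> i)))"
    by (intro sum.cong refl expectation_departure[symmetric]) simp
  also have "\<dots> = expectation (\<lambda>\<omega>. \<Sum>i<m. of_bool (q.path.N \<omega> i \<noteq> 0 \<and> \<not> q.path.arr \<omega> i))"
    by (intro Bochner_Integration.integral_sum[symmetric] of_bool_integrable) measurable
  also have "\<dots> \<le> mean_arrivals m"
    by (intro Bochner_Integration.integral_mono num_arrivals_integrable Bochner_Integration.integrable_sum
        of_bool_integrable q.path.total_departures_le) measurable
  finally show ?thesis .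
qed

text \<open>
  An arrival that finds \<open>n \<ge> 1\<close> customers follows an arrival that finds \<open>n - 1\<close> or a departure that
  leaves \<open>n\<close> behind, the server not completing a service in between.
\<close>

lemma mean_arrivals_finding_rec:
  assumes "n \<noteq> 0"
  shows "expectation (\<lambda>\<omega>. q.path.arrivals_finding \<omega> n (Suc m)) =
    expectation (\<lambda>\<omega>. q.path.arrivals_finding \<omega> (n - 1) m) * lst G mu +
    expectation (\<lambda>\<omega>. \<Sum>i<m. of_bool (q.path.N \<omega> i = Suc n \<and> \<not> q.path.arr \<omega> i) *
      exp (- mu * q.path.r \<omega> (Suc i)))"
proof -
  have int: "integrable M (\<lambda>\<omega>. of_bool (Q \<omega>) * exp (- mu * q.path.r \<omega> i))"
    if [measurable]: "Measurable.pred M Q" for Q i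
    using mu_pos q.path.r_nonneg by (intro integrable_const_bound[where B = 1]) auto
  have "expectation (\<lambda>\<omega>. q.path.arrivals_finding \<omega> n (Suc m)) =
      (\<Sum>i<Suc m. expectation (\<lambda>\<omega>. of_bool (q.path.N \<omega> i = n \<and> q.path.arr \<omega> i)))"
    unfolding q.path.arrivals_finding_def
    by (intro Bochner_Integration.integral_sum of_bool_integrable) measurable
  also have "\<dots> = (\<Sum>i<Suc m. expectation (\<lambda>\<omega>. of_bool (q.path.N \<omega> i = n) * exp (- mu * q.path.r \<omega> i)))"
    using assms expectation_arrival[of "\<lambda>k. k = n"] by (intro sum.cong refl) simp
  also have "\<dots> = expectation (\<lambda>\<omega>. \<Sum>i<Suc m. of_bool (q.path.N \<omega> i = n) * exp (- mu * q.path.r \<omega> i))"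
    by (intro Bochner_Integration.integral_sum[symmetric] int) measurable
  also have "\<dots> = expectation (\<lambda>\<omega>.
      (\<Sum>i<m. of_bool (q.path.N \<omega> i = n - 1 \<and> q.path.arr \<omega> i) * exp (- mu * q.path.r \<omega> (Suc i))) +
      (\<Sum>i<m. of_bool (q.path.N \<omega> i = Suc n \<and> \<not> q.path.arr \<omega> i) * exp (- mu * q.path.r \<omega> (Suc i))))"
    by (rule Bochner_Integration.integral_cong[OF refl]) (rule q.path.arrival_balance[OF assms])
  also have "\<dots> = (\<Sum>i<m. expectation (\<lambda>\<omega>. of_bool (q.path.N \<omega> i = n - 1 \<and> q.path.arr \<omega> i) *
        exp (- mu * q.path.r \<omega> (Suc i)))) +
      expectation (\<lambda>\<omega>. \<Sum>i<m. of_bool (q.path.N \<omega> i = Suc n \<and> \<not> q.path.arr \<omega> i) *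
        exp (- mu * q.path.r \<omega> (Suc i)))"
    by (subst Bochner_Integration.integral_add, (intro Bochner_Integration.integrable_sum int; measurable)+,
        subst Bochner_Integration.integral_sum, (intro int; measurable)+) simp
  also have "(\<Sum>i<m. expectation (\<lambda>\<omega>. of_bool (q.path.N \<omega> i = n - 1 \<and> q.path.arr \<omega> i) *
        exp (- mu * q.path.r \<omega> (Suc i)))) =
      (\<Sum>i<m. expectation (\<lambda>\<omega>. of_bool (q.path.N \<omega> i = n - 1 \<and> q.path.arr \<omega> i)) * lst G mu)"
  proof (intro sum.cong refl)
    fix i
    have "expectation (\<lambda>\<omega>. of_bool (q.path.N \<omega> i = n - 1 \<and> q.path.arr \<omega> i) *
        exp (- mu * max 0 (q.path.r \<omega> (Suc i)))) =
      expectation (\<lambda>\<omega>. of_bool (q.path.N \<omega> i = n - 1 \<and> q.path.arr \<omega> i)) *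
        (LINT y|G. exp (- mu * max 0 (max 0 y)))"
      by (rule expectation_after_arrival[where P = "\<lambda>k. k = n - 1" and f = "\<lambda>t. exp (- mu * max 0 t)"]) auto
    then show "expectation (\<lambda>\<omega>. of_bool (q.path.N \<omega> i = n - 1 \<and> q.path.arr \<omega> i) *
        exp (- mu * q.path.r \<omega> (Suc i))) =
      expectation (\<lambda>\<omega>. of_bool (q.path.N \<omega> i = n - 1 \<and> q.path.arr \<omega> i)) * lst G mu"
      using lst_G q.path.r_nonneg by (simp add: max_absorb2)
  qed
  also have "\<dots> = expectation (\<lambda>\<omega>. q.path.arrivals_finding \<omega> (n - 1) m) * lst G mu"
    unfolding q.path.arrivals_finding_def sum_distrib_right[symmetric]
    by (subst Bochner_Integration.integral_sum) (auto intro!: of_bool_integrable)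
  finally show ?thesis .
qed

text \<open>The contribution of values above \<open>C\<close> to the mean inter-arrival time; it
  vanishes as \<open>C\<close> grows because that mean is finite. It controls elapsed, idle and
  residual times, which have no deterministic bound.\<close>

definition tail :: "real \<Rightarrow> real" where
  "tail C = (LINT y|G. max 0 y * of_bool (C < max 0 y))"

lemma expectation_tail: "expectation (\<lambda>\<omega>. Apos \<omega> k * of_bool (C < Apos \<omega> k)) = tail C"
  and tail_integrable: "integrable M (\<lambda>\<omega>. Apos \<omega> k * of_bool (C < Apos \<omega> k))"
proof -
  show "expectation (\<lambda>\<omega>. Apos \<omega> k * of_bool (C < Apos \<omega> k)) = tail C"
    using integral_distr[OF A_measurable, of "\<lambda>y. max 0 y * of_bool (C < max 0 y)" k]
    by (simp add: interarrival_distr tail_def)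
  show "integrable M (\<lambda>\<omega>. Apos \<omega> k * of_bool (C < Apos \<omega> k))"
    by (rule Bochner_Integration.integrable_bound[OF Apos_integrable[of k]]) auto
qed

lemma tail_nonneg: "0 \<le> tail C"
  unfolding tail_def by (intro Bochner_Integration.integral_nonneg) simp

lemma tail_tendsto: "(\<lambda>k. tail (real k)) \<longlonglongrightarrow> 0"
proof -
  have "(\<lambda>k. LINT y|G. max 0 y * of_bool (real k < max 0 y)) \<longlonglongrightarrow> (LINT y|G. 0)"
  proof (rule integral_dominated_convergence[where w = "\<lambda>y. max 0 y"])
    show "AE y in G. (\<lambda>k. max 0 y * of_bool (real k < max 0 y)) \<longlonglongrightarrow> 0"
    proof (rule AE_I2)
      fix y :: real
      obtain k0 :: nat where "max 0 y \<le> real k0" using real_arch_simple by blast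
      then have "eventually (\<lambda>k. max 0 y * of_bool (real k < max 0 y) = 0) sequentially"
        by (intro eventually_sequentiallyI[of k0]) auto
      then show "(\<lambda>k. max 0 y * of_bool (real k < max 0 y)) \<longlonglongrightarrow> 0"
        by (rule tendsto_eventually)
    qed
  qed (auto simp: integrable_max_G)
  then show ?thesis unfolding tail_def by simp
qed

text \<open>The factor \<open>\<epsilon> m\<close> may depend on the inter-arrival times, so each of
  these is truncated: values below \<open>C\<close> contribute at most \<open>C\<close> times the
  mean of \<open>\<epsilon> m\<close>, values above at most \<open>B * tail C\<close>. First
  \<open>C\<close> is taken large, then \<open>m\<close>.\<close>

lemma uniform_integrability:
  fixes \<epsilon> :: "nat \<Rightarrow> 'w \<Rightarrow> real"
  assumes [measurable]: "\<And>m. \<epsilon> m \<in> borel_measurable M"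
    and \<epsilon>: "\<And>m \<omega>. 0 \<le> \<epsilon> m \<omega>" "\<And>m \<omega>. \<epsilon> m \<omega> \<le> B"
    and lim: "(\<lambda>m. expectation (\<epsilon> m)) \<longlonglongrightarrow> 0"
  shows "(\<lambda>m. expectation (\<lambda>\<omega>. arrival_epoch (Apos \<omega>) m * \<epsilon> m \<omega>) / real m) \<longlonglongrightarrow> 0"
proof (rule LIMSEQ_I)
  fix e :: real assume e: "0 < e"
  have B: "0 \<le> B" using \<epsilon>(1)[of 0 undefined] \<epsilon>(2)[of 0 undefined] by simp
  have int_\<epsilon>: "integrable M (\<epsilon> m)" for m
    using \<epsilon> by (intro integrable_const_bound[where B = B]) auto
  have bound: "expectation (\<lambda>\<omega>. arrival_epoch (Apos \<omega>) m * \<epsilon> m \<omega>) \<le>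
      real (Suc m) * (C * expectation (\<epsilon> m) + B * tail C)" if C: "0 \<le> C" for C m
  proof -
    have le: "arrival_epoch (Apos \<omega>) m * \<epsilon> m \<omega> \<le>
        (\<Sum>k\<le>m. C * \<epsilon> m \<omega> + B * (Apos \<omega> k * of_bool (C < Apos \<omega> k)))" for \<omega>
      unfolding arrival_epoch_def sum_distrib_right
    proof (intro sum_mono)
      fix k
      show "Apos \<omega> k * \<epsilon> m \<omega> \<le> C * \<epsilon> m \<omega> + B * (Apos \<omega> k * of_bool (C < Apos \<omega> k))"
      proof (cases "C < Apos \<omega> k")
        case True
        have "Apos \<omega> k * \<epsilon> m \<omega> \<le> Apos \<omega> k * B" using \<epsilon>(2) by (intro mult_left_mono) auto
        moreover have "0 \<le> C * \<epsilon> m \<omega>" using C \<epsilon>(1) by simp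
        ultimately show ?thesis using True by (simp add: mult.commute)
      next
        case False
        then have "Apos \<omega> k * \<epsilon> m \<omega> \<le> C * \<epsilon> m \<omega>"
          by (intro mult_right_mono \<epsilon>) auto
        then show ?thesis using False by simp
      qed
    qed
    have int: "integrable M (\<lambda>\<omega>. C * \<epsilon> m \<omega> + B * (Apos \<omega> k * of_bool (C < Apos \<omega> k)))" for k
      using int_\<epsilon> tail_integrable by simp
    have "expectation (\<lambda>\<omega>. arrival_epoch (Apos \<omega>) m * \<epsilon> m \<omega>) \<le>
        expectation (\<lambda>\<omega>. \<Sum>k\<le>m. C * \<epsilon> m \<omega> + B * (Apos \<omega> k * of_bool (C < Apos \<omega> k)))"
    proof (rule integral_mono_AE')
      show "AE \<omega> in M. 0 \<le> (\<Sum>k\<le>m. C * \<epsilon> m \<omega> + B * (Apos \<omega> k * of_bool (C < Apos \<omega> k)))"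
        using \<epsilon>(1) B C by (intro AE_I2 sum_nonneg add_nonneg_nonneg mult_nonneg_nonneg) auto
    qed (use le int in auto)
    also have "\<dots> = (\<Sum>k\<le>m. C * expectation (\<epsilon> m) + B * tail C)"
      using int_\<epsilon> tail_integrable int
      by (subst Bochner_Integration.integral_sum) (simp_all add: expectation_tail)
    finally show ?thesis by simp
  qed
  \<comment> \<open>The factor \<open>2\<close> absorbs \<open>Suc m / m\<close>, which is at most
    \<open>2\<close> for \<open>m \<ge> 1\<close>.\<close>
  have "(\<lambda>k. 2 * B * tail (real k)) \<longlonglongrightarrow> 0"
    using tendsto_mult_right_zero[OF tail_tendsto, of "2 * B"] by simp
  from LIMSEQ_D[OF this, of "e / 2"] e obtain k where k: "\<bar>2 * B * tail (real k)\<bar> < e / 2"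
    by auto
  have "(\<lambda>m. 2 * real k * expectation (\<epsilon> m)) \<longlonglongrightarrow> 0"
    using tendsto_mult_right_zero[OF lim, of "2 * real k"] by simp
  from LIMSEQ_D[OF this, of "e / 2"] e obtain m0 where
    m0: "\<And>m. m \<ge> m0 \<Longrightarrow> \<bar>2 * real k * expectation (\<epsilon> m)\<bar> < e / 2" by auto
  show "\<exists>no. \<forall>m\<ge>no. norm (expectation (\<lambda>\<omega>. arrival_epoch (Apos \<omega>) m * \<epsilon> m \<omega>) / real m - 0) < e"
  proof (intro exI[of _ "max 1 m0"] allI impI)
    fix m assume m: "max 1 m0 \<le> m"
    let ?E = "expectation (\<lambda>\<omega>. arrival_epoch (Apos \<omega>) m * \<epsilon> m \<omega>)"
    let ?b = "real k * expectation (\<epsilon> m) + B * tail (real k)"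
    have "0 \<le> ?E" using \<epsilon>(1) q.path.arrival_epoch_nonneg by (intro Bochner_Integration.integral_nonneg) simp
    moreover have "0 \<le> ?b"
      using \<epsilon>(1) B tail_nonneg by (intro add_nonneg_nonneg mult_nonneg_nonneg Bochner_Integration.integral_nonneg) auto
    moreover have "?E \<le> real (Suc m) * ?b" by (rule bound) simp
    moreover have "real (Suc m) * ?b \<le> 2 * real m * ?b"
      using m \<open>0 \<le> ?b\<close> by (intro mult_right_mono) auto
    ultimately have "0 \<le> ?E / real m" "?E / real m \<le> 2 * ?b"
      using m by (auto simp: field_simps)
    then show "norm (?E / real m - 0) < e"
      using k m0[of m] m by (simp add: algebra_simps)
  qed
qed

end

section \<open>Divergence of the clock and a bound on idleness\<close>

context stable_gm1_queue
begin

lemma expectation_exp_epochs: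
  "(\<integral>\<^sup>+\<omega>. ennreal (\<Prod>i<k. exp (- Apos \<omega> i)) \<partial>M) = ennreal ((LINT y|G. exp (- max 0 y)) ^ k)"
proof (induction k)
  case 0
  then show ?case by (simp add: emeasure_space_1)
next
  case (Suc k)
  interpret G: prob_space G by (rule prob_space_G)
  define F where "F x = (\<Prod>i<k. exp (- xA x i))" for x
  have [measurable]: "F \<in> borel_measurable K" unfolding F_def[abs_def] by measurable
  have F: "F (x(Inl k := y)) = F x" for x y
    by (simp add: F_def xA_def)
  have G: "(\<integral>\<^sup>+y. ennreal (exp (- max 0 y)) \<partial>G) = ennreal (LINT y|G. exp (- max 0 y))"
    by (rule nn_integral_eq_integral) (auto intro!: G.integrable_const_bound[where B = 1])
  have "(\<integral>\<^sup>+\<omega>. ennreal (\<Prod>i<Suc k. exp (- Apos \<omega> i)) \<partial>M) =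
      (\<integral>\<^sup>+\<omega>. ennreal (F (coords \<omega>)) * ennreal (exp (- xA (coords \<omega>) k)) \<partial>M)"
    by (simp add: F_def x_coords ennreal_mult prod_nonneg)
  also have "\<dots> = (\<integral>\<^sup>+\<omega>. \<integral>\<^sup>+\<omega>'. ennreal (F ((coords \<omega>)(Inl k := coord (Inl k) \<omega>'))) *
      ennreal (exp (- xA ((coords \<omega>)(Inl k := coord (Inl k) \<omega>')) k)) \<partial>M \<partial>M)"
    by (rule resample) measurable
  also have "\<dots> = (\<integral>\<^sup>+\<omega>. \<integral>\<^sup>+\<omega>'. ennreal (F (coords \<omega>)) * ennreal (exp (- Apos \<omega>' k)) \<partial>M \<partial>M)"
    by (simp only: F) (simp add: xA_def)
  also have "\<dots> = (\<integral>\<^sup>+\<omega>. ennreal (F (coords \<omega>)) \<partial>M) * ennreal (LINT y|G. exp (- max 0 y))"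
    using distr_Apos[of "\<lambda>y. ennreal (exp (- y))" k] G
    by (simp add: nn_integral_cmult nn_integral_multc)
  also have "(\<integral>\<^sup>+\<omega>. ennreal (F (coords \<omega>)) \<partial>M) = ennreal ((LINT y|G. exp (- max 0 y)) ^ k)"
    using Suc by (simp add: F_def x_coords)
  finally show ?case
    by (simp add: ennreal_mult[symmetric] Bochner_Integration.integral_nonneg mult.commute)
qed

text \<open>Chernoff bound: where all partial sums stay below \<open>B\<close>, the product of the
  first \<open>k\<close> factors \<open>exp (- Apos \<omega> i)\<close> is at least
  \<open>exp (- B)\<close>, whereas its mean is \<open>?q ^ k\<close> with \<open>?q < 1\<close>,
  inter-arrival times being positive.\<close>

lemma AE_epochs_unbounded: "AE \<omega> in M. \<forall>B::nat. \<exists>k. real B < (\<Sum>i<k. Apos \<omega> i)"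
  unfolding AE_all_countable
proof
  fix B :: nat
  interpret G: prob_space G by (rule prob_space_G)
  let ?q = "LINT y|G. exp (- max 0 y)"
  let ?E = "{\<omega> \<in> space M. \<forall>k. (\<Sum>i<k. Apos \<omega> i) \<le> real B}"
  have q: "0 \<le> ?q" "?q < 1"
  proof -
    have "integrable G (\<lambda>y. exp (- max 0 y))"
      by (rule G.integrable_const_bound[where B = 1]) auto
    moreover have "AE y in G. exp (- max 0 y) < 1"
      using interarrival_pos by eventually_elim simp
    ultimately show "?q < 1" by (rule G.expectation_less)
  qed (simp add: Bochner_Integration.integral_nonneg)
  have [measurable]: "?E \<in> events" by measurable
  have "exp (- real B) * prob ?E \<le> ?q ^ k" for k
  proof -
    have "ennreal (exp (- real B) * prob ?E) = (\<integral>\<^sup>+\<omega>. ennreal (exp (- real B)) * indicator ?E \<omega> \<partial>M)"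
      by (simp add: nn_integral_cmult ennreal_mult emeasure_eq_measure)
    also have "\<dots> \<le> (\<integral>\<^sup>+\<omega>. ennreal (\<Prod>i<k. exp (- Apos \<omega> i)) \<partial>M)"
    proof (intro nn_integral_mono)
      fix \<omega>
      show "ennreal (exp (- real B)) * indicator ?E \<omega> \<le> ennreal (\<Prod>i<k. exp (- Apos \<omega> i))"
        by (auto simp: indicator_def exp_sum[symmetric] sum_negf intro!: ennreal_leI)
    qed
    also have "\<dots> = ennreal (?q ^ k)" by (rule expectation_exp_epochs)
    finally show ?thesis using q by simp
  qed
  moreover have "(\<lambda>k. ?q ^ k) \<longlonglongrightarrow> 0"
    using q by (intro LIMSEQ_power_zero) simp
  ultimately have "exp (- real B) * prob ?E \<le> 0"
    by (intro LIMSEQ_le_const) auto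
  then have "prob ?E = 0"
    using measure_nonneg[of M ?E] by (simp add: mult_le_0_iff)
  then have "?E \<in> null_sets M" by (simp add: null_sets_def emeasure_eq_measure)
  then have "AE \<omega> in M. \<omega> \<notin> ?E" by (rule AE_not_in)
  then show "AE \<omega> in M. \<exists>k. real B < (\<Sum>i<k. Apos \<omega> i)"
    using AE_space by eventually_elim (auto simp: not_le)
qed

lemma AE_now_at_top: "AE \<omega> in M. filterlim (\<lambda>m. now (q.H m \<omega>)) at_top sequentially"
  using AE_epochs_unbounded
proof eventually_elim
  case (elim \<omega>)
  show ?case
    unfolding filterlim_at_top
  proof
    fix Z :: real
    obtain B :: nat where B: "Z \<le> real B" using real_arch_simple by blast
    obtain k where k: "real B < (\<Sum>i<k. Apos \<omega> i)" using elim by blast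
    show "\<forall>\<^sub>F m in sequentially. Z \<le> now (q.H m \<omega>)"
    proof (rule eventually_sequentiallyI)
      fix m assume m: "2 * k \<le> m"
      have "(\<Sum>i<k. Apos \<omega> i) \<le> (\<Sum>i<m div 2. Apos \<omega> i)"
        using m by (intro sum_mono2) auto
      also have "\<dots> \<le> now (q.H m \<omega>)" by (rule q.path.now_ge)
      finally show "Z \<le> now (q.H m \<omega>)" using B k by simp
    qed
  qed
qed

text \<open>
  If the arrivals hardly ever found the system empty, the server would be busy almost all the time,
  and departures would outnumber arrivals.
\<close>

lemma idle_bound:
  assumes C: "0 \<le> C"
  shows "mean_arrivals m * (1 / lam - 1 / mu) \<le>
    C * expectation (\<lambda>\<omega>. q.path.arrivals_finding \<omega> 0 m) + C + real (2 * m + 1) * tail C"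
proof -
  let ?t = "\<lambda>k \<omega>. Apos \<omega> k * of_bool (C < Apos \<omega> k)"
  let ?busy = "\<lambda>\<omega>. \<Sum>i<m. of_bool (q.path.N \<omega> i \<noteq> 0) * q.path.u \<omega> i"
  have int_busy: "integrable M ?busy"
    by (intro Bochner_Integration.integrable_sum sojourn_integrable) measurable
  have int_idle: "integrable M (\<lambda>\<omega>. q.path.time_spent \<omega> 0 m)"
    unfolding q.path.time_spent_def by (intro Bochner_Integration.integrable_sum sojourn_integrable) measurable
  have int_A: "integrable M (\<lambda>\<omega>. q.path.arrivals_finding \<omega> 0 m)"
    unfolding q.path.arrivals_finding_def
    by (intro Bochner_Integration.integrable_sum of_bool_integrable) measurable
  \<comment> \<open>The epoch of the pending arrival is idle time plus busy time plus residual time;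
    Wald's identity gives its mean.\<close>
  have "(1 + mean_arrivals m) / lam = expectation (\<lambda>\<omega>. q.path.time_spent \<omega> 0 m + ?busy \<omega> + q.path.r \<omega> m)"
    unfolding expectation_arrival_epoch[symmetric]
    by (intro Bochner_Integration.integral_cong refl) (simp add: q.path.r_eq q.path.now_eq_idle_busy)
  also have "\<dots> = expectation (\<lambda>\<omega>. q.path.time_spent \<omega> 0 m) + expectation ?busy + expectation (\<lambda>\<omega>. q.path.r \<omega> m)"
    using int_busy int_idle residual_integrable by simp
  finally have total: "(1 + mean_arrivals m) / lam =
    expectation (\<lambda>\<omega>. q.path.time_spent \<omega> 0 m) + expectation ?busy + expectation (\<lambda>\<omega>. q.path.r \<omega> m)" .
  have busy: "expectation ?busy \<le> mean_arrivals m / mu"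
    using mean_busy_time_le[of m] mu_pos by (simp add: field_simps)
  have "expectation (\<lambda>\<omega>. q.path.time_spent \<omega> 0 m) \<le>
      expectation (\<lambda>\<omega>. C * q.path.arrivals_finding \<omega> 0 m + (\<Sum>k<m. ?t k \<omega>))"
  proof (intro Bochner_Integration.integral_mono int_idle)
    show "integrable M (\<lambda>\<omega>. C * q.path.arrivals_finding \<omega> 0 m + (\<Sum>k<m. ?t k \<omega>))"
      using int_A tail_integrable by simp
    fix \<omega>
    have "(\<Sum>k<num_arrivals (q.H m \<omega>). ?t k \<omega>) \<le> (\<Sum>k<m. ?t k \<omega>)"
      using q.path.num_arrivals_le[of \<omega> m] by (intro sum_mono2) auto
    then show "q.path.time_spent \<omega> 0 m \<le> C * q.path.arrivals_finding \<omega> 0 m + (\<Sum>k<m. ?t k \<omega>)"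
      using q.path.idle_time_le[OF C, of \<omega> m] by simp
  qed
  also have "\<dots> = C * expectation (\<lambda>\<omega>. q.path.arrivals_finding \<omega> 0 m) + real m * tail C"
    using int_A tail_integrable by (simp add: expectation_tail)
  finally have idle: "expectation (\<lambda>\<omega>. q.path.time_spent \<omega> 0 m) \<le>
      C * expectation (\<lambda>\<omega>. q.path.arrivals_finding \<omega> 0 m) + real m * tail C" .
  have "expectation (\<lambda>\<omega>. q.path.r \<omega> m) \<le> expectation (\<lambda>\<omega>. C + (\<Sum>k\<le>m. ?t k \<omega>))"
    using tail_integrable by (intro Bochner_Integration.integral_mono residual_integrable q.path.residual_le C) auto
  also have "\<dots> = C + real (Suc m) * tail C"
    using tail_integrable by (simp add: expectation_tail prob_space)
  finally have res: "expectation (\<lambda>\<omega>. q.path.r \<omega> m) \<le> C + real (Suc m) * tail C" .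
  have "mean_arrivals m * (1 / lam - 1 / mu) \<le> (1 + mean_arrivals m) / lam - mean_arrivals m / mu"
    using lam_pos by (simp add: field_simps)
  \<comment> \<open>Of the \<open>2 * m + 1\<close> tails, \<open>m\<close> come from the idle time
    and \<open>m + 1\<close> from the residual time.\<close>
  also have "\<dots> \<le> C * expectation (\<lambda>\<omega>. q.path.arrivals_finding \<omega> 0 m) + C + real (2 * m + 1) * tail C"
    using total busy idle res by (simp add: algebra_simps)
  finally show ?thesis .
qed

section \<open>Equations for the arrival probabilities\<close>

context
  fixes a :: "nat \<Rightarrow> real"
  assumes arrival_lim: "\<And>n. AE \<omega> in M. (\<lambda>m. arrival_freq (q.path.hist \<omega>) n m) \<longlonglongrightarrow> a n"
begin

lemma arrivals_finding_limit:
  "(\<lambda>m. (expectation (\<lambda>\<omega>. q.path.arrivals_finding \<omega> n m) - a n * mean_arrivals m) / real m) \<longlonglongrightarrow> 0"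
proof (rule ratio_limit)
  show "AE \<omega> in M. (\<lambda>m. q.path.arrivals_finding \<omega> n m / real (num_arrivals (q.H m \<omega>))) \<longlonglongrightarrow> a n"
    using arrival_lim[of n] by (simp add: q.path.arrival_freq_eq)
qed (auto simp: q.path.arrivals_finding_bounds q.path.num_arrivals_le)

lemma arrivals_finding_integrable: "integrable M (\<lambda>\<omega>. q.path.arrivals_finding \<omega> n m)"
  and departures_leaving_integrable: "integrable M (\<lambda>\<omega>. q.path.departures_leaving \<omega> n m)"
  unfolding q.path.arrivals_finding_def q.path.departures_leaving_def
  by (intro Bochner_Integration.integrable_sum of_bool_integrable; measurable)+

text \<open>Along each path the two counts differ by at most one, so division by \<open>m\<close>
  makes their means indistinguishable in the limit.\<close>

lemma departures_leaving_limit: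
  "(\<lambda>m. (expectation (\<lambda>\<omega>. q.path.departures_leaving \<omega> n m) - a n * mean_arrivals m) / real m) \<longlonglongrightarrow> 0"
proof -
  let ?A = "\<lambda>m. expectation (\<lambda>\<omega>. q.path.arrivals_finding \<omega> n m)"
  let ?D = "\<lambda>m. expectation (\<lambda>\<omega>. q.path.departures_leaving \<omega> n m)"
  have "(\<lambda>m. (?D m - ?A m) / real m) \<longlonglongrightarrow> 0"
  proof (rule Lim_null_comparison[OF _ lim_inverse_n])
    have "\<bar>?D m - ?A m\<bar> \<le> 1" for m
    proof -
      have "?A m - ?D m = expectation (\<lambda>\<omega>. of_bool (n < q.path.N \<omega> m))"
        using arrivals_finding_integrable[of n m] departures_leaving_integrable[of n m]
        by (subst Bochner_Integration.integral_diff[symmetric])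
           (simp_all add: q.path.arrivals_departures_balance)
      moreover have "expectation (\<lambda>\<omega>. of_bool (n < q.path.N \<omega> m)) \<le> (1 :: real)"
        by (intro integral_le_const of_bool_integrable) auto
      moreover have "(0 :: real) \<le> expectation (\<lambda>\<omega>. of_bool (n < q.path.N \<omega> m))"
        by (intro Bochner_Integration.integral_nonneg) simp
      ultimately show ?thesis by linarith
    qed
    then show "\<forall>\<^sub>F m in sequentially. norm ((?D m - ?A m) / real m) \<le> inverse (real m)"
      by (intro always_eventually allI) (simp add: divide_inverse abs_mult mult_left_le_one_le)
  qed
  from tendsto_add[OF this arrivals_finding_limit[of n]] show ?thesis
    by (simp add: add_divide_distrib[symmetric])
qed

text \<open>Since \<open>mean_arrivals m\<close> is at least \<open>m / 2\<close>, only the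
  coefficient \<open>0\<close> lets the quotient vanish. This turns asymptotic relations into
  equations.\<close>

lemma mean_arrivals_negligible:
  assumes "(\<lambda>m. c * mean_arrivals m / real m) \<longlonglongrightarrow> 0"
  shows "c = 0"
proof -
  have "\<bar>c\<bar> / 2 \<le> \<bar>c * mean_arrivals m / real m\<bar>" if "0 < m" for m
  proof -
    have "\<bar>c\<bar> * (real m / 2) \<le> \<bar>c\<bar> * mean_arrivals m"
      by (intro mult_left_mono mean_arrivals_bounds) simp
    moreover have "0 \<le> mean_arrivals m" using mean_arrivals_bounds(1)[of m] by linarith
    ultimately show ?thesis using that by (simp add: abs_mult field_simps)
  qed
  then have "\<forall>\<^sub>F m in sequentially. \<bar>c\<bar> / 2 \<le> \<bar>c * mean_arrivals m / real m\<bar>"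
    by (intro eventually_sequentiallyI[of 1]) auto
  with tendsto_rabs_zero[OF assms] have "\<bar>c\<bar> / 2 \<le> 0"
    by (intro tendsto_le[OF sequentially_bot _ tendsto_const]) auto
  then show ?thesis by simp
qed

text \<open>If \<open>a 0 = 0\<close>, dividing \<open>idle_bound\<close> by \<open>m\<close> and
  letting \<open>m\<close> tend to infinity with \<open>C = real k\<close> fixed leaves
  \<open>(1 / lam - 1 / mu) / 2 \<le> 3 * tail (real k)\<close>; letting \<open>k\<close> tend to
  infinity then contradicts stability. The truncation takes care of idle periods that are rare but
  long.\<close>

lemma empty_prob_pos: "0 < a 0"
proof -
  let ?A = "\<lambda>m. expectation (\<lambda>\<omega>. q.path.arrivals_finding \<omega> 0 m)"
  let ?\<delta> = "1 / lam - 1 / mu"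
  have \<delta>: "0 < ?\<delta>" using lam_pos stable by (simp add: field_simps)
  have "a 0 \<noteq> 0"
  proof
    assume "a 0 = 0"
    then have A: "(\<lambda>m. ?A m / real m) \<longlonglongrightarrow> 0" using arrivals_finding_limit[of 0] by simp
    \<comment> \<open>The \<open>2\<close> comes from \<open>mean_arrivals m \<ge> m / 2\<close>,
      the \<open>3\<close> from \<open>2 * m + 1 \<le> 3 * m\<close>.\<close>
    have "?\<delta> / 2 \<le> 3 * tail (real k)" for k
    proof -
      have lim: "(\<lambda>m. real k * (?A m / real m) + real k * inverse (real m) + 3 * tail (real k)) \<longlonglongrightarrow>
          real k * 0 + real k * 0 + 3 * tail (real k)"
        by (intro tendsto_intros A lim_inverse_n)
      have "?\<delta> / 2 \<le> real k * (?A m / real m) + real k * inverse (real m) + 3 * tail (real k)" if m: "1 \<le> m" for m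
      proof -
        have "real m / 2 * ?\<delta> \<le> mean_arrivals m * ?\<delta>"
          using \<delta> by (intro mult_right_mono mean_arrivals_bounds) simp
        also have "\<dots> \<le> real k * ?A m + real k + real (2 * m + 1) * tail (real k)"
          by (rule idle_bound) simp
        also have "real (2 * m + 1) * tail (real k) \<le> (3 * real m) * tail (real k)"
          using m by (intro mult_right_mono tail_nonneg) simp
        finally have "real m * (?\<delta> / 2) \<le> real m * (real k * (?A m / real m) + real k * inverse (real m) + 3 * tail (real k))"
          using m by (simp add: algebra_simps)
        then show ?thesis using m by simp
      qed
      then show ?thesis
        using lim by (intro LIMSEQ_le_const[OF lim[simplified]]) auto
    qed
    then have "?\<delta> / 2 \<le> 3 * 0"
      by (intro LIMSEQ_le_const[OF tendsto_mult_left[OF tail_tendsto]]) auto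
    then show False using \<delta> by simp
  qed
  moreover have "0 \<le> a 0"
  proof -
    have "AE \<omega> in M. 0 \<le> a 0"
      using arrival_lim[of 0]
      by eventually_elim (erule LIMSEQ_le_const, auto simp: arrival_freq_def)
    then show ?thesis by simp
  qed
  ultimately show ?thesis by simp
qed

context
  fixes R :: "real measure"
  assumes R: "real_distribution R"
    and residual_lim: "\<And>n x. AE \<omega> in M. departure_residual_freq (Apos \<omega>) (q.path.hist \<omega>) n x \<longlonglongrightarrow> cdf R x"
begin

interpretation R: real_distribution R by (rule R)

lemma cdf_R_neg: "x < 0 \<Longrightarrow> cdf R x = 0"
proof -
  assume x: "x < 0"
  have "\<not> q.path.r \<omega> i \<le> x" for \<omega> i using q.path.r_nonneg[of \<omega> i] x by simp
  then have "AE \<omega> in M. (\<lambda>_. 0) \<longlonglongrightarrow> cdf R x"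
    using residual_lim[of 0 x] by (simp add: q.path.departure_residual_freq_eq[abs_def])
  then show ?thesis by (simp add: tendsto_const_iff)
qed

lemma AE_R_nonneg: "AE t in R. 0 \<le> t"
proof -
  have "AE t in R. \<forall>k. \<not> t \<le> - inverse (real (Suc k))"
    unfolding AE_all_countable
  proof
    fix k
    have "cdf R (- inverse (real (Suc k))) = 0" by (rule cdf_R_neg) simp
    then have "{..- inverse (real (Suc k))} \<in> null_sets R"
      by (simp add: null_sets_def cdf_def R.emeasure_eq_measure)
    from AE_not_in[OF this] show "AE t in R. \<not> t \<le> - inverse (real (Suc k))" by simp
  qed
  then show ?thesis
  proof eventually_elim
    case (elim t)
    show ?case
    proof (rule ccontr)
      assume "\<not> 0 \<le> t"
      then obtain k where "inverse (real (Suc k)) < - t" using reals_Archimedean[of "- t"] by auto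
      then show False using elim[rule_format, of k] by simp
    qed
  qed
qed

lemma prob_service_ge: "expectation (\<lambda>\<omega>. of_bool (t \<le> Spos \<omega> 0)) = exp (- mu * max 0 t)"
proof -
  have "expectation (\<lambda>\<omega>. of_bool (t \<le> Spos \<omega> 0)) =
      expectation (indicator {\<omega> \<in> space M. max 0 t < S 0 \<omega>} :: 'w \<Rightarrow> real)"
  proof (rule integral_cong_AE)
    show "AE \<omega> in M. of_bool (t \<le> Spos \<omega> 0) = (indicator {\<omega> \<in> space M. max 0 t < S 0 \<omega>} \<omega> :: real)"
      using AE_service_pos AE_service_neq[of 0 t] AE_space
    proof eventually_elim
      case (elim \<omega>)
      then show ?case using elim(1)[rule_format, of 0] by (auto simp: indicator_def max_def)
    qed
  qed auto
  also have "\<dots> = prob {\<omega> \<in> space M. max 0 t < S 0 \<omega>}" by simp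
  also have "\<dots> = exp (- mu * max 0 t)"
    using prob_service_gt[of "max 0 t" 0] by (simp add: emeasure_eq_measure)
  finally show ?thesis .
qed

text \<open>
  An exponential variable with rate \<open>mu\<close> exceeds \<open>t\<close> with probability \<open>exp (- mu * t)\<close>; hence the
  transform at \<open>mu\<close> is the distribution function at an independent service requirement.
\<close>

lemma lst_R_eq: "lst R mu = expectation (\<lambda>\<omega>. cdf R (Spos \<omega> 0))"
proof -
  interpret RM: pair_prob_space R M ..
  have [measurable_cong]: "sets R = sets borel" by simp
  have "expectation (\<lambda>\<omega>. cdf R (Spos \<omega> 0)) = expectation (\<lambda>\<omega>. LINT t|R. of_bool (t \<le> Spos \<omega> 0))"
  proof (intro Bochner_Integration.integral_cong refl)
    fix \<omega>
    have "(LINT t|R. of_bool (t \<le> Spos \<omega> 0)) = (LINT t|R. indicator {..Spos \<omega> 0} t :: real)"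
      by (intro Bochner_Integration.integral_cong refl) (simp add: indicator_def)
    then show "cdf R (Spos \<omega> 0) = (LINT t|R. of_bool (t \<le> Spos \<omega> 0))"
      by (simp add: cdf_def)
  qed
  also have "\<dots> = (LINT t|R. expectation (\<lambda>\<omega>. of_bool (t \<le> Spos \<omega> 0)))"
    by (rule RM.Fubini_integral) (rule RM.integrable_const_bound[where B = 1]; auto)
  also have "\<dots> = (LINT t|R. exp (- mu * max 0 t))" by (simp only: prob_service_ge)
  also have "\<dots> = lst R mu"
    unfolding lst_def set_lebesgue_integral_def
    using AE_R_nonneg by (intro integral_cong_AE) (auto simp: max_absorb2)
  finally show ?thesis ..
qed

text \<open>For each fixed \<open>x\<close> the error \<open>h m x\<close> is a number tending to
  \<open>0\<close>. Evaluating it at a requirement drawn at a second sample point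
  \<open>\<omega>'\<close> and taking means turns \<open>cdf R\<close> into \<open>lst R mu\<close>
  and the indicator of \<open>r \<le> x\<close> into \<open>exp (- mu * r)\<close>. The separate
  sample point keeps that requirement independent of the counts.\<close>

lemma residual_lst_limit:
  "(\<lambda>m. (expectation (\<lambda>\<omega>. \<Sum>i<m. of_bool (q.path.N \<omega> i = Suc n \<and> \<not> q.path.arr \<omega> i) *
      exp (- mu * q.path.r \<omega> (Suc i))) -
    lst R mu * expectation (\<lambda>\<omega>. q.path.departures_leaving \<omega> n m)) / real m) \<longlonglongrightarrow> 0"
proof -
  interpret MM: pair_prob_space M M ..
  define cnt where "cnt m x \<omega> = (\<Sum>i<m. of_bool (q.path.N \<omega> i = Suc n \<and> \<not> q.path.arr \<omega> i) *
      of_bool (q.path.r \<omega> (Suc i) \<le> x) :: real)" for m x \<omega>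
  define h where "h m x = (expectation (cnt m x) - cdf R x *
      expectation (\<lambda>\<omega>. q.path.departures_leaving \<omega> n m)) / real m" for m x
  have [measurable]: "cnt m x \<in> borel_measurable M" for m x
    unfolding cnt_def[abs_def] by measurable
  have cnt: "0 \<le> cnt m x \<omega>" "cnt m x \<omega> \<le> q.path.departures_leaving \<omega> n m" for m x \<omega>
    unfolding cnt_def q.path.departures_leaving_def by (auto intro!: sum_nonneg sum_mono)
  have cnt_le: "cnt m x \<omega> \<le> real m" for m x \<omega>
    using cnt(2)[of m x \<omega>] q.path.departures_leaving_bounds(2)[of \<omega> n m] by simp
  have h_lim: "(\<lambda>m. h m x) \<longlonglongrightarrow> 0" for x
    unfolding h_def
  proof (rule ratio_limit)
    show "AE \<omega> in M. (\<lambda>m. cnt m x \<omega> / q.path.departures_leaving \<omega> n m) \<longlonglongrightarrow> cdf R x"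
      using residual_lim[of n x] by (simp add: q.path.departure_residual_freq_eq[abs_def] cnt_def)
  qed (use cnt q.path.departures_leaving_bounds in auto)
  have joint: "(\<lambda>p. cnt m (Spos (fst p) 0) (snd p)) \<in> borel_measurable (M \<Otimes>\<^sub>M M)" for m
    unfolding cnt_def by measurable
  have int_joint: "integrable (M \<Otimes>\<^sub>M M) (\<lambda>(\<omega>', \<omega>). cnt m (Spos \<omega>' 0) \<omega>)" for m
    using joint[of m] cnt(1) cnt_le
    by (intro MM.integrable_const_bound[where B = "real m"]) (auto simp: split_beta')
  have Ecnt [measurable]: "(\<lambda>\<omega>'. expectation (cnt m (Spos \<omega>' 0))) \<in> borel_measurable M" for m
    using joint[of m] by (intro borel_measurable_lebesgue_integral) (simp add: split_beta')
  have [measurable]: "(\<lambda>x. cdf R x) \<in> borel_measurable borel"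
    by (intro borel_measurable_mono R.cdf_nondecreasing monoI)
  have ED: "0 \<le> expectation (\<lambda>\<omega>. q.path.departures_leaving \<omega> n m)"
      "expectation (\<lambda>\<omega>. q.path.departures_leaving \<omega> n m) \<le> real m" for m
    using q.path.departures_leaving_bounds departures_leaving_integrable[of n m]
    by (auto intro!: Bochner_Integration.integral_nonneg integral_le_const)
  have EC: "0 \<le> expectation (cnt m x)" "expectation (cnt m x) \<le> real m" for m x
  proof -
    have "integrable M (cnt m x)"
      using cnt(1) cnt_le by (intro integrable_const_bound[where B = "real m"]) auto
    then show "0 \<le> expectation (cnt m x)" "expectation (cnt m x) \<le> real m"
      using cnt(1) cnt_le by (auto intro!: Bochner_Integration.integral_nonneg integral_le_const)
  qed
  have "(\<lambda>m. expectation (\<lambda>\<omega>'. h m (Spos \<omega>' 0))) \<longlonglongrightarrow> 0"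
  proof (rule bounded_convergence_zero)
    show "(\<lambda>\<omega>'. h m (Spos \<omega>' 0)) \<in> borel_measurable M" for m
      unfolding h_def by measurable
    show "\<bar>h m (Spos \<omega>' 0)\<bar> \<le> 1" for m \<omega>'
    proof -
      let ?x = "Spos \<omega>' 0" and ?D = "expectation (\<lambda>\<omega>. q.path.departures_leaving \<omega> n m)"
      have "0 \<le> cdf R ?x * ?D"
        using ED(1) R.cdf_nonneg by (rule mult_nonneg_nonneg[rotated])
      moreover have "cdf R ?x * ?D \<le> 1 * real m"
        by (rule mult_mono) (auto simp: ED R.cdf_bounded_prob)
      ultimately have "\<bar>expectation (cnt m ?x) - cdf R ?x * ?D\<bar> \<le> real m"
        using EC[of m ?x] by linarith
      then show ?thesis unfolding h_def by (cases "m = 0") (auto simp: abs_divide)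
    qed
  qed (use h_lim in auto)
  moreover have "expectation (\<lambda>\<omega>'. h m (Spos \<omega>' 0)) =
      (expectation (\<lambda>\<omega>. \<Sum>i<m. of_bool (q.path.N \<omega> i = Suc n \<and> \<not> q.path.arr \<omega> i) *
        exp (- mu * q.path.r \<omega> (Suc i))) -
      lst R mu * expectation (\<lambda>\<omega>. q.path.departures_leaving \<omega> n m)) / real m" for m
  proof -
    have "expectation (\<lambda>\<omega>'. expectation (\<lambda>\<omega>. cnt m (Spos \<omega>' 0) \<omega>)) =
        expectation (\<lambda>\<omega>. expectation (\<lambda>\<omega>'. cnt m (Spos \<omega>' 0) \<omega>))"
      by (rule MM.Fubini_integral[OF int_joint, symmetric])
    also have "\<dots> = expectation (\<lambda>\<omega>. \<Sum>i<m. of_bool (q.path.N \<omega> i = Suc n \<and> \<not> q.path.arr \<omega> i) *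
        exp (- mu * q.path.r \<omega> (Suc i)))"
    proof (intro Bochner_Integration.integral_cong refl)
      fix \<omega>
      have "integrable M (\<lambda>\<omega>'. of_bool (q.path.r \<omega> (Suc i) \<le> Spos \<omega>' 0) :: real)" for i
        by (rule of_bool_integrable) measurable
      then show "expectation (\<lambda>\<omega>'. cnt m (Spos \<omega>' 0) \<omega>) =
          (\<Sum>i<m. of_bool (q.path.N \<omega> i = Suc n \<and> \<not> q.path.arr \<omega> i) * exp (- mu * q.path.r \<omega> (Suc i)))"
        unfolding cnt_def using q.path.r_nonneg[of \<omega>]
        by (subst Bochner_Integration.integral_sum) (simp_all add: prob_service_ge max_absorb2)
    qed
    finally have swap: "expectation (\<lambda>\<omega>'. expectation (cnt m (Spos \<omega>' 0))) = \<dots>" .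
    have "integrable M (\<lambda>\<omega>'. expectation (cnt m (Spos \<omega>' 0)))"
      using EC by (intro integrable_const_bound[where B = "real m"]) auto
    moreover have "integrable M (\<lambda>\<omega>'. cdf R (Spos \<omega>' 0))"
      using R.cdf_nonneg R.cdf_bounded_prob by (intro integrable_const_bound[where B = 1]) auto
    ultimately show ?thesis
      unfolding h_def by (simp add: swap lst_R_eq)
  qed
  ultimately show ?thesis by simp
qed

lemma arrival_prob_rec:
  assumes n: "n \<noteq> 0"
  shows "a n * (1 - lst R mu) = a (n - 1) * lst G mu"
proof -
  let ?A = "\<lambda>n m. expectation (\<lambda>\<omega>. q.path.arrivals_finding \<omega> n m)"
  let ?D = "\<lambda>n m. expectation (\<lambda>\<omega>. q.path.departures_leaving \<omega> n m)"
  let ?W = "\<lambda>m. expectation (\<lambda>\<omega>. \<Sum>i<m. of_bool (q.path.N \<omega> i = Suc n \<and> \<not> q.path.arr \<omega> i) *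
      exp (- mu * q.path.r \<omega> (Suc i)))"
  let ?T = "mean_arrivals"
  have "(\<lambda>m. (?A n (Suc m) - ?A n m) / real m) \<longlonglongrightarrow> 0"
  proof (rule Lim_null_comparison[OF _ lim_inverse_n])
    have "\<bar>?A n (Suc m) - ?A n m\<bar> \<le> 1" for m
    proof -
      have "?A n (Suc m) - ?A n m = expectation (\<lambda>\<omega>. of_bool (q.path.N \<omega> m = n \<and> q.path.arr \<omega> m))"
        using arrivals_finding_integrable[of n "Suc m"] arrivals_finding_integrable[of n m]
        by (subst Bochner_Integration.integral_diff[symmetric])
           (simp_all add: q.path.arrivals_finding_def)
      moreover have "expectation (\<lambda>\<omega>. of_bool (q.path.N \<omega> m = n \<and> q.path.arr \<omega> m)) \<le> (1 :: real)"
        by (intro integral_le_const of_bool_integrable) auto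
      moreover have "(0 :: real) \<le> expectation (\<lambda>\<omega>. of_bool (q.path.N \<omega> m = n \<and> q.path.arr \<omega> m))"
        by (intro Bochner_Integration.integral_nonneg) simp
      ultimately show ?thesis by linarith
    qed
    then show "\<forall>\<^sub>F m in sequentially. norm ((?A n (Suc m) - ?A n m) / real m) \<le> inverse (real m)"
      by (intro always_eventually allI) (simp add: divide_inverse abs_mult mult_left_le_one_le)
  qed
  then have step: "(\<lambda>m. (?A (n - 1) m * lst G mu + ?W m - ?A n m) / real m) \<longlonglongrightarrow> 0"
    unfolding mean_arrivals_finding_rec[OF n] .
  \<comment> \<open>The combination is chosen so that all counts cancel and a multiple of
    \<open>mean_arrivals m\<close> remains, whose coefficient must vanish.\<close>
  have "(\<lambda>m. (?A (n - 1) m * lst G mu + ?W m - ?A n m) / real m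
      + (?A n m - a n * ?T m) / real m
      - lst G mu * ((?A (n - 1) m - a (n - 1) * ?T m) / real m)
      - (?W m - lst R mu * ?D n m) / real m
      - lst R mu * ((?D n m - a n * ?T m) / real m)) \<longlonglongrightarrow> 0 + 0 - lst G mu * 0 - 0 - lst R mu * 0"
    by (intro tendsto_intros step arrivals_finding_limit departures_leaving_limit residual_lst_limit)
  moreover have "(?A (n - 1) m * lst G mu + ?W m - ?A n m) / real m
      + (?A n m - a n * ?T m) / real m
      - lst G mu * ((?A (n - 1) m - a (n - 1) * ?T m) / real m)
      - (?W m - lst R mu * ?D n m) / real m
      - lst R mu * ((?D n m - a n * ?T m) / real m) =
      (a (n - 1) * lst G mu - a n * (1 - lst R mu)) * ?T m / real m" for m
    by (cases "m = 0") (simp_all add: field_simps)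
  ultimately have "a (n - 1) * lst G mu - a n * (1 - lst R mu) = 0"
    by (intro mean_arrivals_negligible) simp
  then show ?thesis by simp
qed

end

section \<open>Equations for the time-average probabilities\<close>

context
  fixes \<pi> :: "nat \<Rightarrow> real"
  assumes time_lim: "\<And>n. AE \<omega> in M. (time_freq (q.path.hist \<omega>) n \<longlongrightarrow> \<pi> n) at_top"
begin

text \<open>The denominator is the clock, which is not bounded by \<open>m\<close> as in
  \<open>ratio_limit\<close>; the error is instead dominated by
  \<open>arrival_epoch (Apos \<omega>) m\<close> times a bounded factor whose mean vanishes.\<close>

lemma time_spent_limit:
  "(\<lambda>m. (expectation (\<lambda>\<omega>. q.path.time_spent \<omega> n m) - \<pi> n * mean_now m) / real m) \<longlonglongrightarrow> 0"
proof -
  define \<epsilon> where "\<epsilon> m \<omega> = \<bar>q.path.time_spent \<omega> n m / now (q.H m \<omega>) - \<pi> n\<bar>" for m \<omega>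
  have \<epsilon>_le: "\<epsilon> m \<omega> \<le> 1 + \<bar>\<pi> n\<bar>" for m \<omega>
  proof -
    have "\<bar>q.path.time_spent \<omega> n m / now (q.H m \<omega>)\<bar> \<le> 1"
      using q.path.time_spent_bounds[of \<omega> n m] q.path.now_nonneg[of \<omega> m]
      by (auto simp: divide_le_eq_1)
    then show ?thesis unfolding \<epsilon>_def by linarith
  qed
  have \<epsilon>_measurable [measurable]: "\<epsilon> m \<in> borel_measurable M" for m
    unfolding \<epsilon>_def[abs_def] by measurable
  have "(\<lambda>m. expectation (\<epsilon> m)) \<longlonglongrightarrow> 0"
  proof (rule bounded_convergence_zero)
    show "\<bar>\<epsilon> m \<omega>\<bar> \<le> 1 + \<bar>\<pi> n\<bar>" for m \<omega> using \<epsilon>_le by (simp add: \<epsilon>_def)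
    show "AE \<omega> in M. (\<lambda>m. \<epsilon> m \<omega>) \<longlonglongrightarrow> 0"
      using time_lim[of n] AE_now_at_top
    proof eventually_elim
      case (elim \<omega>)
      from filterlim_compose[OF elim]
      have "(\<lambda>m. q.path.time_spent \<omega> n m / now (q.H m \<omega>)) \<longlonglongrightarrow> \<pi> n"
        by (simp add: q.path.time_freq_now)
      then show ?case unfolding \<epsilon>_def by (simp add: LIM_zero tendsto_rabs_zero)
    qed
  qed measurable
  then have lim: "(\<lambda>m. expectation (\<lambda>\<omega>. arrival_epoch (Apos \<omega>) m * \<epsilon> m \<omega>) / real m) \<longlonglongrightarrow> 0"
  proof (rule uniform_integrability[rotated 3])
    show "0 \<le> \<epsilon> m \<omega>" "\<epsilon> m \<omega> \<le> 1 + \<bar>\<pi> n\<bar>" for m \<omega>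
      using \<epsilon>_le by (simp_all add: \<epsilon>_def)
  qed (rule \<epsilon>_measurable)
  show ?thesis
  proof (rule Lim_null_comparison[OF always_eventually lim], intro allI)
    fix m
    have int: "integrable M (\<lambda>\<omega>. q.path.time_spent \<omega> n m)"
      unfolding q.path.time_spent_def by (intro Bochner_Integration.integrable_sum sojourn_integrable) measurable
    have "\<bar>expectation (\<lambda>\<omega>. q.path.time_spent \<omega> n m) - \<pi> n * mean_now m\<bar> =
        \<bar>expectation (\<lambda>\<omega>. q.path.time_spent \<omega> n m - \<pi> n * now (q.H m \<omega>))\<bar>"
      using int now_integrable[of m] by simp
    also have "\<dots> \<le> expectation (\<lambda>\<omega>. \<bar>q.path.time_spent \<omega> n m - \<pi> n * now (q.H m \<omega>)\<bar>)"
      by (rule integral_abs_bound)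
    also have "\<dots> \<le> expectation (\<lambda>\<omega>. arrival_epoch (Apos \<omega>) m * \<epsilon> m \<omega>)"
    proof (rule Bochner_Integration.integral_mono)
      show "integrable M (\<lambda>\<omega>. \<bar>q.path.time_spent \<omega> n m - \<pi> n * now (q.H m \<omega>)\<bar>)"
        using int now_integrable[of m] by simp
      show "integrable M (\<lambda>\<omega>. arrival_epoch (Apos \<omega>) m * \<epsilon> m \<omega>)"
      proof (rule Bochner_Integration.integrable_bound)
        show "integrable M (\<lambda>\<omega>. arrival_epoch (Apos \<omega>) m * (1 + \<bar>\<pi> n\<bar>))"
          using arrival_epoch_integrable[of m] by simp
        show "(\<lambda>\<omega>. arrival_epoch (Apos \<omega>) m * \<epsilon> m \<omega>) \<in> borel_measurable M"
          unfolding arrival_epoch_def by measurable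
        show "AE \<omega> in M. norm (arrival_epoch (Apos \<omega>) m * \<epsilon> m \<omega>) \<le>
            norm (arrival_epoch (Apos \<omega>) m * (1 + \<bar>\<pi> n\<bar>))"
          using \<epsilon>_le q.path.arrival_epoch_nonneg
          by (intro AE_I2) (auto simp: abs_mult \<epsilon>_def intro!: mult_left_mono)
      qed
      fix \<omega>
      let ?x = "q.path.time_spent \<omega> n m" and ?t = "now (q.H m \<omega>)"
      have t: "0 \<le> ?t" "0 \<le> ?x" "?x \<le> ?t"
        using q.path.time_spent_bounds[of \<omega> n m] q.path.now_nonneg[of \<omega> m] by auto
      then have "?x - \<pi> n * ?t = ?t * (?x / ?t - \<pi> n)"
        by (cases "?t = 0") (auto simp: field_simps)
      then have "\<bar>?x - \<pi> n * ?t\<bar> = ?t * \<epsilon> m \<omega>" using t by (simp add: \<epsilon>_def abs_mult)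
      also have "\<dots> \<le> arrival_epoch (Apos \<omega>) m * \<epsilon> m \<omega>"
        by (intro mult_right_mono q.path.now_le) (simp add: \<epsilon>_def)
      finally show "\<bar>?x - \<pi> n * ?t\<bar> \<le> arrival_epoch (Apos \<omega>) m * \<epsilon> m \<omega>" .
    qed
    finally show "norm ((expectation (\<lambda>\<omega>. q.path.time_spent \<omega> n m) - \<pi> n * mean_now m) / real m) \<le>
        expectation (\<lambda>\<omega>. arrival_epoch (Apos \<omega>) m * \<epsilon> m \<omega>) / real m"
      by (simp add: divide_right_mono)
  qed
qed

lemma level_crossing_limit:
  "(\<lambda>m. (mu * \<pi> (Suc n) * mean_now m - a n * mean_arrivals m) / real m) \<longlonglongrightarrow> 0"
proof -
  let ?D = "\<lambda>m. expectation (\<lambda>\<omega>. q.path.departures_leaving \<omega> n m)"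
  let ?L = "\<lambda>m. expectation (\<lambda>\<omega>. q.path.time_spent \<omega> (Suc n) m)"
  have "(\<lambda>m. (?D m - a n * mean_arrivals m) / real m - mu * ((?L m - \<pi> (Suc n) * mean_now m) / real m))
      \<longlonglongrightarrow> 0 - mu * 0"
    by (intro tendsto_intros departures_leaving_limit time_spent_limit)
  then show ?thesis
    by (simp add: expectation_departures_leaving right_diff_distrib diff_divide_distrib mult.assoc)
qed

lemma time_prob_nonzero:
  assumes "a n \<noteq> 0"
  shows "\<pi> (Suc n) \<noteq> 0"
proof
  assume "\<pi> (Suc n) = 0"
  then have "(\<lambda>m. - a n * mean_arrivals m / real m) \<longlonglongrightarrow> 0"
    using level_crossing_limit[of n] by simp
  then have "- a n = 0" by (rule mean_arrivals_negligible)
  with assms show False by simp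
qed

text \<open>\<open>mean_now\<close> has to be eliminated between level-crossing relations. Levels
  \<open>n\<close> and \<open>k\<close> combine to leave it with a coefficient proportional to
  \<open>c\<close>; level \<open>0\<close> trades it for \<open>mean_arrivals\<close>, and
  \<open>a 0 > 0\<close> then gives \<open>c = 0\<close>.\<close>

lemma time_prob_ratio: "a k * \<pi> (Suc n) = a n * \<pi> (Suc k)"
proof -
  let ?l = "\<lambda>n m. (mu * \<pi> (Suc n) * mean_now m - a n * mean_arrivals m) / real m"
  define c where "c = a k * \<pi> (Suc n) - a n * \<pi> (Suc k)"
  have "(\<lambda>m. \<pi> (Suc 0) * (a k * ?l n m - a n * ?l k m) - c * ?l 0 m) \<longlonglongrightarrow>
      \<pi> (Suc 0) * (a k * 0 - a n * 0) - c * 0"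
    by (intro tendsto_intros level_crossing_limit)
  moreover have "\<pi> (Suc 0) * (a k * ?l n m - a n * ?l k m) - c * ?l 0 m =
      (c * a 0) * mean_arrivals m / real m" for m
    by (cases "m = 0") (simp_all add: c_def field_simps)
  ultimately have "c * a 0 = 0"
    by (intro mean_arrivals_negligible) simp
  then show ?thesis using empty_prob_pos by (simp add: c_def)
qed

end

end

lemma AE_interarrival_pos: "AE \<omega> in M. \<forall>k. 0 < A k \<omega>"
  unfolding AE_all_countable
proof
  fix k
  have "AE y in distr M borel (A k). 0 < y"
    unfolding interarrival_distr by (rule interarrival_pos)
  then show "AE \<omega> in M. 0 < A k \<omega>"
    by (subst (asm) AE_distr_iff) auto
qed

text \<open>Carries hypotheses stated for the original inputs over to the truncated ones.\<close>

lemma AE_nonneg_inputs: "AE \<omega> in M. (\<lambda>k. A k \<omega>) = Apos \<omega> \<and> (\<lambda>k. S k \<omega>) = Spos \<omega>"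
  using AE_interarrival_pos AE_service_pos
  by eventually_elim (auto simp: fun_eq_iff max_def dest: less_imp_le)

end

theorem theorem4:
  fixes M :: "'w measure" and A S :: "nat \<Rightarrow> 'w \<Rightarrow> real" and V :: "'w \<Rightarrow> real"
    and \<rho> :: regime and G R :: "real measure" and lam mu \<sigma> :: real
    and a \<pi> :: "nat \<Rightarrow> real"
  assumes queue: "stable_gm1_queue M A S V \<rho> G lam mu"
    and arrival_prob: "\<And>n. AE \<omega> in M.
          arrival_freq (queue_history \<rho> (V \<omega>) (\<lambda>k. A k \<omega>) (\<lambda>k. S k \<omega>)) n \<longlonglongrightarrow> a n"
    and time_prob: "\<And>n. AE \<omega> in M.
          (time_freq (queue_history \<rho> (V \<omega>) (\<lambda>k. A k \<omega>) (\<lambda>k. S k \<omega>)) n \<longlongrightarrow> \<pi> n) at_top"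
    and residual_distribution: "real_distribution R"
    and residual: "\<And>n x. AE \<omega> in M.
          departure_residual_freq (\<lambda>k. A k \<omega>)
            (queue_history \<rho> (V \<omega>) (\<lambda>k. A k \<omega>) (\<lambda>k. S k \<omega>)) n x \<longlonglongrightarrow> cdf R x"
    and sigma: "\<sigma> = lst G mu / (1 - lst R mu)"
  shows "lst R mu \<noteq> 1 \<and>
    (\<forall>n\<ge>1. \<pi> n \<noteq> 0 \<and> a (n - 1) \<noteq> 0 \<and>
       \<pi> (n + 1) / \<pi> n = a n / a (n - 1) \<and> a n / a (n - 1) = \<sigma>) \<and>
    (\<forall>m\<ge>1. \<forall>n\<ge>1. \<pi> (m + 1) / \<pi> m = \<pi> (n + 1) / \<pi> n \<and> a m / a (m - 1) = a n / a (n - 1))"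
proof -
  interpret stable_gm1_queue M A S V \<rho> G lam mu by (rule queue)
  have arrival_lim: "AE \<omega> in M. arrival_freq (q.path.hist \<omega>) n \<longlonglongrightarrow> a n" for n
    using arrival_prob[of n] AE_nonneg_inputs by eventually_elim simp
  have time_lim: "AE \<omega> in M. (time_freq (q.path.hist \<omega>) n \<longlongrightarrow> \<pi> n) at_top" for n
    using time_prob[of n] AE_nonneg_inputs by eventually_elim simp
  have residual_lim: "AE \<omega> in M. departure_residual_freq (Apos \<omega>) (q.path.hist \<omega>) n x \<longlonglongrightarrow> cdf R x" for n x
    using residual[of n x] AE_nonneg_inputs by eventually_elim simp
  note rec = arrival_prob_rec[OF arrival_lim residual_distribution residual_lim]
  note a0 = empty_prob_pos[OF arrival_lim]
  \<comment> \<open>Otherwise the recursion for \<open>n = 1\<close> would read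
    \<open>0 = a 0 * lst G mu\<close>, a product of positive factors.\<close>
  have R: "lst R mu \<noteq> 1"
    using rec[of 1] a0 lst_G_pos by auto
  have a_Suc: "a (Suc n) = \<sigma> * a n" for n
    using rec[of "Suc n"] R by (simp add: sigma field_simps)
  have "\<sigma> \<noteq> 0" using R lst_G_pos by (simp add: sigma)
  then have a_neq: "a n \<noteq> 0" for n
    using a0 by (induction n) (auto simp: a_Suc)
  then have \<pi>_neq: "\<pi> (Suc n) \<noteq> 0" for n
    by (intro time_prob_nonzero[OF arrival_lim time_lim])
  have ratios: "\<pi> n \<noteq> 0 \<and> a (n - 1) \<noteq> 0 \<and> \<pi> (n + 1) / \<pi> n = a n / a (n - 1) \<and> a n / a (n - 1) = \<sigma>"
    if "1 \<le> n" for n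
  proof -
    from that obtain k where n: "n = Suc k" by (cases n) auto
    have "a k * \<pi> (Suc (Suc k)) = a (Suc k) * \<pi> (Suc k)"
      by (rule time_prob_ratio[OF arrival_lim time_lim])
    then show ?thesis
      using a_neq[of k] \<pi>_neq[of k] a_Suc[of k] by (simp add: n field_simps)
  qed
  then show ?thesis using R by auto
qed

end
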